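(* Let $\mathbb F$ be a field with a non-trivial Galois automorphism $\sigma$ of order $2$ and fixed field $\mathbb F_0=\{a\in\mathbb F\mid \sigma(a)=a\}$. Let $V$ be a finite dimensional vector space over $\mathbb F$ with a non-degenerate hermitian form $B$ (with respect to $\sigma$). Suppose that the fixed field $\mathbb F_0$ has the property FE. Then the number of $z$-classes in the unitary group $U(V,B)$ is finite.
   Context: Write $\bar a=\sigma(a)$. A hermitian form on $V$ is a map $B\colon V\times V\to\mathbb F$ that is sesquilinear with respect to $\sigma$ (linear in the first variable, $\sigma$-semilinear in the second) and satisfies $B(u,v)=\overline{B(v,u)}$ for all $u,v\in V$. The unitary group is $U(V,B)=\{g\in GL(V)\mid B(g(u),g(v))=B(u,v)\ \text{for all } u,v\in V\}$. Property FE: a perfect field of characteristic $\neq 2$ has the property FE if it has only finitely many field extensions (up to isomorphism) of any finite degree. $z$-classes: for a group $G$, two elements $x,y\in G$ are $z$-equivalent if their centralizers in $G$ are conjugate, i.e. $\mathcal Z_G(y)=g\mathcal Z_G(x)g^{-1}$ for some $g\in G$, where $\mathcal Z_G(x)$ denotes the centralizer of $x$ in $G$. The equivalence classes are called $z$-classes. *)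

theory Defs
  imports "HOL-Algebra.Algebra"
begin

section \<open>Fields with property FE\<close>

text \<open>
  A field extension of degree \<open>n\<close> of \<open>K\<close> is a field \<open>L\<close> together with an
  embedding \<open>i\<close> of \<open>K\<close> into \<open>L\<close>, such that \<open>L\<close> has dimension \<open>n\<close> over the image of \<open>i\<close>.
  Isomorphisms of extensions are the identity on \<open>K\<close>.
\<close>

definition field_extension ::
    "('a, 'm) ring_scheme \<Rightarrow> nat \<Rightarrow> 'b ring \<Rightarrow> ('a \<Rightarrow> 'b) \<Rightarrow> bool" where
  "field_extension K n L i \<longleftrightarrow>
     field L \<and> i \<in> ring_hom K L \<and> ring.dimension L n (i ` carrier K) (carrier L)"

definition extension_iso ::
    "('a, 'm) ring_scheme \<Rightarrow> 'b ring \<Rightarrow> ('a \<Rightarrow> 'b) \<Rightarrow> 'c ring \<Rightarrow> ('a \<Rightarrow> 'c) \<Rightarrow> bool" where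
  "extension_iso K L i L' i' \<longleftrightarrow> (\<exists>h \<in> ring_iso L L'. \<forall>a \<in> carrier K. h (i a) = i' a)"

text \<open>
  HOL cannot quantify over all carrier types of \<open>L\<close>. An extension of degree \<open>n\<close> of a field
  with elements in \<open>'a\<close> is in bijection with the coordinate vectors of length \<open>n\<close>, so taking
  carriers inside \<open>'a list\<close> loses no isomorphism class; see \<open>field_extension_list_model\<close> below.
\<close>

definition field_extensions ::
    "('a, 'm) ring_scheme \<Rightarrow> nat \<Rightarrow> ('a list ring \<times> ('a \<Rightarrow> 'a list)) set" where
  "field_extensions K n = {(L, i). field_extension K n L i}"

definition extension_rel ::
    "('a, 'm) ring_scheme \<Rightarrow> nat \<Rightarrow> ('a list ring \<times> ('a \<Rightarrow> 'a list)) rel" where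
  "extension_rel K n =
     {((L, i), (L', i')). (L, i) \<in> field_extensions K n \<and> (L', i') \<in> field_extensions K n \<and>
        extension_iso K L i L' i'}"

text \<open>
  Perfect: characteristic \<open>0\<close>, or prime characteristic \<open>p\<close> and every element is a \<open>p\<close>-th power.
  In a field, a prime \<open>p\<close> with \<open>p \<cdot> \<one> = \<zero>\<close> is necessarily the characteristic.
\<close>

definition perfect_field :: "('a, 'm) ring_scheme \<Rightarrow> bool" where
  "perfect_field K \<longleftrightarrow> field K \<and>
     (\<forall>p :: nat. Factorial_Ring.prime p \<and> add_pow K p \<one>\<^bsub>K\<^esub> = \<zero>\<^bsub>K\<^esub> \<longrightarrow>
        (\<forall>a \<in> carrier K. \<exists>b \<in> carrier K. b [^]\<^bsub>K\<^esub> p = a))"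

definition property_FE :: "('a, 'm) ring_scheme \<Rightarrow> bool" where
  "property_FE K \<longleftrightarrow> perfect_field K \<and> add_pow K (2 :: nat) \<one>\<^bsub>K\<^esub> \<noteq> \<zero>\<^bsub>K\<^esub> \<and>
     (\<forall>n. finite (field_extensions K n // extension_rel K n))"

lemma equiv_extension_rel: "equiv (field_extensions K n) (extension_rel K n)"
proof (rule equivI)
  show "extension_rel K n \<subseteq> field_extensions K n \<times> field_extensions K n"
    by (auto simp: extension_rel_def)
  show "refl_on (field_extensions K n) (extension_rel K n)"
    by (auto simp: refl_on_def extension_rel_def extension_iso_def
        intro!: bexI[of _ id] ring_iso_set_refl)
  show "sym (extension_rel K n)"
  proof (rule symI)
    fix E E' assume "(E, E') \<in> extension_rel K n"
    then obtain L i L' i' h where E: "E = (L, i)" "E' = (L', i')"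
      and ext: "field_extension K n L i" "field_extension K n L' i'"
      and h: "h \<in> ring_iso L L'" "\<And>a. a \<in> carrier K \<Longrightarrow> h (i a) = i' a"
      by (auto simp: extension_rel_def extension_iso_def field_extensions_def)
    have ring: "ring L"
      using ext(1) by (simp add: field_extension_def field.is_ring)
    have "inv_into (carrier L) h (i' a) = i a" if "a \<in> carrier K" for a
    proof -
      have "i a \<in> carrier L"
        using ext(1) that by (auto simp: field_extension_def ring_hom_closed)
      then show ?thesis
        using h that by (metis bij_betw_def inv_into_f_f ring_iso_memE(5))
    qed
    then show "(E', E) \<in> extension_rel K n"
      using E ext ring_iso_set_sym[OF ring h(1)]
      by (auto simp: extension_rel_def extension_iso_def field_extensions_def)
  qed
  show "trans (extension_rel K n)"
  proof (rule transI)
    fix E E' E'' assume "(E, E') \<in> extension_rel K n" "(E', E'') \<in> extension_rel K n"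
    moreover obtain L i L' i' L'' i'' where "E = (L, i)" "E' = (L', i')" "E'' = (L'', i'')"
      by (cases E, cases E', cases E'') auto
    ultimately obtain h k where E: "E = (L, i)" "E'' = (L'', i'')"
      and ext: "field_extension K n L i" "field_extension K n L'' i''"
      and h: "h \<in> ring_iso L L'" "\<And>a. a \<in> carrier K \<Longrightarrow> h (i a) = i' a"
      and k: "k \<in> ring_iso L' L''" "\<And>a. a \<in> carrier K \<Longrightarrow> k (i' a) = i'' a"
      by (auto simp: extension_rel_def extension_iso_def field_extensions_def)
    have "k \<circ> h \<in> ring_iso L L''"
      using ring_iso_set_trans[OF h(1) k(1)] .
    then show "(E, E'') \<in> extension_rel K n"
      using E ext h(2) k(2)
      by (auto simp: extension_rel_def extension_iso_def field_extensions_def intro!: bexI[of _ "k \<circ> h"])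
  qed
qed

lemma field_extension_list_model:
  fixes K :: "('a, 'm) ring_scheme" and L :: "'b ring"
  assumes K: "field K" and ext: "field_extension K n L i"
  shows "\<exists>(L' :: 'a list ring) i'. (L', i') \<in> field_extensions K n \<and> extension_iso K L i L' i'"
proof -
  have L: "field L" and i: "i \<in> ring_hom K L"
    and dim: "ring.dimension L n (i ` carrier K) (carrier L)"
    using ext by (auto simp: field_extension_def)
  interpret K: field K by fact
  interpret L: field L by fact
  interpret i: ring_hom_ring K L i
    by (intro ring_hom_ringI2 i K.is_ring L.is_ring)
  have sub: "subfield (i ` carrier K) L"
    using i.img_is_subfield(2)[OF K.carrier_is_subfield] by simp
  obtain Us where Us: "set Us \<subseteq> carrier L" "L.Span (i ` carrier K) Us = carrier L"
    using L.exists_base[OF sub dim] by blast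
  note span = trans[OF Us(2)[symmetric] L.Span_eq_combine_set[OF sub Us(1)]]
  have "\<exists>ks. L.combine (map i ks) Us = x" if x: "x \<in> carrier L" for x
  proof -
    obtain Ks where Ks: "set Ks \<subseteq> i ` carrier K" "x = L.combine Ks Us"
      using eqset_imp_iff[OF span, THEN iffD1, OF x] by blast
    then have "\<forall>k \<in> set Ks. \<exists>a. k = i a"
      by blast
    then obtain ks where "Ks = map i ks"
      unfolding ex_map_conv[symmetric] by blast
    then show ?thesis using Ks(2) by blast
  qed
  then obtain f where f: "\<forall>x \<in> carrier L. L.combine (map i (f x)) Us = x"
    using bchoice[of "carrier L" "\<lambda>x ks. L.combine (map i ks) Us = x"] by blast
  have inj: "inj_on f (carrier L)"
    by (rule inj_on_inverseI[of _ "\<lambda>ks. L.combine (map i ks) Us"]) (use f in blast)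
  let ?L' = "image_ring f L"
  have iso: "f \<in> ring_iso L ?L'"
    by (rule inj_imp_image_ring_iso[OF inj])
  have L': "field ?L'"
    by (rule L.inj_imp_image_ring_is_field[OF inj])
  interpret L': field ?L' by fact
  have hom: "f \<in> ring_hom L ?L'" using iso by (simp add: ring_iso_def)
  interpret f: ring_hom_ring L ?L' f
    by (intro ring_hom_ringI2 hom L.is_ring L'.is_ring)
  have "L'.dimension n (f ` (i ` carrier K)) (f ` carrier L)"
    by (rule f.inj_hom_dimension[OF sub _ inj dim]) simp
  then have "field_extension K n ?L' (f \<circ> i)"
    using L' ring_hom_trans[OF i hom]
    by (simp add: field_extension_def image_comp image_ring_carrier)
  moreover have "extension_iso K L i ?L' (f \<circ> i)"
    using iso by (auto simp: extension_iso_def)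
  ultimately show ?thesis
    by (auto simp: field_extensions_def)
qed


section \<open>Hermitian forms and the unitary group\<close>

definition order_two_automorphism :: "('f :: Fields.field \<Rightarrow> 'f) \<Rightarrow> bool" where
  "order_two_automorphism \<sigma> \<longleftrightarrow>
     bij \<sigma> \<and> (\<forall>a b. \<sigma> (a + b) = \<sigma> a + \<sigma> b) \<and> (\<forall>a b. \<sigma> (a * b) = \<sigma> a * \<sigma> b) \<and>
     \<sigma> \<noteq> id \<and> \<sigma> \<circ> \<sigma> = id"

definition fixed_field :: "('f :: Fields.field \<Rightarrow> 'f) \<Rightarrow> 'f ring" where
  "fixed_field \<sigma> = \<lparr>carrier = {a. \<sigma> a = a}, monoid.mult = (*), one = 1, ring.zero = 0, add = (+)\<rparr>"

definition hermitian_form ::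
    "('f :: Fields.field \<Rightarrow> 'f) \<Rightarrow> ('f \<Rightarrow> 'v :: ab_group_add \<Rightarrow> 'v) \<Rightarrow> ('v \<Rightarrow> 'v \<Rightarrow> 'f) \<Rightarrow> bool" where
  "hermitian_form \<sigma> scale B \<longleftrightarrow>
     (\<forall>u v w. B (u + v) w = B u w + B v w) \<and>
     (\<forall>a u v. B (scale a u) v = a * B u v) \<and>
     (\<forall>u v w. B u (v + w) = B u v + B u w) \<and>
     (\<forall>a u v. B u (scale a v) = \<sigma> a * B u v) \<and>
     (\<forall>u v. B u v = \<sigma> (B v u))"

definition nondegenerate :: "('v :: ab_group_add \<Rightarrow> 'v \<Rightarrow> 'f :: Fields.field) \<Rightarrow> bool" where
  "nondegenerate B \<longleftrightarrow> (\<forall>u. (\<forall>v. B u v = 0) \<longrightarrow> u = 0)"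

definition general_linear_group ::
    "('f :: Fields.field \<Rightarrow> 'v :: ab_group_add \<Rightarrow> 'v) \<Rightarrow> ('v \<Rightarrow> 'v) monoid" where
  "general_linear_group scale =
     \<lparr>carrier = {g. Vector_Spaces.linear scale scale g \<and> bij g}, monoid.mult = (\<circ>), one = id\<rparr>"

definition unitary_group ::
    "('f :: Fields.field \<Rightarrow> 'v :: ab_group_add \<Rightarrow> 'v) \<Rightarrow> ('v \<Rightarrow> 'v \<Rightarrow> 'f) \<Rightarrow> ('v \<Rightarrow> 'v) monoid" where
  "unitary_group scale B =
     (general_linear_group scale)
       \<lparr>carrier := {g \<in> carrier (general_linear_group scale). \<forall>u v. B (g u) (g v) = B u v}\<rparr>"

lemma field_fixed_field:
  assumes "order_two_automorphism \<sigma>"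
  shows "field (fixed_field \<sigma>)"
proof -
  have add: "\<sigma> (a + b) = \<sigma> a + \<sigma> b" and mult: "\<sigma> (a * b) = \<sigma> a * \<sigma> b" and inj: "inj \<sigma>" for a b
    using assms by (auto simp: order_two_automorphism_def bij_def)
  have zero: "\<sigma> 0 = 0" using add[of 0 0] by (metis add.right_neutral add_left_cancel)
  have "\<sigma> 1 \<noteq> 0" using inj zero by (metis injD zero_neq_one)
  then have one: "\<sigma> 1 = 1" using mult[of 1 1] by simp
  have minus: "\<sigma> (- a) = - \<sigma> a" for a
    using add[of a "- a"] zero by (simp add: eq_neg_iff_add_eq_0 add.commute)
  have inverse: "\<sigma> (inverse a) = inverse (\<sigma> a)" if "a \<noteq> 0" for a
    using mult[of a "inverse a"] one that by (metis inverse_unique right_inverse)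
  have neg: "\<exists>y. \<sigma> y = y \<and> y + a = 0 \<and> a + y = 0" if "\<sigma> a = a" for a
    using minus[of a] that by (intro exI[of _ "- a"]) simp
  have inv: "\<exists>y. \<sigma> y = y \<and> y * a = 1 \<and> a * y = 1" if "\<sigma> a = a" "a \<noteq> 0" for a
    using inverse[of a] that by (intro exI[of _ "inverse a"]) simp
  show ?thesis
    unfolding fixed_field_def
    by unfold_locales
      (auto simp: add mult zero one distrib_left distrib_right add.assoc mult.assoc Units_def neg inv
        intro: add.commute mult.commute)
qed

lemma group_unitary_group:
  assumes "vector_space scale"
  shows "group (unitary_group scale B)"
proof (rule groupI)
  interpret vector_space scale by fact
  fix f g h
  show "\<one>\<^bsub>unitary_group scale B\<^esub> \<in> carrier (unitary_group scale B)"
    by (simp add: unitary_group_def general_linear_group_def linear_id)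
  show "f \<otimes>\<^bsub>unitary_group scale B\<^esub> g \<in> carrier (unitary_group scale B)"
    if "f \<in> carrier (unitary_group scale B)" "g \<in> carrier (unitary_group scale B)"
    using that
    by (auto simp: unitary_group_def general_linear_group_def bij_comp
        intro: Vector_Spaces.linear_compose)
  show "f \<otimes>\<^bsub>unitary_group scale B\<^esub> g \<otimes>\<^bsub>unitary_group scale B\<^esub> h =
        f \<otimes>\<^bsub>unitary_group scale B\<^esub> (g \<otimes>\<^bsub>unitary_group scale B\<^esub> h)"
    by (simp add: unitary_group_def general_linear_group_def comp_assoc)
  show "\<one>\<^bsub>unitary_group scale B\<^esub> \<otimes>\<^bsub>unitary_group scale B\<^esub> f = f"
    by (simp add: unitary_group_def general_linear_group_def)
  show "\<exists>k \<in> carrier (unitary_group scale B). k \<otimes>\<^bsub>unitary_group scale B\<^esub> f = \<one>\<^bsub>unitary_group scale B\<^esub>"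
    if "f \<in> carrier (unitary_group scale B)"
  proof -
    let ?k = "Hilbert_Choice.inv f"
    have lin: "Vector_Spaces.linear scale scale f" and bij: "bij f"
      and B: "\<And>u v. B (f u) (f v) = B u v"
      using that by (auto simp: unitary_group_def general_linear_group_def)
    have fk: "f (?k x) = x" for x
      using bij by (simp add: bij_is_surj surj_f_inv_f)
    have kf: "?k \<circ> f = id"
      using bij by (simp add: bij_is_inj)
    have k_eq: "?k y = x" if "f x = y" for x y
      using that bij by (metis bij_is_inj inv_f_f)
    have "Vector_Spaces.linear scale scale ?k"
    proof -
      interpret f: Vector_Spaces.linear scale scale f by fact
      show ?thesis
        by unfold_locales (auto intro!: k_eq simp: fk f.add f.scale)
    qed
    moreover have "B (?k u) (?k v) = B u v" for u v
      using B[of "?k u" "?k v"] by (simp add: fk)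
    ultimately have "?k \<in> carrier (unitary_group scale B)"
      using bij by (simp add: unitary_group_def general_linear_group_def bij_imp_bij_inv)
    then show ?thesis
      using kf by (auto simp: unitary_group_def general_linear_group_def)
  qed
qed


section \<open>Conjugacy of centralizers\<close>

definition centralizer :: "('g, 'm) monoid_scheme \<Rightarrow> 'g \<Rightarrow> 'g set" where
  "centralizer G x = {y \<in> carrier G. x \<otimes>\<^bsub>G\<^esub> y = y \<otimes>\<^bsub>G\<^esub> x}"

definition z_rel :: "('g, 'm) monoid_scheme \<Rightarrow> 'g rel" where
  "z_rel G = {(x, y). x \<in> carrier G \<and> y \<in> carrier G \<and>
     (\<exists>g \<in> carrier G. centralizer G y = (g <#\<^bsub>G\<^esub> centralizer G x) #>\<^bsub>G\<^esub> (inv\<^bsub>G\<^esub> g))}"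

definition z_classes :: "('g, 'm) monoid_scheme \<Rightarrow> 'g set set" where
  "z_classes G = carrier G // z_rel G"

lemma (in group) equiv_z_rel: "equiv (carrier G) (z_rel G)"
proof -
  have conj: "(g <# S) #> (inv g) = (\<lambda>s. g \<otimes> s \<otimes> inv g) ` S" for g S
    by (auto simp: l_coset_def r_coset_def)
  have sub: "centralizer G x \<subseteq> carrier G" for x
    by (auto simp: centralizer_def)
  show ?thesis
  proof (rule equivI)
    show "z_rel G \<subseteq> carrier G \<times> carrier G"
      by (auto simp: z_rel_def)
    have "centralizer G x = \<one> <# centralizer G x #> inv \<one>" for x
      using sub[of x] by (simp add: lcos_mult_one coset_mult_one)
    then show "refl_on (carrier G) (z_rel G)"
      by (auto simp: refl_on_def z_rel_def intro!: bexI[of _ \<one>])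
    show "sym (z_rel G)"
    proof (rule symI)
      fix x y assume "(x, y) \<in> z_rel G"
      then obtain g where xy: "x \<in> carrier G" "y \<in> carrier G" and g: "g \<in> carrier G"
        and y: "centralizer G y = (\<lambda>s. g \<otimes> s \<otimes> inv g) ` centralizer G x"
        by (auto simp: z_rel_def conj)
      have "inv g \<otimes> (g \<otimes> s \<otimes> inv g) \<otimes> inv (inv g) = s" if "s \<in> carrier G" for s
        using g that by (simp add: m_assoc[symmetric]) (simp add: m_assoc)
      then have "centralizer G x = (\<lambda>s. inv g \<otimes> s \<otimes> inv (inv g)) ` centralizer G y"
        unfolding y image_image using sub[of x] by (force simp: subset_iff)
      then show "(y, x) \<in> z_rel G"
        using xy g by (auto simp: z_rel_def conj intro!: bexI[of _ "inv g"])
    qed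
    show "trans (z_rel G)"
    proof (rule transI)
      fix x y z assume "(x, y) \<in> z_rel G" "(y, z) \<in> z_rel G"
      then obtain g h where xz: "x \<in> carrier G" "z \<in> carrier G"
        and gh: "g \<in> carrier G" "h \<in> carrier G"
        and y: "centralizer G y = (\<lambda>s. g \<otimes> s \<otimes> inv g) ` centralizer G x"
        and z: "centralizer G z = (\<lambda>s. h \<otimes> s \<otimes> inv h) ` centralizer G y"
        by (auto simp: z_rel_def conj)
      have "h \<otimes> (g \<otimes> s \<otimes> inv g) \<otimes> inv h = (h \<otimes> g) \<otimes> s \<otimes> inv (h \<otimes> g)" if "s \<in> carrier G" for s
        using gh that by (simp add: m_assoc inv_mult_group)
      then have "centralizer G z = (\<lambda>s. (h \<otimes> g) \<otimes> s \<otimes> inv (h \<otimes> g)) ` centralizer G x"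
        unfolding z y image_image using sub[of x] by (auto simp: subset_iff intro!: image_cong)
      then show "(x, z) \<in> z_rel G"
        using xz gh by (auto simp: z_rel_def conj intro!: bexI[of _ "h \<otimes> g"])
    qed
  qed
qed

end

theory Submission
  imports Defs "HOL-Algebra.Algebraic_Closure_Type"
begin

text \<open>
  If the fixed field is finite, so is the unitary group. Otherwise a Cayley transform replaces
  every unitary operator by a self-adjoint operator \<open>S\<close> with the same centralizer, and
  \<open>V\<close> splits orthogonally into the primary components of \<open>S\<close> with respect to polynomials over the
  fixed field \<open>F\<^sub>0\<close>. On a component belonging to an irreducible \<open>p\<close>, the algebra \<open>F\<^sub>0[x]/p\<^sup>k\<close> depends,
  by perfectness, only on the extension \<open>F\<^sub>0[x]/p\<close>; by FE one may therefore change the generator \<open>S\<close> of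
  the algebra so that \<open>p\<close> lies in a fixed finite set. For fixed \<open>p\<close> the component is an orthogonal sum
  of cyclic pieces, and a cyclic piece is determined up to isometry by \<open>k\<close> and by a unit of
  \<open>F\<^sub>0[x]/p\<^sup>k\<close> modulo squares. The square classes are finite in number, since by Hensel lifting they are
  those of \<open>L = F\<^sub>0[x]/p\<close>, and the class of \<open>u\<close> is determined by the extension \<open>L(\<surd>u)\<close> of \<open>F\<^sub>0\<close> inside an
  algebraic closure.
\<close>

section \<open>Polynomials over the fixed field\<close>

text \<open>With a self-adjoint \<open>S\<close> in place of a unitary operator, every polynomial in
  \<open>S\<close> over the fixed field is self-adjoint. Primary components are then mutually
  orthogonal and each carries a nondegenerate form; for unitary operators they would be paired by a
  duality on polynomials. The Cayley transform needs an element of norm 1 that is not an eigenvalue,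
  and an infinite fixed field guarantees one. A centralizer depends only on the algebra that the
  operator generates. This freedom is essential: infinitely many \<open>p\<close> may occur, while
  FE bounds only the fields \<open>F_0[x]/p\<close>. A new generator \<open>s\<close> must produce
  the same algebra modulo \<open>p^k\<close>, nilpotents included, so \<open>r(s)\<close> is
  arranged to have exactly one factor \<open>p\<close>. FE counts abstract extensions up to
  isomorphism, whereas square roots are compared inside one algebraic closure. The bridge is that a
  finite extension has only finitely many embeddings into the closure. Characteristic different from
  2 is used to lift square roots, to find anisotropic vectors and to split scalars into fixed and
  skew parts.\<close>

locale involutive_field =
  fixes \<sigma> :: "'f :: Fields.field \<Rightarrow> 'f"
  assumes order_two: "order_two_automorphism \<sigma>"
begin

lemma conj_add [simp]: "\<sigma> (a + b) = \<sigma> a + \<sigma> b"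
  and conj_mult [simp]: "\<sigma> (a * b) = \<sigma> a * \<sigma> b"
  and conj_conj [simp]: "\<sigma> (\<sigma> a) = a"
  using order_two by (auto simp: order_two_automorphism_def fun_eq_iff)

lemma conj_0 [simp]: "\<sigma> 0 = 0"
  using conj_add[of 0 0] by (metis add.right_neutral add_left_cancel)

lemma conj_eq_iff [simp]: "\<sigma> a = \<sigma> b \<longleftrightarrow> a = b"
  by (metis conj_conj)

lemma conj_eq_0_iff [simp]: "\<sigma> a = 0 \<longleftrightarrow> a = 0"
  by (metis conj_conj conj_0)

lemma conj_1 [simp]: "\<sigma> 1 = 1"
  by (metis conj_eq_0_iff conj_mult mult_cancel_left1 mult_1 zero_neq_one)

lemma conj_minus [simp]: "\<sigma> (- a) = - \<sigma> a"
  using conj_add[of a "- a"] by (simp add: eq_neg_iff_add_eq_0 add.commute del: conj_add)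

lemma conj_diff [simp]: "\<sigma> (a - b) = \<sigma> a - \<sigma> b"
  using conj_add[of a "- b"] by simp

lemma conj_inverse [simp]: "\<sigma> (inverse a) = inverse (\<sigma> a)"
  by (metis conj_0 conj_1 conj_mult inverse_unique inverse_zero right_inverse)

lemma conj_divide [simp]: "\<sigma> (a / b) = \<sigma> a / \<sigma> b"
  by (simp add: divide_inverse)

lemma conj_sum: "\<sigma> (sum f A) = (\<Sum>x\<in>A. \<sigma> (f x))"
  by (induction A rule: infinite_finite_induct) auto

lemma conj_of_nat [simp]: "\<sigma> (of_nat n) = of_nat n"
  by (induction n) auto

lemma conj_numeral [simp]: "\<sigma> (numeral n) = numeral n"
  by (metis conj_of_nat of_nat_numeral)

text \<open>Multiplication by a skew element exchanges fixed and skew elements. It supplies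
  imaginary parts, and the factor that makes the Cayley transform self-adjoint.\<close>

lemma ex_skew: "\<exists>\<delta>. \<delta> \<noteq> 0 \<and> \<sigma> \<delta> = - \<delta>"
proof -
  obtain a where "\<sigma> a \<noteq> a"
    using order_two by (auto simp: order_two_automorphism_def fun_eq_iff)
  then show ?thesis
    by (intro exI[of _ "a - \<sigma> a"]) auto
qed

text \<open>
  Polynomials over the fixed field are represented as polynomials over the whole field with fixed
  coefficients; \<open>irr\<close> below is irreducibility over the fixed field.
\<close>

definition P0 :: "'f poly set" where
  "P0 = {p. \<forall>i. \<sigma> (Polynomial.coeff p i) = Polynomial.coeff p i}"

abbreviation conj_poly :: "'f poly \<Rightarrow> 'f poly" where
  "conj_poly \<equiv> map_poly \<sigma>"

lemma coeff_conj_poly [simp]: "Polynomial.coeff (conj_poly p) i = \<sigma> (Polynomial.coeff p i)"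
  by (simp add: coeff_map_poly)

lemma P0_iff: "p \<in> P0 \<longleftrightarrow> conj_poly p = p"
  by (auto simp: P0_def poly_eq_iff)

lemma conj_poly_conj_poly [simp]: "conj_poly (conj_poly p) = p"
  by (simp add: poly_eq_iff)

lemma conj_poly_eq_0_iff [simp]: "conj_poly p = 0 \<longleftrightarrow> p = 0"
  by (simp add: poly_eq_iff)

lemma degree_conj_poly [simp]: "Polynomial.degree (conj_poly p) = Polynomial.degree p"
  by (cases "p = 0") (simp_all add: map_poly_degree_eq)

lemma conj_poly_add: "conj_poly (p + q) = conj_poly p + conj_poly q"
  by (simp add: poly_eq_iff)

lemma conj_poly_mult: "conj_poly (p * q) = conj_poly p * conj_poly q"
  by (simp add: poly_eq_iff coeff_mult conj_sum)

lemma P0_0 [simp, intro]: "0 \<in> P0" and P0_1 [simp, intro]: "1 \<in> P0"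
  by (simp_all add: P0_iff)

lemma P0_add [simp, intro]: "p \<in> P0 \<Longrightarrow> q \<in> P0 \<Longrightarrow> p + q \<in> P0"
  and P0_diff [simp, intro]: "p \<in> P0 \<Longrightarrow> q \<in> P0 \<Longrightarrow> p - q \<in> P0"
  and P0_minus [simp, intro]: "p \<in> P0 \<Longrightarrow> - p \<in> P0"
  by (simp_all add: P0_def)

lemma P0_mult [simp, intro]: "p \<in> P0 \<Longrightarrow> q \<in> P0 \<Longrightarrow> p * q \<in> P0"
  by (simp add: P0_iff conj_poly_mult)

lemma P0_power [simp, intro]: "p \<in> P0 \<Longrightarrow> p ^ n \<in> P0"
  by (induction n) auto

lemma P0_pCons_iff [simp]: "pCons a p \<in> P0 \<longleftrightarrow> \<sigma> a = a \<and> p \<in> P0"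
  by (auto simp: P0_def coeff_pCons split: nat.splits)

lemma P0_pcompose [simp, intro]: "p \<in> P0 \<Longrightarrow> q \<in> P0 \<Longrightarrow> pcompose p q \<in> P0"
  by (induction p) (auto simp: pcompose_pCons)

lemma P0_pderiv [simp, intro]: "p \<in> P0 \<Longrightarrow> pderiv p \<in> P0"
  by (simp add: P0_def coeff_pderiv)

text \<open>Conjugating a division with remainder gives another one for the same pair, and quotient
  and remainder are unique.\<close>

lemma P0_div_mod:
  assumes "p \<in> P0" "q \<in> P0"
  shows P0_div [simp, intro]: "p div q \<in> P0" and P0_mod [simp, intro]: "p mod q \<in> P0"
proof -
  have "(p div q, p mod q) = (conj_poly (p div q), conj_poly (p mod q))"
  proof (cases "q = 0")
    case True
    then show ?thesis using assms by (simp add: P0_iff)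
  next
    case False
    have "p = conj_poly (p div q) * q + conj_poly (p mod q)"
      using assms by (metis P0_iff conj_poly_add conj_poly_mult div_mult_mod_eq)
    moreover have "conj_poly (p mod q) = 0 \<or> Polynomial.degree (conj_poly (p mod q)) < Polynomial.degree q"
      using False degree_mod_less[of q p] by auto
    ultimately show ?thesis
      using False
      by (metis (no_types, lifting) add.commute add_cancel_right_left degree_0 div_poly_less div_mult_self1 mod_mult_self1
          mod_poly_less mod_0 div_0 mult.commute)
  qed
  then show "p div q \<in> P0" "p mod q \<in> P0" by (simp_all add: P0_iff)
qed

lemma P0_bezout:
  assumes "p \<in> P0" "f \<in> P0" "p \<noteq> 0"
  shows "\<exists>u\<in>P0. \<exists>v\<in>P0. u * f + v * p \<noteq> 0 \<and> (u * f + v * p) dvd f \<and> (u * f + v * p) dvd p"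
  using assms
\<comment> \<open>The measure puts the zero polynomial below the nonzero constants, so that a zero
  remainder also counts as a decrease.\<close>
proof (induction "if f = 0 then 0 else Suc (Polynomial.degree f)" arbitrary: f p rule: less_induct)
  case less
  show ?case
  proof (cases "f = 0")
    case True
    then show ?thesis using less.prems by (intro bexI[of _ 0] bexI[of _ 1]) auto
  next
    case False
    then have "(if p mod f = 0 then 0 else Suc (Polynomial.degree (p mod f)))
        < (if f = 0 then 0 else Suc (Polynomial.degree f))"
      using degree_mod_less[of f p] by auto
    from less.hyps[OF this] obtain u v where uv: "u \<in> P0" "v \<in> P0"
      and g: "u * (p mod f) + v * f \<noteq> 0" "(u * (p mod f) + v * f) dvd (p mod f)"
        "(u * (p mod f) + v * f) dvd f"
      using less.prems False by (metis P0_mod)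
    have eq: "u * (p mod f) + v * f = (v - u * (p div f)) * f + u * p"
      by (simp add: algebra_simps flip: minus_div_mult_eq_mod)
    have "(u * (p mod f) + v * f) dvd p"
      using g by (meson dvd_mod_iff)
    then show ?thesis
      using g uv less.prems unfolding eq by blast
  qed
qed

definition irr :: "'f poly \<Rightarrow> bool" where
  "irr p \<longleftrightarrow> p \<in> P0 \<and> Polynomial.degree p > 0 \<and>
     (\<forall>q\<in>P0. q dvd p \<longrightarrow> Polynomial.degree q = 0 \<or> Polynomial.degree q = Polynomial.degree p)"

lemma irrD: "irr p \<Longrightarrow> p \<in> P0" "irr p \<Longrightarrow> p \<noteq> 0"
  by (auto simp: irr_def)

lemma irr_not_dvd_1: "irr p \<Longrightarrow> \<not> p dvd 1"
  by (auto simp: irr_def dest: dvd_imp_degree_le)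

lemma ex_irr_dvd:
  assumes "q \<in> P0" "Polynomial.degree q > 0"
  shows "\<exists>p. irr p \<and> p dvd q"
proof -
  let ?A = "\<lambda>p. p \<in> P0 \<and> Polynomial.degree p > 0 \<and> p dvd q"
  obtain p where p: "?A p" and min: "\<And>y. ?A y \<Longrightarrow> Polynomial.degree p \<le> Polynomial.degree y"
    using assms ex_has_least_nat[of ?A q Polynomial.degree] by auto
  have "irr p"
    unfolding irr_def
  proof (intro conjI ballI impI)
    fix r assume r: "r \<in> P0" "r dvd p"
    have "Polynomial.degree r \<le> Polynomial.degree p"
      using r p by (auto intro!: dvd_imp_degree_le)
    moreover have "Polynomial.degree p \<le> Polynomial.degree r" if "Polynomial.degree r > 0"
      using min[of r] r p that dvd_trans by blast
    ultimately show "Polynomial.degree r = 0 \<or> Polynomial.degree r = Polynomial.degree p" by force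
  qed (use p in auto)
  then show ?thesis using p by blast
qed

lemma irr_coprime:
  assumes "irr p" "f \<in> P0" "\<not> p dvd f"
  shows "\<exists>u\<in>P0. \<exists>v\<in>P0. u * f + v * p = 1"
proof -
  have p: "p \<in> P0" "p \<noteq> 0" using assms(1) by (auto simp: irr_def)
  obtain u v where uv: "u \<in> P0" "v \<in> P0" and g0: "u * f + v * p \<noteq> 0"
    and gf: "(u * f + v * p) dvd f" and gp: "(u * f + v * p) dvd p"
    using P0_bezout[OF p(1) assms(2) p(2)] by blast
  define g where "g = u * f + v * p"
  have gP: "g \<in> P0" using uv p assms by (auto simp: g_def)
  \<comment> \<open>A common divisor of full degree would be associated to \<open>p\<close> and
    force \<open>p dvd f\<close>.\<close>
  have "Polynomial.degree g \<noteq> Polynomial.degree p"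
  proof
    assume eq: "Polynomial.degree g = Polynomial.degree p"
    obtain c where c: "p = g * c" using gp g_def by (auto)
    then have "Polynomial.degree c = 0" "c \<noteq> 0"
      using eq p by (auto simp: degree_mult_eq)
    then obtain c' where "c = [:c':]" "c' \<noteq> 0" by (metis degree_eq_zeroE pCons_eq_0_iff)
    then have "p dvd g" using c by (simp add: smult_dvd_iff)
    then show False using gf assms(3) g_def dvd_trans by blast
  qed
  then have "Polynomial.degree g = 0"
    using assms(1) gP gp unfolding irr_def g_def by blast
  then obtain c where c: "g = [:c:]" by (rule degree_eq_zeroE)
  have c0: "c \<noteq> 0" "\<sigma> c = c" using g0 gP c by (auto simp: g_def)
  have "[:inverse c:] * g = 1" using c c0 by (simp add: one_pCons)
  then have "([:inverse c:] * u) * f + ([:inverse c:] * v) * p = 1"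
    by (simp only: g_def distrib_left mult.assoc)
  moreover have "[:inverse c:] \<in> P0" using c0 by simp
  ultimately show ?thesis using uv by (metis P0_mult)
qed

lemma irr_prime:
  assumes "irr p" "f \<in> P0" "g \<in> P0" "p dvd f * g"
  shows "p dvd f \<or> p dvd g"
proof (rule disjCI)
  assume "\<not> p dvd g"
  then obtain u v where "u * g + v * p = 1" using irr_coprime assms by blast
  then have "f = u * (f * g) + (f * v) * p" by (metis mult.right_neutral distrib_left mult.assoc mult.left_commute)
  then show "p dvd f" using assms(4) by (metis dvd_add dvd_mult dvd_triv_right)
qed

lemma irr_dvd_power:
  assumes "irr p" "f \<in> P0" "p dvd f ^ n"
  shows "p dvd f"
  using assms(3)
proof (induction n)
  case 0
  then show ?case using irr_not_dvd_1[OF assms(1)] by simp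
next
  case (Suc n)
  then show ?case using irr_prime[OF assms(1,2), of "f ^ n"] assms by auto
qed

lemma irr_coprime_power:
  assumes "irr p" "f \<in> P0" "\<not> p dvd f"
  shows "\<exists>u\<in>P0. \<exists>v\<in>P0. u * f + v * p ^ k = 1"
proof (induction k)
  case 0
  show ?case by (intro bexI[of _ 0] bexI[of _ 1]) auto
next
  case (Suc k)
  then obtain u v where uv: "u \<in> P0" "v \<in> P0" "u * f + v * p ^ k = 1" by blast
  obtain u' v' where uv': "u' \<in> P0" "v' \<in> P0" "u' * f + v' * p = 1"
    using irr_coprime assms by blast
  have "1 = (u * f + v * p ^ k) * (u' * f + v' * p)" using uv uv' by simp
  also have "\<dots> = (u * (u' * f + v' * p) + v * p ^ k * u') * f + (v * v') * p ^ Suc k"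
    by (simp add: algebra_simps)
  finally show ?case
    using uv uv' irrD(1)[OF assms(1)] assms(2)
    by (intro bexI[of _ "u * (u' * f + v' * p) + v * p ^ k * u'"] bexI[of _ "v * v'"]) auto
qed

text \<open>The ideals of \<open>F_0[x]/p^k\<close> form a chain, so the ideal of any nonzero
  \<open>f\<close> contains the smallest nonzero one, generated by \<open>p^(k-1)\<close>. In
  \<open>dvd_of_orthogonal\<close> this detects divisibility by \<open>p^k\<close> from a single
  value of a functional.\<close>

lemma irr_power_gcd:
  assumes "irr p" "f \<in> P0" "\<not> p ^ k dvd f"
  shows "\<exists>u\<in>P0. \<exists>v\<in>P0. u * f + v * p ^ k = p ^ (k - 1)"
  using assms(2,3)
proof (induction k arbitrary: f)
  case (Suc k)
  show ?case
  proof (cases "p dvd f")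
    case False
    then obtain u v where uv: "u \<in> P0" "v \<in> P0" "u * f + v * p ^ Suc k = 1"
      using irr_coprime_power[OF assms(1) Suc.prems(1)] by blast
    then have "(p ^ k * u) * f + (p ^ k * v) * p ^ Suc k = p ^ k"
      by (metis distrib_left mult.assoc mult.right_neutral)
    then show ?thesis using uv irrD(1)[OF assms(1)] by (metis P0_mult P0_power diff_Suc_1)
  next
    case True
    then obtain g where g: "f = p * g" by (auto)
    then have gP: "g \<in> P0"
      using P0_div[OF Suc.prems(1) irrD(1)[OF assms(1)]] irrD(2)[OF assms(1)] by simp
    have "\<not> p ^ k dvd g" using Suc.prems(2) g by auto
    then have "k \<noteq> 0" by (intro notI) simp
    obtain u v where uv: "u \<in> P0" "v \<in> P0" "u * g + v * p ^ k = p ^ (k - 1)"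
      using Suc.IH[OF gP \<open>\<not> p ^ k dvd g\<close>] by blast
    have "u * f + v * p ^ Suc k = p * (u * g + v * p ^ k)"
      by (simp add: g algebra_simps)
    also have "\<dots> = p ^ k" using uv \<open>k \<noteq> 0\<close> by (cases k) auto
    finally show ?thesis using uv by auto
  qed
qed simp

end

section \<open>Separability and lifting modulo powers of an irreducible polynomial\<close>

lemma add_power_prime_char:
  fixes x y :: "'a :: comm_ring_1"
  assumes "Factorial_Ring.prime n" "of_nat n = (0 :: 'a)"
  shows "(x + y) ^ n = x ^ n + y ^ n"
proof -
  have n: "n > 0" using assms(1) by (simp add: prime_gt_0_nat)
  have "(x + y) ^ n = (\<Sum>k\<le>n. of_nat (n choose k) * x ^ k * y ^ (n - k))"
    by (rule binomial_ring)
  also have "\<dots> = (\<Sum>k\<in>{0, n}. of_nat (n choose k) * x ^ k * y ^ (n - k))"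
  proof (rule sum.mono_neutral_right)
    show "\<forall>k\<in>{..n} - {0, n}. of_nat (n choose k) * x ^ k * y ^ (n - k) = 0"
    proof
      fix k assume "k \<in> {..n} - {0, n}"
      then have "n dvd (n choose k)"
        using assms(1) n by (intro dvd_choose_prime) auto
      then have "of_nat (n choose k) = (0 :: 'a)"
        using assms(2) by (metis dvd_def mult_zero_left of_nat_mult)
      then show "of_nat (n choose k) * x ^ k * y ^ (n - k) = 0" by simp
    qed
  qed auto
  also have "\<dots> = x ^ n + y ^ n" using n by (simp add: add.commute)
  finally show ?thesis .
qed

lemma sum_power_prime_char:
  fixes f :: "'b \<Rightarrow> 'a :: comm_ring_1"
  assumes "Factorial_Ring.prime n" "of_nat n = (0 :: 'a)"
  shows "(\<Sum>i\<in>A. f i) ^ n = (\<Sum>i\<in>A. f i ^ n)"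
  using prime_gt_0_nat[OF assms(1)]
  by (induction A rule: infinite_finite_induct) (auto simp: add_power_prime_char[OF assms] zero_power)

lemma dvd_pcompose_diff: "a - b dvd pcompose h a - pcompose h (b :: 'a :: comm_ring_1 poly)"
proof (induction h)
  case (pCons c h)
  have "pcompose (pCons c h) a - pcompose (pCons c h) b =
      (a - b) * pcompose h a + b * (pcompose h a - pcompose h b)"
    by (simp add: pcompose_pCons algebra_simps)
  then show ?case using pCons by (metis dvd_add dvd_mult dvd_triv_left)
qed auto

text \<open>First-order Taylor expansion, proved along Horner's rule so that no factorials have to
  be inverted.\<close>

lemma pcompose_taylor_dvd:
  fixes g z :: "'a :: idom poly"
  shows "z ^ 2 dvd pcompose r (g + z) - pcompose r g - pcompose (pderiv r) g * z"
proof (induction r)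
  case (pCons a r)
  have "pcompose (pCons a r) (g + z) - pcompose (pCons a r) g - pcompose (pderiv (pCons a r)) g * z
     = (g + z) * (pcompose r (g + z) - pcompose r g - pcompose (pderiv r) g * z)
       + z ^ 2 * pcompose (pderiv r) g"
    by (simp add: pcompose_pCons pderiv_pCons pcompose_add algebra_simps power2_eq_square)
  then show ?case using pCons by (metis dvd_add dvd_mult dvd_triv_left)
qed auto

locale fe_field = involutive_field \<sigma> for \<sigma> :: "'f :: Fields.field \<Rightarrow> 'f" +
  assumes FE: "property_FE (fixed_field \<sigma>)"
begin

sublocale K0: field "fixed_field \<sigma>"
  by (rule field_fixed_field[OF order_two])

lemma fixed_field_simps [simp]:
  "carrier (fixed_field \<sigma>) = {a. \<sigma> a = a}" "\<one>\<^bsub>fixed_field \<sigma>\<^esub> = 1" "\<zero>\<^bsub>fixed_field \<sigma>\<^esub> = 0"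
  "x \<otimes>\<^bsub>fixed_field \<sigma>\<^esub> y = x * y" "x \<oplus>\<^bsub>fixed_field \<sigma>\<^esub> y = x + y"
  by (simp_all add: fixed_field_def)

lemma add_pow_fixed_field: "add_pow (fixed_field \<sigma>) (n :: nat) 1 = of_nat n"
  by (induction n) (use K0.add.nat_pow_0 K0.add.nat_pow_Suc in \<open>auto simp: add.commute\<close>)

lemma nat_pow_fixed_field: "b [^]\<^bsub>fixed_field \<sigma>\<^esub> (n :: nat) = b ^ n"
  by (induction n) (auto simp: mult.commute)

lemma two_neq_0: "(2 :: 'f) \<noteq> 0"
  using FE by (auto simp: property_FE_def add_pow_fixed_field)

lemma ex_root_char:
  assumes "Factorial_Ring.prime n" "of_nat n = (0 :: 'f)" "\<sigma> a = a"
  shows "\<exists>b. \<sigma> b = b \<and> b ^ n = a"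
  using FE assms by (auto simp: property_FE_def perfect_field_def add_pow_fixed_field nat_pow_fixed_field)

text \<open>Separability from perfectness. A vanishing derivative leaves only exponents divisible by
  the characteristic \<open>n\<close>; with \<open>n\<close>-th roots of the coefficients in the
  fixed field, \<open>r\<close> becomes an \<open>n\<close>-th power, against
  irreducibility.\<close>

lemma irr_not_dvd_pderiv:
  assumes "irr r"
  shows "\<not> r dvd pderiv r"
proof
  assume "r dvd pderiv r"
  have deg: "Polynomial.degree r > 0" using assms by (simp add: irr_def)
  have "pderiv r = 0"
  proof (rule ccontr)
    assume "pderiv r \<noteq> 0"
    then have "Polynomial.degree r \<le> Polynomial.degree (pderiv r)"
      using \<open>r dvd pderiv r\<close> by (simp add: dvd_imp_degree_le)
    moreover have "Polynomial.degree (pderiv r) \<le> Polynomial.degree r - 1"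
      by (rule degree_le) (auto simp: coeff_pderiv coeff_eq_0)
    ultimately show False using deg by linarith
  qed
  then have c: "of_nat i * Polynomial.coeff r i = 0" for i
    using coeff_pderiv[of r "i - 1"] by (cases i) auto
  define n where "n = CHAR('f)"
  have "of_nat (Polynomial.degree r) = (0 :: 'f)"
    using c[of "Polynomial.degree r"] deg by auto
  then have "n > 0" unfolding n_def using deg CHAR_pos_iff by blast
  then have n: "Factorial_Ring.prime n" "of_nat n = (0 :: 'f)"
    by (auto simp: n_def prime_CHAR_semidom)
  have r0: "\<sigma> (Polynomial.coeff r i) = Polynomial.coeff r i" for i
    using assms by (simp add: irr_def P0_def)
  have "\<forall>i. \<exists>b. \<sigma> b = b \<and> b ^ n = Polynomial.coeff r (n * i)"
    using ex_root_char[OF n r0] by blast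
  then obtain b where b: "\<And>i. \<sigma> (b i) = b i" "\<And>i. b i ^ n = Polynomial.coeff r (n * i)"
    by metis
  \<comment> \<open>\<open>g\<close> is to be the \<open>n\<close>-th root of \<open>r\<close>;
    Frobenius is additive, so \<open>g ^ n\<close> can be computed term by term.\<close>
  define g where "g = (\<Sum>j\<le>Polynomial.degree r. Polynomial.monom (b j) j)"
  have gP: "g \<in> P0"
    by (auto simp: P0_def g_def coeff_sum conj_sum b(1) if_distrib[of \<sigma>] intro!: sum.cong)
  have n': "of_nat n = (0 :: 'f poly)" by (metis n(2) of_nat_poly pCons_0_0)
  have "g ^ n = (\<Sum>j\<le>Polynomial.degree r. Polynomial.monom (Polynomial.coeff r (n * j)) (n * j))"
    unfolding g_def sum_power_prime_char[OF n(1) n'] by (simp add: monom_power b mult.commute)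
  also have "\<dots> = r"
  proof (rule poly_eqI)
    fix i
    show "Polynomial.coeff (\<Sum>j\<le>Polynomial.degree r. Polynomial.monom (Polynomial.coeff r (n * j)) (n * j)) i
        = Polynomial.coeff r i"
    proof (cases "n dvd i")
      case True
      then obtain k where k: "i = n * k" by blast
      have eq: "n * j = i \<longleftrightarrow> j = k" for j using k \<open>n > 0\<close> by auto
      have "k \<le> i" using k \<open>n > 0\<close> by simp
      then have "k > Polynomial.degree r \<Longrightarrow> Polynomial.coeff r i = 0"
        by (intro coeff_eq_0) linarith
      then show ?thesis
        by (auto simp: coeff_sum eq) (auto simp: k)
    next
      case False
      then have "Polynomial.coeff r i = 0"
        using c[of i] of_nat_eq_0_iff_char_dvd[where 'a = 'f] by (auto simp: n_def)
      moreover have "n * j \<noteq> i" for j using False by auto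
      ultimately show ?thesis by (simp add: coeff_sum)
    qed
  qed
  finally have rg: "r = g ^ n" by simp
  then have "r dvd g" using irr_dvd_power[OF assms gP] by (metis dvd_refl)
  moreover have "g \<noteq> 0" using rg irrD(2)[OF assms] \<open>n > 0\<close> by (auto simp: zero_power)
  ultimately have "Polynomial.degree r \<le> Polynomial.degree g" by (simp add: dvd_imp_degree_le)
  moreover have "Polynomial.degree r = n * Polynomial.degree g"
    by (simp add: rg \<open>g \<noteq> 0\<close> degree_power_eq)
  moreover have "n > 1" using n(1) by (rule prime_gt_1_nat)
  then have "2 * Polynomial.degree g \<le> n * Polynomial.degree g" by (intro mult_le_mono1) simp
  ultimately show False using deg by linarith
qed

text \<open>
  If \<open>p\<^sup>2\<close> divides \<open>r(f)\<close>, then it does not divide \<open>r(f + p)\<close>, by separability of \<open>r\<close>.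
\<close>

lemma ex_uniformizing_root:
  assumes p: "irr p" and r: "irr r" and fh: "f \<in> P0" "h \<in> P0"
    and rf: "p dvd pcompose r f" and hf: "p dvd pcompose h f - [:0, 1:]"
  shows "\<exists>s\<in>P0. p dvd pcompose h s - [:0, 1:] \<and> p dvd pcompose r s \<and> \<not> p ^ 2 dvd pcompose r s"
proof (cases "p ^ 2 dvd pcompose r f")
  case False
  then show ?thesis using assms by blast
next
  case True
  have pP: "p \<in> P0" "p \<noteq> 0" and rP: "r \<in> P0" using irrD p r by auto
  obtain u v where uv: "u \<in> P0" "v \<in> P0" "u * pderiv r + v * r = 1"
    using irr_coprime[OF r _ irr_not_dvd_pderiv[OF r]] rP by blast
  \<comment> \<open>Composing the Bezout identity of \<open>r\<close> and its derivative with
    \<open>f\<close> shows that \<open>r'(f)\<close> is a unit modulo \<open>p\<close>.\<close>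
  have "pcompose u f * pcompose (pderiv r) f + pcompose v f * pcompose r f = 1"
    using arg_cong[OF uv(3), of "\<lambda>q. pcompose q f"] by (simp add: pcompose_add pcompose_mult pcompose_1)
  then have nd: "\<not> p dvd pcompose (pderiv r) f"
    using irr_not_dvd_1[OF p] rf by (metis dvd_add dvd_mult)
  have "p dvd pcompose h (f + p) - pcompose h f" "p dvd pcompose r (f + p) - pcompose r f"
    using dvd_pcompose_diff[of "f + p" f] by auto
  then have "p dvd (pcompose h (f + p) - pcompose h f) + (pcompose h f - [:0, 1:])"
    "p dvd (pcompose r (f + p) - pcompose r f) + pcompose r f"
    using hf rf by (blast intro: dvd_add)+
  then have 1: "p dvd pcompose h (f + p) - [:0, 1:]" "p dvd pcompose r (f + p)"
    by (simp_all only: add_diff_eq diff_add_cancel)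
  \<comment> \<open>By Taylor expansion \<open>r(f + p)\<close> is \<open>r(f) + r'(f) p\<close>
    modulo \<open>p^2\<close>, and the second term is not divisible by \<open>p^2\<close>.\<close>
  have 2: "\<not> p ^ 2 dvd pcompose r (f + p)"
  proof
    assume "p ^ 2 dvd pcompose r (f + p)"
    then have "p ^ 2 dvd pcompose r (f + p) - pcompose r f -
        (pcompose r (f + p) - pcompose r f - pcompose (pderiv r) f * p)"
      using True pcompose_taylor_dvd[of p r f] dvd_diff by blast
    then have "p * p dvd pcompose (pderiv r) f * p" by (simp add: power2_eq_square)
    then show False using nd pP by simp
  qed
  show ?thesis using 1 2 fh pP by (intro bexI[of _ "f + p"]) auto
qed

text \<open>
  Successive approximation in powers of the uniformizer \<open>r(s)\<close>: the ring \<open>F\<^sub>0[x]/p\<^sup>k\<close> is generated by \<open>s\<close>.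
\<close>

lemma P0_mod_power_generated:
  assumes p: "irr p" and P: "r \<in> P0" "h \<in> P0" "s \<in> P0"
    and hs: "p dvd pcompose h s - [:0, 1:]" and rs: "p dvd pcompose r s" "\<not> p ^ 2 dvd pcompose r s"
    and a: "a \<in> P0"
  shows "\<exists>G\<in>P0. p ^ k dvd a - pcompose G s"
  using a
proof (induction k arbitrary: a)
  case 0
  show ?case by auto
next
  case (Suc k)
  note pP = irrD[OF p]
  \<comment> \<open>Modulo \<open>p\<close>, \<open>x\<close> equals \<open>h(s)\<close>, so
    \<open>a\<close> and \<open>a(h(s))\<close> differ by a multiple \<open>p * b\<close>.\<close>
  have "pcompose h s - [:0, 1:] dvd pcompose a (pcompose h s) - a"
    using dvd_pcompose_diff[of "pcompose h s" "[:0, 1:]" a] by simp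
  then have "p dvd a - pcompose a (pcompose h s)"
    using hs by (meson dvd_trans dvd_diff_commute)
  then obtain b where b: "a - pcompose a (pcompose h s) = p * b" by blast
  have "p * b div p = b" using pP by simp
  then have bP: "b \<in> P0"
    using P Suc.prems pP by (metis P0_div P0_diff P0_pcompose b)
  obtain e where e: "pcompose r s = p * e" using rs by blast
  have "p * e div p = e" using pP by simp
  then have eP: "e \<in> P0" using P pP by (metis P0_div P0_pcompose e)
  \<comment> \<open>\<open>e\<close> is a unit modulo \<open>p\<close> because \<open>r(s)\<close>
    has exactly one factor \<open>p\<close>.\<close>
  have "\<not> p dvd e" using rs(2) pP by (auto simp: e power2_eq_square)
  then obtain w v where wv: "w \<in> P0" "v \<in> P0" "w * e + v * p ^ k = 1"
    using irr_coprime_power[OF p eP] by blast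
  \<comment> \<open>\<open>w\<close> inverts \<open>e\<close> modulo \<open>p^k\<close>, so
    \<open>p * b\<close> is \<open>r(s) * (b * w)\<close> modulo \<open>p^(k+1)\<close>, and the
    cofactor \<open>b * w\<close> is only needed modulo \<open>p^k\<close>.\<close>
  obtain G where G: "G \<in> P0" "p ^ k dvd b * w - pcompose G s"
    using Suc.IH[of "b * w"] bP wv by blast
  then obtain c where c: "b * w - pcompose G s = p ^ k * c" by blast
  have "a - pcompose (pcompose a h + r * G) s
      = p * b * (w * e + v * p ^ k) - p * e * pcompose G s"
    using b by (simp add: pcompose_add pcompose_mult e wv pcompose_assoc flip: b)
  also have "\<dots> = p * e * (b * w - pcompose G s) + p ^ Suc k * (b * v)"
    by (simp add: algebra_simps)
  also have "\<dots> = p ^ Suc k * (e * c + b * v)"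
    by (simp add: c algebra_simps)
  finally show ?case
    using G P Suc.prems by (intro bexI[of _ "pcompose a h + r * G"]) auto
qed

text \<open>Hensel lifting for \<open>Y^2 \<beta> = \<beta>'\<close>. The derivative
  \<open>2 Y \<beta>\<close> is a unit modulo \<open>r\<close>, since 2 is invertible and
  \<open>r\<close> does not divide \<open>\<beta>'\<close>.\<close>

lemma square_mod_power:
  assumes r: "irr r" and P: "\<beta> \<in> P0" "\<beta>' \<in> P0" "y \<in> P0"
    and y: "r dvd \<beta>' - y ^ 2 * \<beta>" and nd: "\<not> r dvd \<beta>'"
  shows "\<exists>Y\<in>P0. r ^ Suc k dvd \<beta>' - Y ^ 2 * \<beta>"
proof (induction k)
  case 0
  show ?case using y P by auto
next
  case (Suc k)
  note rP = irrD[OF r]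
  obtain Y where Y: "Y \<in> P0" "r ^ Suc k dvd \<beta>' - Y ^ 2 * \<beta>" using Suc by blast
  then obtain c where c: "\<beta>' - Y ^ 2 * \<beta> = r ^ Suc k * c" by blast
  have "r ^ Suc k * c div r ^ Suc k = c"
    using rP by (metis nonzero_mult_div_cancel_left power_not_zero)
  then have cP: "c \<in> P0" using Y P rP by (metis P0_div P0_diff P0_mult P0_power c)
  have "r dvd \<beta>' - Y ^ 2 * \<beta>" using c by simp
  then have nd': "\<not> r dvd Y * \<beta>"
    using nd by (metis diff_add_cancel dvd_add dvd_mult power2_eq_square mult.assoc)
  have "\<not> r dvd [:2:] * (Y * \<beta>)"
    using nd' two_neq_0 by (simp add: dvd_smult_iff)
  moreover have "[:2:] * (Y * \<beta>) \<in> P0" by (intro P0_mult Y P) simp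
  ultimately obtain u v where uv: "u \<in> P0" "v \<in> P0" "u * ([:2:] * (Y * \<beta>)) + v * r = 1"
    using irr_coprime[OF r, of "[:2:] * (Y * \<beta>)"] by blast
  \<comment> \<open>Newton correction: modulo \<open>r\<close>, \<open>z\<close> solves the
    linearized equation \<open>2 Y \<beta> z = c\<close>.\<close>
  define z where "z = u * c"
  have two: "[:2:] = (2 :: 'f poly)" by (metis numeral_poly)
  have "\<beta>' - (Y + r ^ Suc k * z) ^ 2 * \<beta>
      = (\<beta>' - Y ^ 2 * \<beta>) - r ^ Suc k * (z * ([:2:] * (Y * \<beta>))) - r ^ Suc k * r ^ Suc k * (z ^ 2 * \<beta>)"
    unfolding two by (simp add: algebra_simps power2_eq_square)
  also have "\<dots> = r ^ Suc k * (c * (u * ([:2:] * (Y * \<beta>)) + v * r) - z * ([:2:] * (Y * \<beta>)) - r ^ Suc k * (z ^ 2 * \<beta>))"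
    unfolding uv(3) c by (simp only: algebra_simps) simp
  also have "\<dots> = r ^ Suc (Suc k) * (c * v - r ^ k * (z ^ 2 * \<beta>))"
    by (simp add: z_def algebra_simps)
  finally show ?case
    using Y uv cP rP by (intro bexI[of _ "Y + r ^ Suc k * z"]) (auto simp: z_def)
qed

end

section \<open>Consequences of property FE\<close>

lemma sum_lessThan_add:
  fixes f :: "nat \<Rightarrow> 'a :: comm_monoid_add"
  shows "(\<Sum>i<m + n. f i) = (\<Sum>i<m. f i) + (\<Sum>i<n. f (m + i))"
  by (induction n) (auto simp: add.assoc)

lemma (in ring) ex_dimension_Span:
  assumes "subfield K R" "set Us \<subseteq> carrier R"
  shows "\<exists>n\<le>length Us. dimension n K (Span K Us)"
  using assms(2)
proof (induction Us)
  case Nil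
  show ?case by auto
next
  case (Cons u Us)
  then obtain n where n: "n \<le> length Us" "dimension n K (Span K Us)" by auto
  show ?case
  proof (cases "u \<in> Span K Us")
    case True
    have us: "set Us \<subseteq> carrier R" "u \<in> carrier R" using Cons.prems by auto
    have "set (u # Us) \<subseteq> Span K Us"
      using True Span_base_incl[OF assms(1) us(1)] by auto
    then have "Span K (u # Us) \<subseteq> Span K Us"
      using mono_Span_subset[OF assms(1)] us by blast
    then have "Span K (u # Us) = Span K Us"
      using mono_Span[OF assms(1) us] by blast
    then show ?thesis using n by (metis le_SucI length_Cons)
  next
    case False
    then show ?thesis
      using Suc_dim[OF _ False n(2)] n(1) Cons.prems by (intro exI[of _ "Suc n"]) auto
  qed
qed

section \<open>Evaluation in an algebraic closure\<close>

context fe_field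
begin

text \<open>The closure is that of \<open>'f\<close>, since the fixed field is not a type of its
  own; by \<open>ex_ev_eq_0\<close> it is algebraic over the fixed field as well.\<close>

definition ev :: "'f alg_closure \<Rightarrow> 'f poly \<Rightarrow> 'f alg_closure" where
  "ev \<theta> p = poly (map_poly to_ac p) \<theta>"

lemma ev_pCons [simp]: "ev \<theta> (pCons a p) = to_ac a + \<theta> * ev \<theta> p"
  by (simp add: ev_def map_poly_pCons)

lemma ev_0 [simp]: "ev \<theta> 0 = 0" and ev_1 [simp]: "ev \<theta> 1 = 1"
  by (simp_all add: ev_def)

lemma ev_add [simp]: "ev \<theta> (p + q) = ev \<theta> p + ev \<theta> q"
proof -
  have "map_poly to_ac (p + q) = map_poly to_ac p + map_poly to_ac q"
    by (simp add: poly_eq_iff coeff_map_poly)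
  then show ?thesis by (simp add: ev_def)
qed

lemma ev_smult [simp]: "ev \<theta> (smult a p) = to_ac a * ev \<theta> p"
  by (induction p) (auto simp: algebra_simps)

lemma ev_minus [simp]: "ev \<theta> (- p) = - ev \<theta> p"
  using ev_add[of \<theta> p "- p"] by (simp add: eq_neg_iff_add_eq_0 add.commute del: ev_add)

lemma ev_diff [simp]: "ev \<theta> (p - q) = ev \<theta> p - ev \<theta> q"
  using ev_add[of \<theta> p "- q"] by simp

lemma ev_mult [simp]: "ev \<theta> (p * q) = ev \<theta> p * ev \<theta> q"
  by (induction p) (auto simp: algebra_simps)

lemma ev_power [simp]: "ev \<theta> (p ^ n) = ev \<theta> p ^ n"
  by (induction n) auto

lemma ev_pcompose [simp]: "ev \<theta> (pcompose p q) = ev (ev \<theta> q) p"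
  by (induction p) (auto simp: pcompose_pCons)

lemma ev_altdef:
  assumes "Polynomial.degree p < n"
  shows "ev \<theta> p = (\<Sum>i<n. to_ac (Polynomial.coeff p i) * \<theta> ^ i)"
proof -
  have "ev \<theta> p = (\<Sum>i\<le>Polynomial.degree p. to_ac (Polynomial.coeff p i) * \<theta> ^ i)"
    by (cases "p = 0") (simp_all add: ev_def poly_altdef map_poly_degree_eq coeff_map_poly)
  also have "\<dots> = (\<Sum>i<n. to_ac (Polynomial.coeff p i) * \<theta> ^ i)"
    using assms by (intro sum.mono_neutral_left) (auto simp: coeff_eq_0)
  finally show ?thesis .
qed

text \<open>The norm \<open>p * conj_poly p\<close> of a polynomial over the large field has fixed
  coefficients and keeps the roots of \<open>p\<close>.\<close>

lemma ex_ev_eq_0: "\<exists>q\<in>P0. q \<noteq> 0 \<and> ev x q = 0"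
proof -
  obtain p :: "'f poly" where p: "p \<noteq> 0" "ev x p = 0"
    using alg_closure_algebraic[of x] unfolding ev_def by blast
  have "p * conj_poly p \<in> P0" by (simp add: P0_iff conj_poly_mult mult.commute)
  then show ?thesis using p by (intro bexI[of _ "p * conj_poly p"]) auto
qed

lemma finite_ev_roots:
  assumes "q \<noteq> 0" shows "finite {x. ev x q = 0}"
proof -
  have "map_poly to_ac q \<noteq> 0"
    using assms by (simp add: map_poly_eq_0_iff)
  then show ?thesis unfolding ev_def by (rule poly_roots_finite)
qed

lemma ex_ev_root:
  assumes "Polynomial.degree q > 0" shows "\<exists>x. ev x q = 0"
  unfolding ev_def
  using assms by (intro alg_closed_imp_poly_has_root) (subst map_poly_degree_eq, auto)

section \<open>Finitely many subfields of bounded degree\<close>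

definition subalg :: "'f alg_closure set \<Rightarrow> bool" where
  "subalg M \<longleftrightarrow> (\<forall>a. \<sigma> a = a \<longrightarrow> to_ac a \<in> M) \<and> (\<forall>x\<in>M. \<forall>y\<in>M. x + y \<in> M \<and> x * y \<in> M)"

definition lspan :: "nat \<Rightarrow> (nat \<Rightarrow> 'f alg_closure) \<Rightarrow> 'f alg_closure set" where
  "lspan n m = {(\<Sum>i<n. to_ac (a i) * m i) | a. \<forall>i. \<sigma> (a i) = a i}"

text \<open>
  The members of \<open>exts n\<close> are the subfields of the algebraic closure of degree at most \<open>n\<close> over the
  fixed field: they contain inverses because all elements are algebraic.
\<close>

definition exts :: "nat \<Rightarrow> 'f alg_closure set set" where
  "exts n = {M. subalg M \<and> (\<exists>m. M = lspan n m)}"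

lemma lspan_generator:
  assumes "i < n" shows "m i \<in> lspan n m"
proof -
  have "m i = (\<Sum>j<n. to_ac (if j = i then 1 else 0) * m j)"
    using assms by (simp add: if_distrib if_distribR cong: if_cong)
  then show ?thesis
    unfolding lspan_def by (intro CollectI exI[of _ "\<lambda>j. if j = i then 1 else 0"]) auto
qed

lemma subalg_ev:
  assumes "subalg M" "x \<in> M" "q \<in> P0" shows "ev x q \<in> M"
  using assms(3)
proof (induction q)
  case 0
  have "to_ac 0 \<in> M" using assms(1) conj_0 unfolding subalg_def by blast
  then show ?case by simp
qed (use assms in \<open>auto simp: subalg_def\<close>)

lemma subalg_0_1_minus:
  assumes "subalg M"
  shows "0 \<in> M" "1 \<in> M" "x \<in> M \<Longrightarrow> - x \<in> M"
proof -
  have "to_ac 0 \<in> M" "to_ac 1 \<in> M" "to_ac (-1) \<in> M"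
    using assms unfolding subalg_def by (metis conj_0 conj_1 conj_minus)+
  then show "0 \<in> M" "1 \<in> M" "x \<in> M \<Longrightarrow> - x \<in> M"
    using assms unfolding subalg_def by (auto dest: bspec[of M _ "-1"])
qed

lemma subalg_sum:
  assumes "subalg M" "\<And>i. i \<in> A \<Longrightarrow> f i \<in> M" shows "sum f A \<in> M"
  using assms(2)
  by (induction A rule: infinite_finite_induct)
    (use assms(1) subalg_0_1_minus[OF assms(1)] in \<open>auto simp: subalg_def\<close>)

text \<open>An annihilating polynomial of least degree has nonzero constant term \<open>a\<close>,
  since otherwise \<open>x\<close> could be cancelled; then \<open>a + x q'(x) = 0\<close> gives the
  inverse inside \<open>M\<close>.\<close>

lemma subalg_inverse:
  assumes M: "subalg M" and x: "x \<in> M" "x \<noteq> 0"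
  shows "\<exists>y\<in>M. x * y = 1"
proof -
  let ?A = "\<lambda>q. q \<in> P0 \<and> q \<noteq> 0 \<and> ev x q = 0"
  obtain q where q: "?A q" and min: "\<And>y. ?A y \<Longrightarrow> Polynomial.degree q \<le> Polynomial.degree y"
    using ex_ev_eq_0[of x] ex_has_least_nat[of ?A _ Polynomial.degree] by blast
  obtain a q' where q': "q = pCons a q'" by (cases q)
  have "a \<noteq> 0"
  proof
    assume "a = 0"
    then have "?A q'" using q q' x by auto
    then have "Polynomial.degree q \<le> Polynomial.degree q'" by (rule min)
    then show False using q' \<open>?A q'\<close> by auto
  qed
  have "\<sigma> a = a" "q' \<in> P0" using q q' by auto
  then have "to_ac (- inverse a) \<in> M"
    using M unfolding subalg_def by (metis conj_inverse conj_minus)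
  then have "to_ac (- inverse a) * ev x q' \<in> M"
    using M subalg_ev[OF M x(1) \<open>q' \<in> P0\<close>] unfolding subalg_def by blast
  moreover have "to_ac a + x * ev x q' = 0" using q q' by auto
  then have "x * ev x q' = - to_ac a" by (simp add: add_eq_0_iff2)
  then have "x * (to_ac (- inverse a) * ev x q') = to_ac (- inverse a) * - to_ac a"
    by (metis mult.left_commute)
  then have "x * (to_ac (- inverse a) * ev x q') = 1"
    using \<open>a \<noteq> 0\<close> by (simp flip: to_ac_mult add: mult.commute)
  ultimately show ?thesis by blast
qed

definition ext_ring :: "'f alg_closure set \<Rightarrow> 'f alg_closure ring" where
  "ext_ring M = \<lparr>carrier = M, monoid.mult = (*), one = 1, ring.zero = 0, add = (+)\<rparr>"

lemma ext_ring_simps [simp]: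
  "carrier (ext_ring M) = M" "\<one>\<^bsub>ext_ring M\<^esub> = 1" "\<zero>\<^bsub>ext_ring M\<^esub> = 0"
  "x \<otimes>\<^bsub>ext_ring M\<^esub> y = x * y" "x \<oplus>\<^bsub>ext_ring M\<^esub> y = x + y"
  by (simp_all add: ext_ring_def)

lemma field_ext_ring:
  assumes M: "subalg M" shows "field (ext_ring M)"
proof -
  note c = subalg_0_1_minus[OF M]
  have cl: "x + y \<in> M" "x * y \<in> M" if "x \<in> M" "y \<in> M" for x y
    using M that by (auto simp: subalg_def)
  have neg: "\<exists>y\<in>M. y + x = 0 \<and> x + y = 0" if "x \<in> M" for x
    using c(3)[OF that] by (intro bexI[of _ "- x"]) auto
  have inv: "\<exists>y\<in>M. y * x = 1 \<and> x * y = 1" if "x \<in> M" "x \<noteq> 0" for x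
    using subalg_inverse[OF M that] by (metis mult.commute)
  show ?thesis
    unfolding ext_ring_def
    by unfold_locales
      (auto simp: c cl distrib_left distrib_right add.assoc mult.assoc Units_def neg inv
        intro: add.commute mult.commute)
qed

lemma combine_ext_ring:
  assumes "subalg M" "length ks = length us"
  shows "ring.combine (ext_ring M) ks us = (\<Sum>i<length us. ks ! i * us ! i)"
proof -
  interpret L: field "ext_ring M" by (rule field_ext_ring[OF assms(1)])
  show ?thesis
    using assms(2)
    by (induction ks us rule: list_induct2) (auto simp: sum.lessThan_Suc_shift simp del: sum.lessThan_Suc)
qed

text \<open>The degree is only bounded by \<open>n\<close> because the \<open>n\<close> spanning
  elements may be dependent.\<close>

lemma exts_imp_extension:
  assumes "M \<in> exts n"
  shows "\<exists>k\<le>n. field_extension (fixed_field \<sigma>) k (ext_ring M) to_ac"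
proof -
  obtain m where M: "subalg M" "M = lspan n m" using assms by (auto simp: exts_def)
  interpret L: field "ext_ring M" by (rule field_ext_ring[OF M(1)])
  have hom: "to_ac \<in> ring_hom (fixed_field \<sigma>) (ext_ring M)"
    using M(1) by (intro ring_hom_memI) (auto simp: subalg_def)
  interpret i: ring_hom_ring "fixed_field \<sigma>" "ext_ring M" to_ac
    by (intro ring_hom_ringI2 hom K0.is_ring L.is_ring)
  let ?K = "to_ac ` carrier (fixed_field \<sigma>)"
  have sub: "subfield ?K (ext_ring M)"
    using i.img_is_subfield(2)[OF K0.carrier_is_subfield] by simp
  let ?us = "map m [0..<n]"
  have mM: "m i \<in> M" if "i < n" for i
    unfolding M(2) using that by (rule lspan_generator)
  then have us: "set ?us \<subseteq> carrier (ext_ring M)" by auto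
  have "M \<subseteq> L.Span ?K ?us"
  proof
    fix x assume "x \<in> M"
    then obtain a where a: "x = (\<Sum>i<n. to_ac (a i) * m i)" "\<And>i. \<sigma> (a i) = a i"
      unfolding M(2) lspan_def by blast
    have "x = L.combine (map (\<lambda>i. to_ac (a i)) [0..<n]) ?us"
      by (subst combine_ext_ring[OF M(1)]) (auto simp: a)
    then show "x \<in> L.Span ?K ?us"
      unfolding L.Span_eq_combine_set_length_version[OF sub us]
      using a(2) by (intro CollectI exI[of _ "map (\<lambda>i. to_ac (a i)) [0..<n]"]) auto
  qed
  moreover have "L.Span ?K ?us \<subseteq> M"
    using L.Span_in_carrier[of ?K ?us] us sub subfieldE(3)[OF sub] by simp
  ultimately have "L.Span ?K ?us = M" by blast
  then obtain k where "k \<le> n" "L.dimension k ?K M"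
    using L.ex_dimension_Span[OF sub us] by auto
  then show ?thesis
    using hom L.field_axioms by (auto simp: field_extension_def)
qed

text \<open>FE speaks of models on \<open>'f list\<close>. Each \<open>M\<close> is transported to
  such a model and coloured by the class of the model; two fields of one colour are identified by
  passing through their models.\<close>

lemma exts_coloring:
  "\<exists>c :: _ \<Rightarrow> nat \<times> ('f list ring \<times> ('f \<Rightarrow> 'f list)) set. finite (c ` exts n) \<and>
     (\<forall>M\<in>exts n. \<forall>M'\<in>exts n. c M = c M' \<longrightarrow>
        extension_iso (fixed_field \<sigma>) (ext_ring M) to_ac (ext_ring M') to_ac)"
proof -
  let ?K = "fixed_field \<sigma>"
  have "\<exists>k E. k \<le> n \<and> E \<in> field_extensions ?K k \<and>
      extension_iso ?K (ext_ring M) to_ac (fst E) (snd E)" if M: "M \<in> exts n" for M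
  proof -
    obtain k where "k \<le> n" "field_extension ?K k (ext_ring M) to_ac"
      using exts_imp_extension[OF M] by blast
    then show ?thesis
      using field_extension_list_model[OF K0.field_axioms, of k "ext_ring M" to_ac] by fastforce
  qed
  then obtain k E where kE: "\<And>M. M \<in> exts n \<Longrightarrow> k M \<le> n"
    "\<And>M. M \<in> exts n \<Longrightarrow> E M \<in> field_extensions ?K (k M)"
    "\<And>M. M \<in> exts n \<Longrightarrow> extension_iso ?K (ext_ring M) to_ac (fst (E M)) (snd (E M))"
    by metis
  \<comment> \<open>The degree belongs to the colour because \<open>extension_rel\<close> is a
    different relation for each degree.\<close>
  define c where "c M = (k M, extension_rel ?K (k M) `` {E M})" for M
  have "c ` exts n \<subseteq> (SIGMA j:{..n}. field_extensions ?K j // extension_rel ?K j)"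
    using kE by (auto simp: c_def intro!: quotientI)
  moreover have "finite (SIGMA j:{..n}. field_extensions ?K j // extension_rel ?K j)"
    using FE by (intro finite_SigmaI) (auto simp: property_FE_def)
  ultimately have "finite (c ` exts n)" by (rule finite_subset)
  moreover have "extension_iso ?K (ext_ring M) to_ac (ext_ring M') to_ac"
    if M: "M \<in> exts n" "M' \<in> exts n" and eq: "c M = c M'" for M M'
  proof -
    have k: "k M = k M'" and "extension_rel ?K (k M) `` {E M} = extension_rel ?K (k M') `` {E M'}"
      using eq unfolding c_def by (blast elim: Pair_inject)+
    then have "(E M, E M') \<in> extension_rel ?K (k M)"
      by (intro eq_equiv_class[OF _ equiv_extension_rel kE(2)[OF M(2), folded k]]) (simp only:)
    then obtain g where g: "g \<in> ring_iso (fst (E M)) (fst (E M'))"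
      "\<And>a. a \<in> carrier ?K \<Longrightarrow> g (snd (E M) a) = snd (E M') a"
      by (auto simp: extension_rel_def extension_iso_def split: prod.splits)
    obtain f where f: "f \<in> ring_iso (ext_ring M) (fst (E M))"
      "\<And>a. a \<in> carrier ?K \<Longrightarrow> f (to_ac a) = snd (E M) a"
      using kE(3)[OF M(1)] by (auto simp: extension_iso_def)
    obtain f' where f': "f' \<in> ring_iso (ext_ring M') (fst (E M'))"
      "\<And>a. a \<in> carrier ?K \<Longrightarrow> f' (to_ac a) = snd (E M') a"
      using kE(3)[OF M(2)] by (auto simp: extension_iso_def)
    have M': "subalg M'" using M by (simp add: exts_def)
    interpret L: field "ext_ring M'" by (rule field_ext_ring[OF M'])
    have h: "inv_into M' f' \<circ> (g \<circ> f) \<in> ring_iso (ext_ring M) (ext_ring M')"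
      using ring_iso_set_trans[OF ring_iso_set_trans[OF f(1) g(1)] ring_iso_set_sym[OF L.is_ring f'(1)]]
      by simp
    moreover have "(inv_into M' f' \<circ> (g \<circ> f)) (to_ac a) = to_ac a" if "a \<in> carrier ?K" for a
    proof -
      have "to_ac a \<in> M'" using M' that by (simp add: subalg_def)
      then show ?thesis
        using f' that f(2) g(2) by (auto simp: ring_iso_def bij_betw_def) (metis inv_into_f_f)
    qed
    ultimately show ?thesis unfolding extension_iso_def by blast
  qed
  ultimately show ?thesis by blast
qed

text \<open>An isomorphism over the fixed field is determined by the images of the spanning
  elements, and each image is again a root of a polynomial that the element satisfies.\<close>

lemma finite_isomorphic_exts:
  assumes M: "M \<in> exts n"
  shows "finite {M'. extension_iso (fixed_field \<sigma>) (ext_ring M) to_ac (ext_ring M') to_ac}"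
proof -
  obtain m where m: "subalg M" "M = lspan n m" using M by (auto simp: exts_def)
  have mM: "m i \<in> M" if "i < n" for i
    unfolding m(2) using that by (rule lspan_generator)
  have "\<forall>i. \<exists>q. q \<in> P0 \<and> q \<noteq> 0 \<and> ev (m i) q = 0"
    using ex_ev_eq_0 by blast
  then obtain q where q: "\<And>i. q i \<in> P0" "\<And>i. q i \<noteq> 0" "\<And>i. ev (m i) (q i) = 0"
    by metis
  have "{M'. extension_iso (fixed_field \<sigma>) (ext_ring M) to_ac (ext_ring M') to_ac}
      \<subseteq> lspan n ` (PiE {..<n} (\<lambda>i. {x. ev x (q i) = 0}))"
  proof
    fix M' assume "M' \<in> {M'. extension_iso (fixed_field \<sigma>) (ext_ring M) to_ac (ext_ring M') to_ac}"
    then obtain h where h: "h \<in> ring_iso (ext_ring M) (ext_ring M')" "\<And>a. \<sigma> a = a \<Longrightarrow> h (to_ac a) = to_ac a"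
      by (auto simp: extension_iso_def)
    have bij: "h ` M = M'" and add: "\<And>x y. x \<in> M \<Longrightarrow> y \<in> M \<Longrightarrow> h (x + y) = h x + h y"
      and mult: "\<And>x y. x \<in> M \<Longrightarrow> y \<in> M \<Longrightarrow> h (x * y) = h x * h y"
      using h(1) by (auto simp: ring_iso_def ring_hom_def bij_betw_def)
    have inM: "to_ac a \<in> M" if "\<sigma> a = a" for a using m(1) that by (simp add: subalg_def)
    have h0: "h 0 = 0" using h(2)[of 0] by simp
    have hev: "h (ev x p) = ev (h x) p" if "x \<in> M" "p \<in> P0" for x p
      using that(2)
    proof (induction p)
      case (pCons a p)
      have "ev x p \<in> M" "x * ev x p \<in> M"
        using subalg_ev[OF m(1) that(1)] pCons m(1) that(1) by (auto simp: subalg_def)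
      then show ?case using pCons that(1) by (simp add: add mult h(2) inM)
    qed (simp add: h0)
    have hsum: "h (\<Sum>i<k. to_ac (a i) * m i) = (\<Sum>i<k. to_ac (a i) * h (m i))"
      if "k \<le> n" "\<And>i. \<sigma> (a i) = a i" for k a
      using that(1)
    proof (induction k)
      case (Suc k)
      have in1: "to_ac (a i) * m i \<in> M" if "i < n" for i
        using m(1) inM \<open>\<And>i. \<sigma> (a i) = a i\<close> mM[OF that] by (auto simp: subalg_def)
      then have "(\<Sum>i<k. to_ac (a i) * m i) \<in> M" using Suc.prems by (intro subalg_sum[OF m(1)]) auto
      then show ?case using Suc in1 inM mM that(2) by (simp add: add mult h(2))
    qed (simp add: h0)
    have "M' = lspan n (h \<circ> m)"
      unfolding bij[symmetric] unfolding m(2) lspan_def using hsum[of n] by (force simp: image_iff)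
    \<comment> \<open>Restriction puts the family into the finite set \<open>PiE\<close>;
      \<open>lspan n\<close> reads only indices below \<open>n\<close>.\<close>
    also have "\<dots> = lspan n (restrict (h \<circ> m) {..<n})"
      by (simp add: lspan_def)
    finally have "M' = lspan n (restrict (h \<circ> m) {..<n})" .
    moreover have "ev (h (m i)) (q i) = 0" if "i < n" for i
      using hev[OF mM[OF that] q(1), of i] q(3) h0 by simp
    then have "restrict (h \<circ> m) {..<n} \<in> PiE {..<n} (\<lambda>i. {x. ev x (q i) = 0})" by auto
    ultimately show "M' \<in> lspan n ` (PiE {..<n} (\<lambda>i. {x. ev x (q i) = 0}))" by (rule image_eqI)
  qed
  moreover have "finite (lspan n ` (PiE {..<n} (\<lambda>i. {x. ev x (q i) = 0})))"
    by (intro finite_imageI finite_PiE finite_ev_roots q) auto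
  ultimately show ?thesis by (rule finite_subset)
qed

lemma finite_exts: "finite (exts n)"
proof -
  obtain c :: "_ \<Rightarrow> nat \<times> ('f list ring \<times> ('f \<Rightarrow> 'f list)) set" where c: "finite (c ` exts n)"
    "\<And>M M'. M \<in> exts n \<Longrightarrow> M' \<in> exts n \<Longrightarrow> c M = c M' \<Longrightarrow>
        extension_iso (fixed_field \<sigma>) (ext_ring M) to_ac (ext_ring M') to_ac"
    using exts_coloring[of n] by blast
  have "finite {M' \<in> exts n. c M' = y}" if "y \<in> c ` exts n" for y
  proof -
    from that obtain M where M: "M \<in> exts n" "c M = y" by blast
    show ?thesis by (rule finite_subset[OF _ finite_isomorphic_exts[OF M(1)]]) (use c(2) M in auto)
  qed
  then have "finite (\<Union>y\<in>c ` exts n. {M' \<in> exts n. c M' = y})" using c(1) by blast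
  then show ?thesis by (rule finite_subset[rotated]) auto
qed

lemma extsI:
  assumes "subalg M" "\<And>i. i < n \<Longrightarrow> m i \<in> M" "M \<subseteq> lspan n m"
  shows "M \<in> exts n"
proof -
  have "lspan n m \<subseteq> M"
    using assms(1,2) by (auto simp: lspan_def subalg_def intro!: subalg_sum)
  then show ?thesis using assms by (auto simp: exts_def)
qed

section \<open>Residue fields and square classes\<close>

lemma irr_dvd_iff_ev:
  assumes "irr p" "ev \<theta> p = 0" "f \<in> P0"
  shows "p dvd f \<longleftrightarrow> ev \<theta> f = 0"
proof
  assume 0: "ev \<theta> f = 0"
  show "p dvd f"
  proof (rule ccontr)
    assume "\<not> p dvd f"
    then obtain u v where "u * f + v * p = 1" using irr_coprime assms by blast
    then have "ev \<theta> (u * f + v * p) = 1" by simp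
    then show False using 0 assms(2) by simp
  qed
qed (use assms(2) in auto)

lemma ev_mod:
  assumes "ev \<theta> p = 0" shows "ev \<theta> (f mod p) = ev \<theta> f"
proof -
  have "ev \<theta> f = ev \<theta> (f div p * p + f mod p)" by simp
  also have "\<dots> = ev \<theta> (f mod p)" unfolding ev_add ev_mult using assms by simp
  finally show ?thesis ..
qed

lemma subalg_ev_image: "subalg (ev \<theta> ` P0)"
  unfolding subalg_def
proof (intro conjI allI impI ballI)
  fix a assume "\<sigma> a = a"
  then show "to_ac a \<in> ev \<theta> ` P0" by (intro image_eqI[of _ _ "[:a:]"]) auto
next
  fix x y assume "x \<in> ev \<theta> ` P0" "y \<in> ev \<theta> ` P0"
  then obtain p q where "p \<in> P0" "q \<in> P0" "x = ev \<theta> p" "y = ev \<theta> q" by blast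
  then show "x + y \<in> ev \<theta> ` P0" "x * y \<in> ev \<theta> ` P0"
    by (auto intro: image_eqI[of _ _ "p + q"] image_eqI[of _ _ "p * q"])
qed

lemma ev_lspan:
  assumes "irr p" "ev \<theta> p = 0" "Polynomial.degree p \<le> n" "f \<in> P0"
  shows "\<exists>a. (\<forall>i. \<sigma> (a i) = a i) \<and> ev \<theta> f = (\<Sum>i<n. to_ac (a i) * \<theta> ^ i)"
proof -
  have "f mod p \<in> P0" using assms irrD by blast
  moreover have "Polynomial.degree (f mod p) < n"
    using assms(1,3) degree_mod_less[of p f] irrD(2)[OF assms(1)] by (auto simp: irr_def)
  ultimately show ?thesis
    using ev_altdef[of "f mod p" n \<theta>] ev_mod[OF assms(2), of f]
    by (intro exI[of _ "Polynomial.coeff (f mod p)"]) (auto simp: P0_def)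
qed

text \<open>The pair \<open>f\<close>, \<open>h\<close> encodes an isomorphism of
  \<open>F_0[x]/r\<close> with \<open>F_0[x]/p\<close>: \<open>f\<close> is the image of the root of
  \<open>r\<close>, and \<open>h\<close> recovers \<open>x\<close>. Two polynomials whose chosen
  roots generate the same subfield of the closure are related in this way, each root being a
  polynomial in the other.\<close>

lemma finite_irr_representatives:
  "\<exists>R. finite R \<and> (\<forall>r\<in>R. irr r) \<and>
     (\<forall>p. irr p \<and> Polynomial.degree p \<le> n \<longrightarrow>
        (\<exists>r\<in>R. \<exists>f\<in>P0. \<exists>h\<in>P0. p dvd pcompose r f \<and> p dvd pcompose h f - [:0, 1:]))"
proof -
  define A where "A = {p. irr p \<and> Polynomial.degree p \<le> n}"
  obtain rt where rt: "\<And>p. irr p \<Longrightarrow> ev (rt p) p = 0"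
    using ex_ev_root by (metis irr_def)
  define \<Phi> where "\<Phi> p = ev (rt p) ` P0" for p
  have "\<Phi> p \<in> exts n" if "p \<in> A" for p
  proof (rule extsI[of _ _ "\<lambda>i. rt p ^ i"])
    show "subalg (\<Phi> p)" unfolding \<Phi>_def by (rule subalg_ev_image)
    show "rt p ^ i \<in> \<Phi> p" for i
      unfolding \<Phi>_def by (rule image_eqI[of _ _ "[:0, 1:] ^ i"]) auto
    show "\<Phi> p \<subseteq> lspan n (\<lambda>i. rt p ^ i)"
    proof
      fix x assume "x \<in> \<Phi> p"
      then obtain f where f: "f \<in> P0" "x = ev (rt p) f" unfolding \<Phi>_def by blast
      have "irr p" "Polynomial.degree p \<le> n" using \<open>p \<in> A\<close> by (auto simp: A_def)
      from ev_lspan[OF this(1) rt[OF this(1)] this(2) f(1)]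
      show "x \<in> lspan n (\<lambda>i. rt p ^ i)" unfolding lspan_def f(2) by blast
    qed
  qed
  then have "\<Phi> ` A \<subseteq> exts n" by blast
  then have "finite (\<Phi> ` A)" using finite_exts by (rule finite_subset)
  \<comment> \<open>One polynomial for each subfield that occurs.\<close>
  define R where "R = inv_into A \<Phi> ` (\<Phi> ` A)"
  have "finite R" using \<open>finite (\<Phi> ` A)\<close> by (simp add: R_def)
  moreover have RA: "r \<in> A" if "r \<in> R" for r
  proof -
    from that obtain y where "r = inv_into A \<Phi> y" "y \<in> \<Phi> ` A" unfolding R_def by blast
    then show ?thesis by (simp only: inv_into_into)
  qed
  moreover have "\<exists>r\<in>R. \<exists>f\<in>P0. \<exists>h\<in>P0. p dvd pcompose r f \<and> p dvd pcompose h f - [:0, 1:]"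
    if "p \<in> A" for p
  proof -
    define r where "r = inv_into A \<Phi> (\<Phi> p)"
    have r: "r \<in> R" "\<Phi> r = \<Phi> p" using that by (auto simp: r_def R_def f_inv_into_f)
    have p: "irr p" "irr r" using that RA[OF r(1)] by (auto simp: A_def)
    have in_\<Phi>: "rt q \<in> \<Phi> q" for q unfolding \<Phi>_def by (rule image_eqI[of _ _ "[:0, 1:]"]) auto
    obtain f where f: "f \<in> P0" "rt r = ev (rt p) f" using in_\<Phi>[of r] r unfolding \<Phi>_def by auto
    obtain h where h: "h \<in> P0" "rt p = ev (rt r) h" using in_\<Phi>[of p] r unfolding \<Phi>_def by auto
    have "ev (rt p) (pcompose r f) = 0" using rt[OF p(2)] by (simp flip: f(2))
    then have "p dvd pcompose r f"
      using irr_dvd_iff_ev[OF p(1) rt[OF p(1)] P0_pcompose[OF irrD(1)[OF p(2)] f(1)]] by blast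
    moreover have "ev (rt p) (pcompose h f - [:0, 1:]) = 0"
      using h(2)[symmetric] by (simp flip: f(2))
    then have "p dvd pcompose h f - [:0, 1:]"
      using irr_dvd_iff_ev[OF p(1) rt[OF p(1)], of "pcompose h f - [:0, 1:]"] f(1) h(1) by simp
    ultimately show ?thesis using f h r by blast
  qed
  ultimately show ?thesis by (intro exI[of _ R]) (auto simp: A_def)
qed

text \<open>
  The class of \<open>\<beta>\<close> modulo squares is recorded by the field \<open>L(\<surd>\<beta>)\<close>, where \<open>L\<close> is generated by a root
  of \<open>r\<close>.
\<close>

lemma finite_square_classes:
  assumes r: "irr r"
  shows "\<exists>\<kappa> :: 'f poly \<Rightarrow> 'f alg_closure set. finite (range \<kappa>) \<and>
    (\<forall>\<beta>\<in>P0. \<forall>\<beta>'\<in>P0. \<not> r dvd \<beta> \<longrightarrow> \<not> r dvd \<beta>' \<longrightarrow> \<kappa> \<beta> = \<kappa> \<beta>' \<longrightarrow> (\<exists>y\<in>P0. r dvd \<beta>' - y ^ 2 * \<beta>))"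
proof -
  define d where "d = Polynomial.degree r"
  have d: "d > 0" using r by (simp add: d_def irr_def)
  then obtain \<theta> where \<theta>: "ev \<theta> r = 0" using ex_ev_root unfolding d_def by metis
  have "\<exists>s. s ^ 2 = ev \<theta> \<beta>" for \<beta> using nth_root_exists[of 2 "ev \<theta> \<beta>"] by auto
  then obtain s where s: "\<And>\<beta>. s \<beta> ^ 2 = ev \<theta> \<beta>" by metis
  define L where "L = ev \<theta> ` P0"
  have L: "subalg L" unfolding L_def by (rule subalg_ev_image)
  have Lc: "x + y \<in> L" "x * y \<in> L" if "x \<in> L" "y \<in> L" for x y
    using L that by (auto simp: subalg_def)
  note L0 = subalg_0_1_minus[OF L]
  \<comment> \<open>The set is \<open>L(\<surd>\<beta>)\<close>; the dummy value outside
    \<open>P0\<close> keeps the range finite.\<close>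
  define \<kappa> where "\<kappa> \<beta> = (if \<beta> \<in> P0 then {x + y * s \<beta> | x y. x \<in> L \<and> y \<in> L} else {})" for \<beta>
  have ext: "\<kappa> \<beta> \<in> exts (d + d)" if \<beta>: "\<beta> \<in> P0" for \<beta>
  \<comment> \<open>Spanning family: \<open>\<theta>^i\<close> for \<open>i < d\<close>, followed by
    the same powers times \<open>s \<beta>\<close>.\<close>
  proof (rule extsI[of _ _ "\<lambda>i. if i < d then \<theta> ^ i else \<theta> ^ (i - d) * s \<beta>"])
    have \<kappa>I: "x + y * s \<beta> \<in> \<kappa> \<beta>" if "x \<in> L" "y \<in> L" for x y using that \<beta> by (auto simp: \<kappa>_def)
    show "subalg (\<kappa> \<beta>)"
      unfolding subalg_def
    proof (intro conjI allI impI ballI)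
      fix a assume "\<sigma> a = a"
      then have "to_ac a \<in> L" using L by (simp add: subalg_def)
      then show "to_ac a \<in> \<kappa> \<beta>" using \<kappa>I[of "to_ac a" 0] L0 by simp
    next
      fix u v assume "u \<in> \<kappa> \<beta>" "v \<in> \<kappa> \<beta>"
      then obtain x y x' y' where xy: "x \<in> L" "y \<in> L" "x' \<in> L" "y' \<in> L"
        and uv: "u = x + y * s \<beta>" "v = x' + y' * s \<beta>" using \<beta> by (auto simp: \<kappa>_def)
      have "ev \<theta> \<beta> \<in> L" using \<beta> by (simp add: L_def)
      then have "(x * x' + y * y' * ev \<theta> \<beta>) + (x * y' + x' * y) * s \<beta> \<in> \<kappa> \<beta>"
        by (intro \<kappa>I Lc xy)
      moreover have "u * v = (x * x' + y * y' * ev \<theta> \<beta>) + (x * y' + x' * y) * s \<beta>"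
        by (simp add: uv algebra_simps power2_eq_square flip: s)
      ultimately show "u * v \<in> \<kappa> \<beta>" by simp
      have "(x + x') + (y + y') * s \<beta> \<in> \<kappa> \<beta>" by (intro \<kappa>I Lc xy)
      then show "u + v \<in> \<kappa> \<beta>" by (simp add: uv algebra_simps)
    qed
    have "\<theta> ^ i \<in> L" for i unfolding L_def by (rule image_eqI[of _ _ "[:0, 1:] ^ i"]) auto
    then show "(if i < d then \<theta> ^ i else \<theta> ^ (i - d) * s \<beta>) \<in> \<kappa> \<beta>" for i
      using \<kappa>I[of "\<theta> ^ i" 0] \<kappa>I[of 0 "\<theta> ^ (i - d)"] L0 by auto
    show "\<kappa> \<beta> \<subseteq> lspan (d + d) (\<lambda>i. if i < d then \<theta> ^ i else \<theta> ^ (i - d) * s \<beta>)"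
    proof
      fix u assume "u \<in> \<kappa> \<beta>"
      then obtain p q where pq: "p \<in> P0" "q \<in> P0" "u = ev \<theta> p + ev \<theta> q * s \<beta>"
        using \<beta> by (auto simp: \<kappa>_def L_def)
      have "Polynomial.degree r \<le> d" by (simp add: d_def)
      note sp = ev_lspan[OF r \<theta> this]
      from sp[OF pq(1)] obtain a where a: "\<And>i. \<sigma> (a i) = a i" "ev \<theta> p = (\<Sum>i<d. to_ac (a i) * \<theta> ^ i)"
        by blast
      from sp[OF pq(2)] obtain b where b: "\<And>i. \<sigma> (b i) = b i" "ev \<theta> q = (\<Sum>i<d. to_ac (b i) * \<theta> ^ i)"
        by blast
      show "u \<in> lspan (d + d) (\<lambda>i. if i < d then \<theta> ^ i else \<theta> ^ (i - d) * s \<beta>)"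
        unfolding lspan_def
        by (intro CollectI exI[of _ "\<lambda>i. if i < d then a i else b (i - d)"])
          (auto simp: a b pq sum_lessThan_add sum_distrib_right mult.assoc)
    qed
  qed
  have "range \<kappa> \<subseteq> insert {} (exts (d + d))" using ext by (auto simp: \<kappa>_def)
  then have fin: "finite (range \<kappa>)" by (rule finite_subset) (simp add: finite_exts)
  have ratio: "\<exists>y\<in>P0. r dvd \<beta>' - y ^ 2 * \<beta>"
    if "\<beta> \<in> P0" "\<beta>' \<in> P0" "b \<in> L" "ev \<theta> \<beta>' = b ^ 2 * ev \<theta> \<beta>" for \<beta> \<beta>' b
  proof -
    from that(3) obtain y where y: "y \<in> P0" "b = ev \<theta> y" by (auto simp: L_def)
    then have "r dvd \<beta>' - y ^ 2 * \<beta>"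
      using that irr_dvd_iff_ev[OF r \<theta>, of "\<beta>' - y ^ 2 * \<beta>"] by simp
    then show ?thesis using y by blast
  qed
  have "\<exists>y\<in>P0. r dvd \<beta>' - y ^ 2 * \<beta>"
    if \<beta>: "\<beta> \<in> P0" "\<beta>' \<in> P0" "\<not> r dvd \<beta>" "\<not> r dvd \<beta>'" and eq: "\<kappa> \<beta> = \<kappa> \<beta>'" for \<beta> \<beta>'
  proof -
    have s0: "s \<beta> \<noteq> 0" using s[of \<beta>] irr_dvd_iff_ev[OF r \<theta> \<beta>(1)] \<beta>(3) by auto
    have s_mem: "s \<gamma> \<in> \<kappa> \<gamma>" if "\<gamma> \<in> P0" for \<gamma>
    proof -
      have "0 + 1 * s \<gamma> \<in> \<kappa> \<gamma>"
        using L0(1,2) that unfolding \<kappa>_def if_P[OF that] by blast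
      then show ?thesis by simp
    qed
    have "s \<beta>' \<in> \<kappa> \<beta>" using s_mem[OF \<beta>(2)] eq by simp
    then obtain a b where ab: "a \<in> L" "b \<in> L" "s \<beta>' = a + b * s \<beta>"
      using \<beta> by (auto simp: \<kappa>_def)
    have quot: "x * y' \<in> L" if "x \<in> L" "y \<in> L" "y * y' = 1" for x y y'
    proof -
      have "y \<noteq> 0" using that by auto
      from subalg_inverse[OF L that(2) this] obtain z where "z \<in> L" "y * z = 1" by blast
      then have "z = y'" using that \<open>y \<noteq> 0\<close> by (metis mult_left_cancel)
      then show ?thesis using Lc that \<open>z \<in> L\<close> by blast
    qed
    show ?thesis
    \<comment> \<open>If \<open>\<surd>\<beta>\<close> lies in \<open>L\<close>, so does
      \<open>\<surd>\<beta>'\<close>, and their quotient is the required root. Otherwise squaring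
      \<open>\<surd>\<beta>' = a + b \<surd>\<beta>\<close> leaves a cross term to be
      examined.\<close>
    proof (cases "s \<beta> \<in> L")
      case True
      then have "s \<beta>' \<in> L" using ab Lc by simp
      then have "s \<beta>' * inverse (s \<beta>) \<in> L" using quot[of "s \<beta>'" "s \<beta>" "inverse (s \<beta>)"] True s0 by simp
      moreover have "ev \<theta> \<beta>' = (s \<beta>' * inverse (s \<beta>)) ^ 2 * ev \<theta> \<beta>"
        using s0 by (simp add: power_mult_distrib flip: s) (simp add: field_simps)
      ultimately show ?thesis using ratio \<beta> by blast
    next
      case False
      have "ev \<theta> \<beta>' = a ^ 2 + b ^ 2 * ev \<theta> \<beta> + 2 * a * b * s \<beta>"
        using s[of \<beta>'] s[of \<beta>] by (simp add: ab power2_eq_square algebra_simps)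
      then have e: "ev \<theta> \<beta>' + - (a ^ 2 + b ^ 2 * ev \<theta> \<beta>) = s \<beta> * (2 * a * b)" by simp
      have L2: "1 + 1 \<in> L" using L0 Lc by blast
      \<comment> \<open>A nonzero cross term could be divided out, which would put
        \<open>\<surd>\<beta>\<close> into \<open>L\<close>.\<close>
      have "2 * a * b = 0"
      proof (rule ccontr)
        assume n0: "2 * a * b \<noteq> 0"
        have "2 * a * b \<in> L" using L2 ab Lc by simp
        moreover have "ev \<theta> \<beta>' + - (a ^ 2 + b ^ 2 * ev \<theta> \<beta>) \<in> L"
          unfolding power2_eq_square using \<beta> by (intro Lc L0(3) ab) (auto simp: L_def)
        ultimately have "s \<beta> * (2 * a * b) * inverse (2 * a * b) \<in> L"
          using quot[of "s \<beta> * (2 * a * b)" "2 * a * b" "inverse (2 * a * b)"] n0 e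
          by (metis right_inverse)
        then show False using False n0 by (simp add: field_simps)
      qed
      moreover have "(2 :: 'f alg_closure) \<noteq> 0"
        using two_neq_0 by (metis to_ac_eq_0_iff to_ac_numeral)
      ultimately consider "a = 0" | "b = 0" by auto
      then show ?thesis
      proof cases
        case 1
        then have "ev \<theta> \<beta>' = b ^ 2 * ev \<theta> \<beta>" using e by (simp add: eq_neg_iff_add_eq_0)
        then show ?thesis using ratio \<beta> ab by blast
      next
        \<comment> \<open>Here \<open>L(\<surd>\<beta>')\<close> collapses to \<open>L\<close>, yet
          it contains \<open>\<surd>\<beta>\<close>, which is not in \<open>L\<close>.\<close>
        case 2
        then have "s \<beta>' \<in> L" using ab by simp
        moreover have "s \<beta> \<in> \<kappa> \<beta>'" using s_mem[OF \<beta>(1)] eq by simp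
        then obtain a' b' where "a' \<in> L" "b' \<in> L" "s \<beta> = a' + b' * s \<beta>'"
          using \<beta> by (auto simp: \<kappa>_def)
        ultimately show ?thesis using False Lc by auto
      qed
    qed
  qed
  then show ?thesis using fin by blast
qed

end

section \<open>Self-adjoint operators and orthogonal decompositions\<close>

locale hermitian_space = fe_field \<sigma> + finite_dimensional_vector_space scale Bs
  for \<sigma> :: "'f :: Fields.field \<Rightarrow> 'f" and scale :: "'f \<Rightarrow> 'v :: ab_group_add \<Rightarrow> 'v" and Bs +
  fixes B :: "'v \<Rightarrow> 'v \<Rightarrow> 'f"
  assumes hermitian: "hermitian_form \<sigma> scale B"
    and nondegenerate_B: "nondegenerate B"
begin

abbreviation endo :: "('v \<Rightarrow> 'v) \<Rightarrow> bool" where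
  "endo \<equiv> Vector_Spaces.linear scale scale"

lemma endoD:
  assumes "endo S"
  shows "S (u + v) = S u + S v" "S (scale a u) = scale a (S u)" "S 0 = 0" "S (u - v) = S u - S v"
proof -
  interpret S: Vector_Spaces.linear scale scale S by fact
  show "S (u + v) = S u + S v" "S (scale a u) = scale a (S u)" "S 0 = 0" "S (u - v) = S u - S v"
    by (simp_all add: S.add S.scale S.zero S.diff)
qed

lemma endoI:
  assumes "\<And>u v. S (u + v) = S u + S v" "\<And>a u. S (scale a u) = scale a (S u)"
  shows "endo S"
  by unfold_locales (use assms in auto)

lemma B_add_left [simp]: "B (u + v) w = B u w + B v w"
  and B_scale_left [simp]: "B (scale a u) v = a * B u v"
  and B_add_right [simp]: "B u (v + w) = B u v + B u w"
  and B_scale_right [simp]: "B u (scale a v) = \<sigma> a * B u v"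
  and B_sym: "B u v = \<sigma> (B v u)"
  using hermitian unfolding hermitian_form_def by blast+

lemma B_0_left [simp]: "B 0 v = 0" and B_0_right [simp]: "B v 0 = 0"
  using B_scale_left[of 0 0 v] B_scale_right[of v 0 0] by simp_all

lemma B_minus_left [simp]: "B (- u) v = - B u v" and B_minus_right [simp]: "B v (- u) = - B v u"
  using B_add_left[of u "- u" v] B_add_right[of v u "- u"]
  by (simp_all add: eq_neg_iff_add_eq_0 add.commute del: B_add_left B_add_right)

lemma B_diff_left [simp]: "B (u - v) w = B u w - B v w" and B_diff_right [simp]: "B w (u - v) = B w u - B w v"
  using B_add_left[of u "- v" w] B_add_right[of w u "- v"] by simp_all

lemma B_eq_0_sym: "B u v = 0 \<longleftrightarrow> B v u = 0"
  by (metis B_sym conj_0)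

text \<open>The vector \<open>p(S) v\<close>, that is, the module structure over the polynomial ring
  in which \<open>x\<close> acts as \<open>S\<close>. The fold is Horner's scheme.\<close>

definition pact :: "('v \<Rightarrow> 'v) \<Rightarrow> 'f poly \<Rightarrow> 'v \<Rightarrow> 'v" where
  "pact S p = fold_coeffs (\<lambda>a g v. scale a v + S (g v)) p (\<lambda>v. 0)"

lemma pact_0 [simp]: "pact S 0 v = 0"
  by (simp add: pact_def)

context
  fixes S assumes S: "endo S"
begin

lemma pact_pCons [simp]: "pact S (pCons a p) v = scale a v + S (pact S p v)"
  by (cases "a = 0"; cases "p = 0") (auto simp: pact_def endoD[OF S])

lemma pact_1 [simp]: "pact S 1 v = v"
  by (simp add: one_pCons endoD[OF S])

lemma pact_X: "pact S [:0, 1:] v = S v"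
  by (simp add: endoD[OF S])

lemma pact_add: "pact S (p + q) v = pact S p v + pact S q v"
  by (induction p q rule: poly_induct2) (auto simp: endoD[OF S] scale_left_distrib algebra_simps)

lemma pact_smult: "pact S (smult a p) v = scale a (pact S p v)"
  by (induction p) (auto simp: endoD[OF S] scale_right_distrib)

lemma pact_minus: "pact S (- p) v = - pact S p v"
  using pact_add[of p "- p" v] by (simp add: eq_neg_iff_add_eq_0 add.commute)

lemma pact_diff: "pact S (p - q) v = pact S p v - pact S q v"
  using pact_add[of p "- q" v] by (simp add: pact_minus)

lemma endo_pact: "endo (pact S p)"
proof (induction p)
  case 0
  show ?case by (rule endoI) auto
next
  case (pCons a p)
  show ?case
    by (rule endoI) (auto simp: endoD[OF S] endoD[OF pCons(2)] scale_right_distrib scale_left_commute)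
qed

lemma pact_S: "pact S p (S v) = S (pact S p v)"
  by (induction p) (auto simp: endoD[OF S])

lemma pact_mult: "pact S (p * q) v = pact S p (pact S q v)"
  by (induction p) (auto simp: endoD[OF S] pact_add pact_smult)

lemma pact_commute: "pact S p (pact S q v) = pact S q (pact S p v)"
  by (metis pact_mult mult.commute)

lemma pact_dvd: "q dvd p \<Longrightarrow> pact S q v = 0 \<Longrightarrow> pact S p v = 0"
  by (auto simp: pact_mult pact_commute endoD[OF endo_pact] elim!: dvdE)

lemma pact_in:
  assumes "subspace W" "S ` W \<subseteq> W" "v \<in> W" shows "pact S p v \<in> W"
  by (induction p) (use assms in \<open>auto intro!: subspace_0 subspace_add subspace_scale\<close>)

text \<open>Moving \<open>S\<close> across the form conjugates only the scalars. For
  \<open>p\<close> in \<open>P0\<close> nothing changes, which is what makes kernels of coprime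
  polynomials orthogonal.\<close>

lemma pact_selfadjoint:
  assumes "subspace W" "S ` W \<subseteq> W" "\<And>u v. u \<in> W \<Longrightarrow> v \<in> W \<Longrightarrow> B (S u) v = B u (S v)"
    and "u \<in> W" "v \<in> W"
  shows "B (pact S p u) v = B u (pact S (conj_poly p) v)"
  using assms(5)
proof (induction p arbitrary: v)
  case (pCons a p)
  have "S v \<in> W" using assms(2) pCons.prems by blast
  then show ?case
    using pCons assms(3)[OF pact_in[OF assms(1,2,4), of p] pCons.prems]
    by (simp add: map_poly_pCons pact_S)
qed simp

end

text \<open>Linearity is asked of \<open>g\<close> on \<open>W\<close> only, since an isometry in
  the sense of \<open>isom\<close> is arbitrary outside its domain.\<close>

lemma pact_intertwine:
  assumes S: "endo S" and W: "subspace W" "S ` W \<subseteq> W" and S': "endo S'"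
    and g: "\<And>u v. u \<in> W \<Longrightarrow> v \<in> W \<Longrightarrow> g (u + v) = g u + g v" "\<And>a u. u \<in> W \<Longrightarrow> g (scale a u) = scale a (g u)"
    and gS: "\<And>w. w \<in> W \<Longrightarrow> g (S w) = S' (g w)" and w: "w \<in> W"
  shows "g (pact S p w) = pact S' p (g w)"
proof (induction p)
  case 0
  show ?case using g(2)[of 0 0] W by (simp add: subspace_0)
next
  case (pCons a p)
  have "pact S p w \<in> W" by (rule pact_in[OF S W w])
  moreover have "S (pact S p w) \<in> W" "scale a w \<in> W"
    using calculation W w by (auto intro: subspace_scale)
  ultimately show ?case
    using pCons w by (simp add: S S' g gS)
qed

lemma pact_pcompose:
  assumes S: "endo S" shows "pact S (pcompose p q) v = pact (pact S q) p v"
  by (induction p) (auto simp: pcompose_pCons S endoD[OF S] endo_pact[OF S] pact_add[OF S] pact_mult[OF S])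

lemma pact_monom: "endo S \<Longrightarrow> pact S (Polynomial.monom a i) v = scale a ((S ^^ i) v)"
  by (induction i) (auto simp: monom_0 monom_Suc endoD)

lemma pact_sum: "endo S \<Longrightarrow> pact S (sum f A) v = (\<Sum>x\<in>A. pact S (f x) v)"
  by (induction A rule: infinite_finite_induct) (auto simp: pact_add)

text \<open>The vectors \<open>w, S w, ..., S^d w\<close>, with \<open>d\<close> the dimension, are
  dependent over the large field. The norm \<open>f * conj_poly f\<close> has fixed coefficients at
  the price of doubling the degree; this is the origin of the bound
  \<open>2 * dimension\<close>.\<close>

lemma ex_annihilator:
  assumes S: "endo S"
  shows "\<exists>f\<in>P0. f \<noteq> 0 \<and> Polynomial.degree f \<le> 2 * dimension \<and> pact S f w = 0"
proof -
  have "\<exists>f. f \<noteq> 0 \<and> Polynomial.degree f \<le> dimension \<and> pact S f w = 0"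
  \<comment> \<open>Dependence is a property of the set of these vectors, so a repetition among them
    is treated apart.\<close>
  proof (cases "inj_on (\<lambda>i. (S ^^ i) w) {..dimension}")
    case False
    then obtain i j where ij: "i \<le> dimension" "j \<le> dimension" "i \<noteq> j" "(S ^^ i) w = (S ^^ j) w"
      unfolding inj_on_def by auto
    let ?f = "Polynomial.monom 1 i - Polynomial.monom 1 j :: 'f poly"
    have "Polynomial.coeff ?f i \<noteq> 0" using ij by simp
    then have "?f \<noteq> 0" by (metis Polynomial.coeff_0)
    moreover have "Polynomial.degree ?f \<le> dimension"
      using ij by (intro degree_diff_le degree_monom_le order.trans[OF degree_monom_le])
    moreover have "pact S ?f w = 0"
      using ij by (simp add: pact_diff[OF S] pact_monom[OF S])
    ultimately show ?thesis by blast
  next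
    case True
    let ?A = "(\<lambda>i. (S ^^ i) w) ` {..dimension}"
    have "card ?A = Suc dimension" using True by (simp add: card_image)
    then have "dependent ?A"
      using dim_subset_UNIV[of ?A] by (intro dependent_biggerset_general) simp
    moreover have "finite ?A" by simp
    ultimately obtain u where u: "\<exists>v\<in>?A. u v \<noteq> 0" "(\<Sum>v\<in>?A. scale (u v) v) = 0"
      using dependent_finite by blast
    define f where "f = (\<Sum>i\<le>dimension. Polynomial.monom (u ((S ^^ i) w)) i)"
    have c: "Polynomial.coeff f i = (if i \<le> dimension then u ((S ^^ i) w) else 0)" for i
      by (simp add: f_def coeff_sum)
    have "Polynomial.degree f \<le> dimension" by (rule degree_le) (simp add: c)
    moreover have "f \<noteq> 0" using u(1) c by (auto simp: poly_eq_iff)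
    moreover have "pact S f w = 0"
      using u(2) by (simp add: f_def pact_sum[OF S] pact_monom[OF S] sum.reindex[OF True])
    ultimately show ?thesis by blast
  qed
  then obtain f where f: "f \<noteq> 0" "Polynomial.degree f \<le> dimension" "pact S f w = 0" by blast
  have "f * conj_poly f \<in> P0" by (simp add: P0_iff conj_poly_mult mult.commute)
  moreover have "Polynomial.degree (f * conj_poly f) \<le> 2 * dimension"
    using f(1,2) by (simp add: degree_mult_eq)
  moreover have "pact S (f * conj_poly f) w = 0" by (rule pact_dvd[OF S dvd_triv_left f(3)])
  ultimately show ?thesis using f(1) by (intro bexI[of _ "f * conj_poly f"]) auto
qed

lemma ex_global_annihilator:
  assumes S: "endo S" shows "\<exists>q\<in>P0. q \<noteq> 0 \<and> (\<forall>w. pact S q w = 0)"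
proof -
  have "\<exists>q\<in>P0. q \<noteq> 0 \<and> (\<forall>w\<in>A. pact S q w = 0)" if "finite A" for A
    using that
  proof induction
    case empty
    show ?case by (intro bexI[of _ 1]) auto
  next
    case (insert a A)
    then obtain q where q: "q \<in> P0" "q \<noteq> 0" "\<forall>w\<in>A. pact S q w = 0" by blast
    obtain f where f: "f \<in> P0" "f \<noteq> 0" "pact S f a = 0" using ex_annihilator[OF S] by blast
    have "pact S (q * f) a = 0" by (rule pact_dvd[OF S dvd_triv_right f(3)])
    moreover have "pact S (q * f) w = 0" if "w \<in> A" for w
      using q(3) that by (intro pact_dvd[OF S dvd_triv_left]) blast
    ultimately show ?case using q f by (intro bexI[of _ "q * f"]) auto
  qed
  from this[OF finite_Basis] obtain q where q: "q \<in> P0" "q \<noteq> 0" "\<forall>w\<in>Bs. pact S q w = 0" by blast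
  have "subspace {w. pact S q w = 0}"
    by (auto simp: subspace_def endoD[OF endo_pact[OF S]])
  then have "span Bs \<subseteq> {w. pact S q w = 0}" using q(3) by (intro span_minimal) auto
  then show ?thesis using q span_Basis by blast
qed

section \<open>Nondegenerate subspaces and orthogonal sums\<close>

definition nondeg :: "'v set \<Rightarrow> bool" where
  "nondeg W \<longleftrightarrow> (\<forall>u\<in>W. (\<forall>v\<in>W. B u v = 0) \<longrightarrow> u = 0)"

lemma nondegD: "nondeg W \<Longrightarrow> u \<in> W \<Longrightarrow> (\<And>v. v \<in> W \<Longrightarrow> B u v = 0) \<Longrightarrow> u = 0"
  by (auto simp: nondeg_def)

text \<open>\<open>S\<close> stays an operator on all of \<open>V\<close>, so that passing to an
  invariant summand changes only \<open>W\<close>.\<close>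

definition sa :: "'v set \<Rightarrow> ('v \<Rightarrow> 'v) \<Rightarrow> bool" where
  "sa W S \<longleftrightarrow> endo S \<and> subspace W \<and> nondeg W \<and> S ` W \<subseteq> W \<and>
     (\<forall>u\<in>W. \<forall>v\<in>W. B (S u) v = B u (S v))"

lemma saD:
  assumes "sa W S"
  shows "endo S" "subspace W" "nondeg W" "S ` W \<subseteq> W" "v \<in> W \<Longrightarrow> S v \<in> W"
    "u \<in> W \<Longrightarrow> v \<in> W \<Longrightarrow> B (S u) v = B u (S v)" "v \<in> W \<Longrightarrow> pact S p v \<in> W"
    "u \<in> W \<Longrightarrow> v \<in> W \<Longrightarrow> B (pact S p u) v = B u (pact S (conj_poly p) v)"
proof -
  show *: "endo S" "subspace W" "nondeg W" "S ` W \<subseteq> W" "v \<in> W \<Longrightarrow> S v \<in> W"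
    "u \<in> W \<Longrightarrow> v \<in> W \<Longrightarrow> B (S u) v = B u (S v)"
    using assms unfolding sa_def by blast+
  show "v \<in> W \<Longrightarrow> pact S p v \<in> W" using pact_in * by blast
  show "u \<in> W \<Longrightarrow> v \<in> W \<Longrightarrow> B (pact S p u) v = B u (pact S (conj_poly p) v)"
    using assms by (intro pact_selfadjoint[of S W]) (auto simp: sa_def)
qed

text \<open>Nondegeneracy makes the map from \<open>b\<close> to the values \<open>B b e\<close> on
  a basis injective, and equality of dimensions makes it surjective.\<close>

lemma riesz:
  assumes W: "subspace W" "nondeg W"
    and \<phi>: "\<And>u v. u \<in> W \<Longrightarrow> v \<in> W \<Longrightarrow> \<phi> (u + v) = \<phi> u + \<phi> v"
      "\<And>a u. u \<in> W \<Longrightarrow> \<phi> (scale a u) = a * \<phi> u"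
  shows "\<exists>b\<in>W. \<forall>w\<in>W. \<phi> w = B w b"
proof -
  obtain E where E: "E \<subseteq> W" "independent E" "W \<subseteq> span E" "card E = dim W" by (rule basis_exists)
  have spanE: "span E = W" using E W by (metis span_subspace)
  have fin: "finite E" using E(2) by (rule finiteI_independent)
  \<comment> \<open>Taking these values as coordinates turns the map into an endomorphism; with
    \<open>b\<close> in the first argument it is linear and not semilinear.\<close>
  define T where "T b = (\<Sum>e\<in>E. scale (B b e) e)" for b
  have T: "endo T"
    by (rule endoI) (auto simp: T_def scale_left_distrib sum.distrib scale_sum_right)
  interpret T: Vector_Spaces.linear scale scale T by (rule T)
  have TW: "T ` W \<subseteq> W" using E(1) W(1) by (auto simp: T_def intro!: subspace_sum subspace_scale)
  have "inj_on T W"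
    unfolding T.inj_on_iff_eq_0[OF W(1)]
  proof (intro ballI impI)
    fix b assume b: "b \<in> W" "T b = 0"
    have 0: "B b e = 0" if "e \<in> E" for e
      using independentD[OF E(2) fin order.refl, of "B b" e] b(2) that by (simp add: T_def)
    have "B w b = 0" if "w \<in> span E" for w
      using that 0 by (induction rule: span_induct_alt) (auto dest: B_eq_0_sym[THEN iffD1])
    then show "b = 0" using W(2) b(1) spanE by (metis B_eq_0_sym nondegD)
  qed
  then have indep: "independent (T ` E)"
    using E(2) T.independent_injective_image spanE by simp
  have "card (T ` E) = dim W"
    using \<open>inj_on T W\<close> E by (metis card_image inj_on_subset)
  then have "W \<subseteq> span (T ` E)"
    using indep TW E(1) by (intro card_ge_dim_independent) auto
  then have surj: "W \<subseteq> T ` W"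
    using T.span_image[of E] spanE by simp
  \<comment> \<open>The target is conjugated because \<open>T\<close> records \<open>B b e\<close>,
    whereas \<open>\<phi> e\<close> is to equal \<open>B e b\<close>.\<close>
  have "(\<Sum>e\<in>E. scale (\<sigma> (\<phi> e)) e) \<in> W"
    using E(1) W(1) by (auto intro!: subspace_sum subspace_scale)
  then obtain b where b: "b \<in> W" "T b = (\<Sum>e\<in>E. scale (\<sigma> (\<phi> e)) e)" using surj by (auto simp: image_iff)
  have "(\<Sum>e\<in>E. scale (B b e - \<sigma> (\<phi> e)) e) = 0"
    using b(2) by (simp add: T_def scale_left_diff_distrib sum_subtractf)
  then have "B b e = \<sigma> (\<phi> e)" if "e \<in> E" for e
    using independentD[OF E(2) fin order.refl, of "\<lambda>e. B b e - \<sigma> (\<phi> e)" e] that by simp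
  then have e: "\<phi> e = B e b" if "e \<in> E" for e using that by (metis B_sym conj_conj)
  have \<phi>0: "\<phi> 0 = 0" using \<phi>(2)[of 0 0] W(1) by (simp add: subspace_0)
  have "w \<in> W \<and> \<phi> w = B w b" if "w \<in> span E" for w
    using that
  proof (induction rule: span_induct_alt)
    case base
    then show ?case using \<phi>0 W(1) by (simp add: subspace_0)
  next
    case (step c x y)
    then have "x \<in> W" using E(1) by blast
    then show ?case
      using step e \<phi> W(1) by (simp add: subspace_add subspace_scale)
  qed
  then show ?thesis using b(1) spanE by blast
qed

text \<open>Directness is a consequence: a vector common to both summands is orthogonal to
  \<open>W1\<close>, hence 0 when \<open>W1\<close> is nondegenerate.\<close>

definition orth_sum :: "'v set \<Rightarrow> 'v set \<Rightarrow> 'v set \<Rightarrow> bool" where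
  "orth_sum W W1 W2 \<longleftrightarrow> subspace W1 \<and> subspace W2 \<and> W1 \<subseteq> W \<and> W2 \<subseteq> W \<and>
     (\<forall>w\<in>W. \<exists>u\<in>W1. \<exists>v\<in>W2. w = u + v) \<and> (\<forall>u\<in>W1. \<forall>v\<in>W2. B u v = 0)"

lemma orth_sum_sa:
  assumes sum: "orth_sum W W1 W2" and sa: "sa W S" and inv: "S ` W1 \<subseteq> W1" "S ` W2 \<subseteq> W2"
  shows "sa W1 S" "sa W2 S"
proof -
  have "nondeg W1" unfolding nondeg_def
  proof (intro ballI impI)
    fix u assume u: "u \<in> W1" "\<forall>v\<in>W1. B u v = 0"
    have "B u w = 0" if w: "w \<in> W" for w
    proof -
      obtain a b where "a \<in> W1" "b \<in> W2" "w = a + b" using sum w by (auto simp: orth_sum_def)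
      then show ?thesis using u sum by (auto simp: orth_sum_def)
    qed
    then show "u = 0" using u(1) sum saD(3)[OF sa] by (auto simp: orth_sum_def nondeg_def)
  qed
  moreover have "nondeg W2" unfolding nondeg_def
  proof (intro ballI impI)
    fix u assume u: "u \<in> W2" "\<forall>v\<in>W2. B u v = 0"
    have "B u w = 0" if w: "w \<in> W" for w
    proof -
      obtain a b where "a \<in> W1" "b \<in> W2" "w = a + b" using sum w by (auto simp: orth_sum_def)
      then show ?thesis using u sum by (auto simp: orth_sum_def B_eq_0_sym[of u a])
    qed
    then show "u = 0" using u(1) sum saD(3)[OF sa] by (auto simp: orth_sum_def nondeg_def)
  qed
  ultimately show "sa W1 S" "sa W2 S" using sum sa inv unfolding sa_def orth_sum_def by blast+
qed

lemma orth_complement: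
  assumes sa: "sa W S" and W1: "subspace W1" "W1 \<subseteq> W" "nondeg W1" "S ` W1 \<subseteq> W1"
  defines "W2 \<equiv> {w \<in> W. \<forall>u\<in>W1. B w u = 0}"
  shows "orth_sum W W1 W2" "S ` W2 \<subseteq> W2"
proof -
  note W = saD[OF sa]
  have "subspace W2"
    using W(2) by (auto simp: W2_def subspace_def)
  moreover have "\<exists>u\<in>W1. \<exists>v\<in>W2. w = u + v" if w: "w \<in> W" for w
  proof -
    \<comment> \<open>\<open>b\<close> is the orthogonal projection of \<open>w\<close> to
      \<open>W1\<close>, supplied by Riesz representation.\<close>
    obtain b where b: "b \<in> W1" "\<And>u. u \<in> W1 \<Longrightarrow> B u w = B u b"
      using riesz[OF W1(1,3), of "\<lambda>u. B u w"] by auto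
    have "w - b \<in> W" using w b(1) W1(2) W(2) by (auto intro: subspace_diff)
    moreover have "B (w - b) u = 0" if "u \<in> W1" for u
      using b(2)[OF that] by (subst B_eq_0_sym) simp
    ultimately have "w - b \<in> W2" by (simp add: W2_def)
    then show ?thesis using b(1) by (intro bexI[of _ b] bexI[of _ "w - b"]) auto
  qed
  moreover have "B u v = 0" if "u \<in> W1" "v \<in> W2" for u v
    using that by (auto simp: W2_def B_eq_0_sym[of u v])
  ultimately show "orth_sum W W1 W2"
    using W1 by (auto simp: orth_sum_def W2_def)
  show "S ` W2 \<subseteq> W2"
  proof
    fix x assume "x \<in> S ` W2"
    then obtain w where w: "w \<in> W" "x = S w" "\<And>u. u \<in> W1 \<Longrightarrow> B w u = 0" by (auto simp: W2_def)
    have "B (S w) u = 0" if "u \<in> W1" for u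
      using W(6)[of w u] w W1(2,4) that by (auto simp: subset_iff)
    then show "x \<in> W2" using w W(5) by (auto simp: W2_def)
  qed
qed

text \<open>
  Linearity of an isometry is not part of the definition: it is automatic on nondegenerate subspaces.
\<close>

definition isom :: "'v set \<Rightarrow> 'v set \<Rightarrow> ('v \<Rightarrow> 'v) \<Rightarrow> bool" where
  "isom W W' g \<longleftrightarrow> g ` W = W' \<and> (\<forall>u\<in>W. \<forall>v\<in>W. B (g u) (g v) = B u v)"

text \<open>The defect of additivity is orthogonal to every \<open>g w\<close>, and these fill the
  nondegenerate space \<open>W'\<close>; scalars are treated alike. Injectivity comes from
  nondegeneracy of \<open>W\<close>.\<close>

lemma isom_linear:
  assumes g: "isom W W' g" and W: "subspace W" "nondeg W" and W': "subspace W'" "nondeg W'"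
  shows "u \<in> W \<Longrightarrow> v \<in> W \<Longrightarrow> g (u + v) = g u + g v"
    and "u \<in> W \<Longrightarrow> g (scale a u) = scale a (g u)"
    and "inj_on g W" and "g 0 = 0"
proof -
  have gW: "g u \<in> W'" if "u \<in> W" for u using g that by (auto simp: isom_def)
  have eqI: "x = y" if "x \<in> W'" "y \<in> W'" "\<And>w. w \<in> W \<Longrightarrow> B x (g w) = B y (g w)" for x y
  proof -
    have "B (x - y) w' = 0" if "w' \<in> W'" for w'
      using that g \<open>\<And>w. w \<in> W \<Longrightarrow> B x (g w) = B y (g w)\<close> by (auto simp: isom_def)
    moreover have "x - y \<in> W'" using that W'(1) by (auto intro: subspace_diff)
    ultimately show ?thesis using nondegD[OF W'(2), of "x - y"] by auto
  qed
  have iso: "B (g u) (g v) = B u v" if "u \<in> W" "v \<in> W" for u v using g that by (auto simp: isom_def)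
  show "g (u + v) = g u + g v" if "u \<in> W" "v \<in> W" for u v
    using that W W' by (intro eqI) (auto intro: gW subspace_add simp: iso subspace_add)
  show scale: "g (scale a u) = scale a (g u)" if "u \<in> W" for a u
    using that W W' by (intro eqI) (auto intro: gW subspace_scale simp: iso subspace_scale)
  show "g 0 = 0" using scale[of 0 0] W by (simp add: subspace_0)
  show "inj_on g W"
  proof (rule inj_onI)
    fix x y assume xy: "x \<in> W" "y \<in> W" "g x = g y"
    have "B (x - y) w = 0" if "w \<in> W" for w
      using iso[OF xy(1) that] iso[OF xy(2) that] xy(3) by simp
    then show "x = y" using nondegD[OF W(2), of "x - y"] xy W(1) by (auto intro: subspace_diff)
  qed
qed

lemma isom_glue:
  assumes sum: "orth_sum W W1 W2" "orth_sum W' W1' W2'"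
    and nd: "nondeg W1" "nondeg W2" "nondeg W1'" "nondeg W2'" "subspace W" "subspace W'"
    and g: "isom W1 W1' g1" "isom W2 W2' g2"
  shows "\<exists>g. isom W W' g \<and> (\<forall>u\<in>W1. \<forall>v\<in>W2. g (u + v) = g1 u + g2 v)"
proof -
  have sub: "subspace W1" "subspace W2" "subspace W1'" "subspace W2'" using sum by (auto simp: orth_sum_def)
  have uniq: "u = u' \<and> v = v'" if "u \<in> W1" "v \<in> W2" "u' \<in> W1" "v' \<in> W2" "u + v = u' + v'" for u v u' v'
  proof -
    have "u - u' = v' - v" using that(5) by (simp add: algebra_simps)
    moreover have 1: "u - u' \<in> W1" "v' - v \<in> W2"
      by (rule subspace_diff[OF sub(1) that(1,3)], rule subspace_diff[OF sub(2) that(4,2)])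
    moreover have "B w (v' - v) = 0" if "w \<in> W1" for w
      using that 1(2) sum(1) unfolding orth_sum_def by blast
    ultimately have "B w (u - u') = 0" if "w \<in> W1" for w using that by metis
    then have "u - u' = 0" using nondegD[OF nd(1) 1(1)] B_eq_0_sym by blast
    then show ?thesis using that(5) by simp
  qed
  \<comment> \<open>The value is forced on \<open>W1 + W2\<close> by uniqueness of the
    decomposition, and arbitrary elsewhere.\<close>
  have "\<exists>x. \<forall>u\<in>W1. \<forall>v\<in>W2. w = u + v \<longrightarrow> x = g1 u + g2 v" for w
    using uniq by metis
  then obtain g where gw: "\<And>w u v. u \<in> W1 \<Longrightarrow> v \<in> W2 \<Longrightarrow> w = u + v \<Longrightarrow> g w = g1 u + g2 v"
    by metis
  have dec: "\<exists>u\<in>W1. \<exists>v\<in>W2. w = u + v" if "w \<in> W" for w using sum(1) that by (auto simp: orth_sum_def)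
  have dec': "\<exists>u\<in>W1'. \<exists>v\<in>W2'. w = u + v" if "w \<in> W'" for w using sum(2) that by (auto simp: orth_sum_def)
  have in1: "g1 u \<in> W1'" if "u \<in> W1" for u using g(1) that by (auto simp: isom_def)
  have in2: "g2 u \<in> W2'" if "u \<in> W2" for u using g(2) that by (auto simp: isom_def)
  have o: "B u v = 0" "B v u = 0" if "u \<in> W1" "v \<in> W2" for u v
    using that sum(1) by (auto simp: orth_sum_def B_eq_0_sym[of v u])
  have o': "B u v = 0" "B v u = 0" if "u \<in> W1'" "v \<in> W2'" for u v
    using that sum(2) by (auto simp: orth_sum_def B_eq_0_sym[of v u])
  have "isom W W' g"
    unfolding isom_def
  proof (intro conjI ballI)
    show "g ` W = W'"
    proof (intro subset_antisym subsetI)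
      fix w' assume "w' \<in> g ` W"
      then obtain w where "w \<in> W" "w' = g w" by blast
      then obtain u v where "u \<in> W1" "v \<in> W2" "w' = g1 u + g2 v" using dec gw by metis
      then show "w' \<in> W'" using in1 in2 sum(2) nd(6) by (auto simp: orth_sum_def intro!: subspace_add)
    next
      fix w' assume "w' \<in> W'"
      then obtain u' v' where uv': "u' \<in> W1'" "v' \<in> W2'" "w' = u' + v'" using dec' by blast
      obtain u where u: "u \<in> W1" "u' = g1 u" using uv'(1) g(1) by (auto simp: isom_def)
      obtain v where v: "v \<in> W2" "v' = g2 v" using uv'(2) g(2) by (auto simp: isom_def)
      have "w' = g (u + v)" using gw[OF u(1) v(1) refl] uv'(3) u(2) v(2) by simp
      moreover have "u + v \<in> W" using u v sum(1) nd(5) by (auto simp: orth_sum_def intro!: subspace_add)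
      ultimately show "w' \<in> g ` W" by blast
    qed
  next
    fix x y assume "x \<in> W" "y \<in> W"
    then obtain u v a b where uv: "u \<in> W1" "v \<in> W2" "x = u + v" "a \<in> W1" "b \<in> W2" "y = a + b"
      using dec by metis
    then have "g x = g1 u + g2 v" "g y = g1 a + g2 b" using gw by auto
    moreover have "B (g1 u) (g1 a) = B u a" "B (g2 v) (g2 b) = B v b"
      using uv g by (auto simp: isom_def)
    ultimately show "B (g x) (g y) = B x y"
      using uv by (simp add: o o' in1 in2)
  qed
  then show ?thesis using gw by blast
qed

end

section \<open>Isometry classes of primary operators\<close>

text \<open>A colouring instead of a quotient, so that colourings of pieces can be combined before
  \<open>R\<close> is known to be an equivalence. Colours are natural numbers because a definition
  cannot quantify over types; \<open>finite_classesI\<close> admits any type.\<close>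

definition finite_classes :: "'a set \<Rightarrow> ('a \<Rightarrow> 'a \<Rightarrow> bool) \<Rightarrow> bool" where
  "finite_classes A R \<longleftrightarrow>
     (\<exists>\<kappa> :: 'a \<Rightarrow> nat. finite (\<kappa> ` A) \<and> (\<forall>x\<in>A. \<forall>y\<in>A. \<kappa> x = \<kappa> y \<longrightarrow> R x y))"

lemma finite_classesI:
  fixes \<kappa> :: "'a \<Rightarrow> 'c"
  assumes "finite (\<kappa> ` A)" "\<And>x y. x \<in> A \<Longrightarrow> y \<in> A \<Longrightarrow> \<kappa> x = \<kappa> y \<Longrightarrow> R x y"
  shows "finite_classes A R"
proof -
  obtain h :: "'c \<Rightarrow> nat" where h: "inj_on h (\<kappa> ` A)"
    using finite_imp_inj_to_nat_seg[OF assms(1)] by blast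
  have "finite ((h \<circ> \<kappa>) ` A)" using finite_imageI[OF assms(1), of h] by (simp only: image_comp)
  moreover have "R x y" if "x \<in> A" "y \<in> A" "(h \<circ> \<kappa>) x = (h \<circ> \<kappa>) y" for x y
    using assms(2) that h by (auto simp: inj_on_def)
  ultimately show ?thesis unfolding finite_classes_def by blast
qed

lemma finite_classes_pair:
  assumes "finite_classes Y Q" "finite_classes Z P"
    and "\<And>x. x \<in> A \<Longrightarrow> f x \<in> Y" "\<And>x. x \<in> A \<Longrightarrow> g x \<in> Z"
    and "\<And>x y. x \<in> A \<Longrightarrow> y \<in> A \<Longrightarrow> Q (f x) (f y) \<Longrightarrow> P (g x) (g y) \<Longrightarrow> R x y"
  shows "finite_classes A R"
proof -
  obtain \<kappa> :: "_ \<Rightarrow> nat" where \<kappa>: "finite (\<kappa> ` Y)" "\<And>x y. x \<in> Y \<Longrightarrow> y \<in> Y \<Longrightarrow> \<kappa> x = \<kappa> y \<Longrightarrow> Q x y"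
    using assms(1) unfolding finite_classes_def by blast
  obtain \<mu> :: "_ \<Rightarrow> nat" where \<mu>: "finite (\<mu> ` Z)" "\<And>x y. x \<in> Z \<Longrightarrow> y \<in> Z \<Longrightarrow> \<mu> x = \<mu> y \<Longrightarrow> P x y"
    using assms(2) unfolding finite_classes_def by blast
  show ?thesis
  proof (rule finite_classesI)
    show "finite ((\<lambda>x. (\<kappa> (f x), \<mu> (g x))) ` A)"
      by (rule finite_subset[of _ "\<kappa> ` Y \<times> \<mu> ` Z"]) (use \<kappa>(1) \<mu>(1) assms(3,4) in auto)
  qed (use \<kappa>(2) \<mu>(2) assms(3-5) in auto)
qed

lemma finite_classes_map:
  assumes "finite_classes Y Q" "\<And>x. x \<in> A \<Longrightarrow> f x \<in> Y"
    and "\<And>x y. x \<in> A \<Longrightarrow> y \<in> A \<Longrightarrow> Q (f x) (f y) \<Longrightarrow> R x y"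
  shows "finite_classes A R"
  by (rule finite_classes_pair[OF assms(1,1), of A f f]) (use assms(2,3) in auto)

lemma finite_classes_UN:
  assumes "finite I" "\<And>i. i \<in> I \<Longrightarrow> finite_classes (A i) R" "Y \<subseteq> (\<Union>i\<in>I. A i)"
  shows "finite_classes Y R"
proof -
  have "\<forall>i\<in>I. \<exists>\<kappa> :: 'b \<Rightarrow> nat. finite (\<kappa> ` A i) \<and> (\<forall>x\<in>A i. \<forall>y\<in>A i. \<kappa> x = \<kappa> y \<longrightarrow> R x y)"
    using assms(2) unfolding finite_classes_def by blast
  then obtain \<kappa> :: "'a \<Rightarrow> 'b \<Rightarrow> nat" where
    \<kappa>: "\<And>i. i \<in> I \<Longrightarrow> finite (\<kappa> i ` A i)"
      "\<And>i x y. i \<in> I \<Longrightarrow> x \<in> A i \<Longrightarrow> y \<in> A i \<Longrightarrow> \<kappa> i x = \<kappa> i y \<Longrightarrow> R x y"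
    by metis
  obtain i where i: "\<And>y. y \<in> Y \<Longrightarrow> i y \<in> I" "\<And>y. y \<in> Y \<Longrightarrow> y \<in> A (i y)"
    using assms(3) by (metis UN_E subsetD)
  show ?thesis
  proof (rule finite_classesI)
    show "finite ((\<lambda>y. (i y, \<kappa> (i y) y)) ` Y)"
      by (rule finite_subset[of _ "SIGMA j:I. \<kappa> j ` A j"]) (use assms(1) \<kappa>(1) i in auto)
    show "R x y" if "x \<in> Y" "y \<in> Y" "(i x, \<kappa> (i x) x) = (i y, \<kappa> (i y) y)" for x y
      using \<kappa>(2)[of "i x" x y] i that by auto
  qed
qed

context hermitian_space
begin

section \<open>Cyclic pieces and their functionals\<close>

definition congr :: "'v set \<times> ('v \<Rightarrow> 'v) \<Rightarrow> 'v set \<times> ('v \<Rightarrow> 'v) \<Rightarrow> bool" where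
  "congr x y \<longleftrightarrow> (\<exists>g. isom (fst x) (fst y) g \<and> (\<forall>w\<in>fst x. g (snd x w) = snd y (g w)))"

text \<open>Real and imaginary parts: since 2 is invertible, \<open>F[x]\<close> is the sum of
  \<open>F_0[x]\<close> and \<open>\<delta> F_0[x]\<close>.\<close>

lemma conj_decomp:
  fixes f :: "'f poly"
  obtains \<delta> f1 f2 where "\<delta> \<noteq> 0" "\<sigma> \<delta> = - \<delta>" "f1 \<in> P0" "f2 \<in> P0" "f = f1 + smult \<delta> f2"
proof -
  obtain \<delta> where \<delta>: "\<delta> \<noteq> 0" "\<sigma> \<delta> = - \<delta>" using ex_skew by blast
  let ?f1 = "smult (1/2) (f + conj_poly f)" and ?f2 = "smult (1/(2*\<delta>)) (f - conj_poly f)"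
  have "?f1 \<in> P0" "?f2 \<in> P0"
    using \<delta> two_neq_0 by (auto simp: P0_def field_simps)
  moreover have "f = ?f1 + smult \<delta> ?f2"
    using \<delta> two_neq_0 by (auto simp: poly_eq_iff field_simps)
  ultimately show thesis using \<delta> that by blast
qed

context
  fixes W S v assumes sa: "sa W S" and v: "v \<in> W"
begin

text \<open>The moment functional of \<open>v\<close>. By \<open>form_pact\<close> it determines the
  form on the subspace generated by \<open>v\<close> under \<open>S\<close>.\<close>

private abbreviation "\<phi> f \<equiv> B (pact S f v) v"

lemma functional_conj: "\<phi> (conj_poly f) = \<sigma> (\<phi> f)"
  using saD(8)[OF sa v v, of "conj_poly f"] B_sym[of v "pact S f v"] by simp

lemma functional_real: "f \<in> P0 \<Longrightarrow> \<sigma> (\<phi> f) = \<phi> f"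
  using functional_conj[of f] by (simp add: P0_iff)

lemma functional_add: "\<phi> (f + g) = \<phi> f + \<phi> g"
  and functional_smult: "\<phi> (smult a f) = a * \<phi> f"
  by (simp_all add: pact_add[OF saD(1)[OF sa]] pact_smult[OF saD(1)[OF sa]])

lemma form_pact: "B (pact S f v) (pact S g v) = \<phi> (conj_poly g * f)"
  using saD(8)[OF sa, of "pact S f v" v "conj_poly g"] v saD(7)[OF sa v]
  by (simp add: pact_mult[OF saD(1)[OF sa]])

text \<open>The functional does not vanish on the smallest nonzero ideal of
  \<open>F_0[x]/r^k\<close>, so \<open>\<phi> (f * g)\<close> is a nondegenerate pairing there. An
  \<open>f\<close> over the large field is handled through its two parts.\<close>

lemma dvd_of_orthogonal:
  assumes r: "irr r" and k: "pact S (r ^ k) v = 0" "\<phi> (r ^ (k - 1)) \<noteq> 0"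
    and f: "\<And>g. g \<in> P0 \<Longrightarrow> \<phi> (f * g) = 0"
  shows "r ^ k dvd f"
proof -
  obtain \<delta> f1 f2 where \<delta>: "\<delta> \<noteq> 0" "\<sigma> \<delta> = - \<delta>" and fP: "f1 \<in> P0" "f2 \<in> P0"
    and fe: "f = f1 + smult \<delta> f2" by (rule conj_decomp)
  have *: "\<phi> (f1 * g) = 0 \<and> \<phi> (f2 * g) = 0" if g: "g \<in> P0" for g
  proof -
    have "\<phi> (f * g) = \<phi> (f1 * g) + \<delta> * \<phi> (f2 * g)"
      by (simp only: fe distrib_right functional_add mult_smult_left functional_smult)
    then have 1: "\<phi> (f1 * g) + \<delta> * \<phi> (f2 * g) = 0" using f g by simp
    \<comment> \<open>Conjugation changes the sign of the skew part, so both parts vanish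
      separately.\<close>
    then have "\<sigma> (\<phi> (f1 * g) + \<delta> * \<phi> (f2 * g)) = 0" by simp
    then have 2: "\<phi> (f1 * g) - \<delta> * \<phi> (f2 * g) = 0"
      using functional_real fP g \<delta> by simp
    have "2 * \<phi> (f1 * g) = (\<phi> (f1 * g) + \<delta> * \<phi> (f2 * g)) + (\<phi> (f1 * g) - \<delta> * \<phi> (f2 * g))"
      by (simp add: algebra_simps)
    then have "\<phi> (f1 * g) = 0" using 1 2 two_neq_0 by simp
    then show ?thesis using 1 \<delta> by simp
  qed
  have "r ^ k dvd h" if h: "h \<in> P0" "\<And>g. g \<in> P0 \<Longrightarrow> \<phi> (h * g) = 0" for h
  proof (rule ccontr)
    assume "\<not> r ^ k dvd h"
    then obtain u w where uw: "u \<in> P0" "w \<in> P0" "u * h + w * r ^ k = r ^ (k - 1)"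
      using irr_power_gcd[OF r h(1)] by blast
    have "pact S (w * r ^ k) v = 0"
      by (rule pact_dvd[OF saD(1)[OF sa] dvd_triv_right k(1)])
    then have "\<phi> (r ^ (k - 1)) = \<phi> (h * u)"
      unfolding uw(3)[symmetric] functional_add by (simp add: mult.commute)
    then show False using h(2)[OF uw(1)] k(2) by simp
  qed
  then have "r ^ k dvd f1" "r ^ k dvd f2" using * fP by blast+
  then show ?thesis unfolding fe by (intro dvd_add dvd_smult)
qed

end

text \<open>The final condition says that the functional of \<open>v\<close> survives on the
  smallest ideal; it makes \<open>r ^ k\<close> the exact annihilator of \<open>v\<close>.\<close>

definition cyclic :: "'f poly \<Rightarrow> nat \<Rightarrow> 'v set \<Rightarrow> ('v \<Rightarrow> 'v) \<Rightarrow> 'v \<Rightarrow> bool" where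
  "cyclic r k W S v \<longleftrightarrow> sa W S \<and> v \<in> W \<and> W = range (\<lambda>f. pact S f v) \<and> k > 0 \<and>
     pact S (r ^ k) v = 0 \<and> B (pact S (r ^ (k - 1)) v) v \<noteq> 0"

lemma cyclicD:
  assumes "cyclic r k W S v"
  shows "sa W S" "v \<in> W" "W = range (\<lambda>f. pact S f v)" "k > 0" "pact S (r ^ k) v = 0"
    "B (pact S (r ^ (k - 1)) v) v \<noteq> 0" "endo S"
  using assms unfolding cyclic_def sa_def by blast+

lemma cyclic_annihilator:
  assumes c: "cyclic r k W S v" and r: "irr r"
  shows "pact S f v = 0 \<longleftrightarrow> r ^ k dvd f"
proof
  note c = cyclicD[OF c]
  assume "pact S f v = 0"
  then have "pact S (f * g) v = 0" for g
    by (rule pact_dvd[OF c(7) dvd_triv_left])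
  then show "r ^ k dvd f" by (intro dvd_of_orthogonal[OF c(1,2) r c(5,6)]) simp
next
  assume "r ^ k dvd f"
  then show "pact S f v = 0" using pact_dvd cyclicD(5,7)[OF c] by blast
qed

text \<open>
  By Riesz representation, the functional \<open>f \<mapsto> B(f(S')v', v')\<close> on \<open>F\<^sub>0[x]/r\<^sup>k\<close> is a multiple of the one
  attached to \<open>v\<close>. The coefficient a priori has coefficients in \<open>F\<close> and is averaged with its conjugate.
\<close>

lemma cyclic_transfer:
  assumes c: "cyclic r k W S v" and c': "cyclic r k W' S' v'" and r: "irr r"
  shows "\<exists>\<beta>\<in>P0. \<not> r dvd \<beta> \<and>
    (\<forall>f\<in>P0. B (pact S' f v') v' = B (pact S (\<beta> * f) v) v)"
proof -
  note C = cyclicD[OF c] and C' = cyclicD[OF c']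
  \<comment> \<open>The functional of \<open>v'\<close> descends to \<open>W\<close> because both
    pieces have the same annihilator.\<close>
  have wd: "pact S' f v' = pact S' g v'" if "pact S f v = pact S g v" for f g
  proof -
    have "pact S (f - g) v = 0" using that by (simp add: pact_diff[OF C(7)])
    then have "pact S' (f - g) v' = 0"
      using cyclic_annihilator[OF c r] cyclic_annihilator[OF c' r] by blast
    then show ?thesis by (simp add: pact_diff[OF C'(7)])
  qed
  have "\<forall>w. \<exists>x. \<forall>f. w = pact S f v \<longrightarrow> x = B (pact S' f v') v'"
    using wd by metis
  then obtain \<psi> where "\<And>w f. w = pact S f v \<Longrightarrow> \<psi> w = B (pact S' f v') v'"
    by metis
  then have \<psi>: "\<psi> (pact S f v) = B (pact S' f v') v'" for f by simp
  have add: "\<psi> (x + y) = \<psi> x + \<psi> y" if "x \<in> W" "y \<in> W" for x y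
  proof -
    from that obtain f g where fg: "x = pact S f v" "y = pact S g v" using C(3) by blast
    have "x + y = pact S (f + g) v" by (simp add: fg pact_add[OF C(7)])
    then show ?thesis by (simp only: fg \<psi>) (simp add: pact_add[OF C'(7)])
  qed
  have scale: "\<psi> (scale a x) = a * \<psi> x" if "x \<in> W" for a x
  proof -
    from that obtain f where f: "x = pact S f v" using C(3) by blast
    have "scale a x = pact S (smult a f) v" by (simp add: f pact_smult[OF C(7)])
    then show ?thesis by (simp only: f \<psi>) (simp add: pact_smult[OF C'(7)])
  qed
  obtain b where b: "b \<in> W" "\<And>w. w \<in> W \<Longrightarrow> \<psi> w = B w b"
    using riesz[OF saD(2,3)[OF C(1)] add scale] by blast
  obtain \<gamma> where \<gamma>: "b = pact S \<gamma> v" using b(1) C(3) by blast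
  let ?\<gamma> = "conj_poly \<gamma>"
  have \<gamma>1: "B (pact S' f v') v' = B (pact S (?\<gamma> * f) v) v" for f
    using b(2)[of "pact S f v"] C(3) \<psi> form_pact[OF C(1,2)] \<gamma> by auto
  define \<beta> where "\<beta> = smult (1/2) (\<gamma> + ?\<gamma>)"
  have \<beta>P: "\<beta> \<in> P0" by (auto simp: \<beta>_def P0_def field_simps)
  have \<beta>: "B (pact S' f v') v' = B (pact S (\<beta> * f) v) v" if f: "f \<in> P0" for f
  proof -
    have "conj_poly (?\<gamma> * f) = \<gamma> * f" using f by (simp add: conj_poly_mult P0_iff)
    then have "B (pact S (\<gamma> * f) v) v = \<sigma> (B (pact S (?\<gamma> * f) v) v)"
      using functional_conj[OF C(1,2), of "?\<gamma> * f"] by simp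
    also have "\<dots> = B (pact S' f v') v'"
      using \<gamma>1[of f] functional_real[OF C'(1,2) f] by simp
    finally have "B (pact S (\<beta> * f) v) v = (1/2) * (B (pact S' f v') v' + B (pact S' f v') v')"
      unfolding \<beta>_def mult_smult_left distrib_right functional_smult[OF C(1,2)]
        functional_add[OF C(1,2)] \<gamma>1[symmetric] by simp
    then show ?thesis using two_neq_0 by (simp flip: mult_2)
  qed
  \<comment> \<open>Otherwise the functional of \<open>v'\<close> would vanish at
    \<open>r^(k-1)\<close>.\<close>
  have "\<not> r dvd \<beta>"
  proof
    assume "r dvd \<beta>"
    then obtain c where "\<beta> = r * c" by blast
    then have "\<beta> * r ^ (k - 1) = r ^ k * c" using C(4) by (cases k) auto
    then have "pact S (\<beta> * r ^ (k - 1)) v = 0" using cyclic_annihilator[OF c r] by simp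
    then show False using \<beta>[of "r ^ (k - 1)"] C'(6) irrD[OF r] by auto
  qed
  then show ?thesis using \<beta>P \<beta> by blast
qed

text \<open>Send \<open>f(S') v'\<close> to \<open>f(S) y(S) v\<close>. As \<open>y(S)\<close> is
  self-adjoint, the functional of \<open>y(S) v\<close> is that of \<open>v\<close> multiplied by
  \<open>y^2\<close>, so the forms match.\<close>

lemma cyclic_congr:
  assumes c: "cyclic r k W S v" and c': "cyclic r k W' S' v'" and r: "irr r" and y: "y \<in> P0"
    and eq: "\<And>f. f \<in> P0 \<Longrightarrow> B (pact S' f v') v' = B (pact S (y ^ 2 * f) v) v"
  shows "congr (W', S') (W, S)"
proof -
  note C = cyclicD[OF c] and C' = cyclicD[OF c']
  have eq': "B (pact S' f v') v' = B (pact S (y ^ 2 * f) v) v" for f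
  proof -
    obtain \<delta> f1 f2 where fP: "f1 \<in> P0" "f2 \<in> P0" and fe: "f = f1 + smult \<delta> f2"
      by (rule conj_decomp)
    show ?thesis
      unfolding fe distrib_left mult_smult_right functional_add[OF C(1,2)] functional_add[OF C'(1,2)]
        functional_smult[OF C(1,2)] functional_smult[OF C'(1,2)] by (simp only: eq fP)
  qed
  define z where "z = pact S y v"
  have z: "pact S f z = pact S (f * y) v" for f by (simp add: z_def pact_mult[OF C(7)])
  have wd: "pact S f z = pact S g z" if "pact S' f v' = pact S' g v'" for f g
  proof -
    have "pact S' (f - g) v' = 0" using that by (simp add: pact_diff[OF C'(7)])
    then have "pact S (f - g) v = 0"
      using cyclic_annihilator[OF c r] cyclic_annihilator[OF c' r] by blast
    then have "pact S (f - g) z = 0" unfolding z by (rule pact_dvd[OF C(7) dvd_triv_left])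
    then show ?thesis by (simp add: pact_diff[OF C(7)])
  qed
  have "\<forall>w. \<exists>x. \<forall>f. w = pact S' f v' \<longrightarrow> x = pact S f z"
    using wd by metis
  then obtain h where "\<And>w f. w = pact S' f v' \<Longrightarrow> h w = pact S f z"
    by metis
  then have h: "h (pact S' f v') = pact S f z" for f by simp
  \<comment> \<open>\<open>y\<close> is a unit modulo \<open>r^k\<close>, which makes
    \<open>z\<close> a generator of \<open>W\<close> again.\<close>
  have "\<not> r dvd y"
  proof
    assume "r dvd y"
    then obtain c where "y = r * c" by blast
    then have "y ^ 2 * r ^ (k - 1) = r ^ k * (c * y)" using C(4) by (cases k) (auto simp: power2_eq_square)
    then have "pact S (y ^ 2 * r ^ (k - 1)) v = 0" using cyclic_annihilator[OF c r] by simp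
    then show False using eq[of "r ^ (k - 1)"] C'(6) irrD[OF r] by auto
  qed
  then obtain u w where uw: "u * y + w * r ^ k = 1" using irr_coprime_power[OF r y] by blast
  have "isom W' W h"
    unfolding isom_def
  proof (intro conjI ballI)
    have "pact S f v \<in> h ` W'" for f
    proof -
      have "pact S (f * (u * y + w * r ^ k)) v = pact S (f * u) z + pact S (f * w * r ^ k) v"
        unfolding z by (simp add: distrib_left pact_add[OF C(7)] mult.assoc)
      also have "pact S (f * w * r ^ k) v = 0" by (rule pact_dvd[OF C(7) dvd_triv_right C(5)])
      finally have "pact S f v = h (pact S' (f * u) v')" by (simp add: uw h)
      then show ?thesis using C'(3) by blast
    qed
    moreover have "h (pact S' f v') \<in> W" for f unfolding h z using C(3) by blast
    ultimately show "h ` W' = W" using C(3) C'(3) by blast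
  next
    fix a b assume "a \<in> W'" "b \<in> W'"
    then obtain f g where fg: "a = pact S' f v'" "b = pact S' g v'" using C'(3) by blast
    have "B (h a) (h b) = B (pact S (f * y) v) (pact S (g * y) v)" by (simp add: fg h z)
    also have "\<dots> = B (pact S (y ^ 2 * (conj_poly g * f)) v) v"
      using y by (simp add: form_pact[OF C(1,2)] conj_poly_mult P0_iff power2_eq_square mult_ac)
    also have "\<dots> = B a b" by (simp add: fg eq'[symmetric] form_pact[OF C'(1,2)])
    finally show "B (h a) (h b) = B a b" .
  qed
  moreover have "h (S' a) = S (h a)" if "a \<in> W'" for a
  proof -
    obtain f where f: "a = pact S' f v'" using \<open>a \<in> W'\<close> C'(3) by blast
    have "S' a = pact S' (pCons 0 f) v'" by (simp add: f C'(7))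
    then have "h (S' a) = pact S (pCons 0 f) z" using h by metis
    then show ?thesis by (simp add: f h C(7))
  qed
  ultimately show ?thesis unfolding congr_def by auto
qed

text \<open>One reference piece is fixed. Every piece of the same exponent is described by its
  multiplier \<open>\<beta>\<close> against the reference functional, and multipliers in one square
  class give congruent pieces.\<close>

lemma finite_classes_cyclic:
  assumes r: "irr r"
  shows "finite_classes {(W, S). \<exists>v. cyclic r k W S v} congr" (is "finite_classes ?X _")
proof (cases "?X = {}")
  case True
  then show ?thesis by (simp add: finite_classes_def)
next
  case False
  then obtain W0 S0 v0 where c0: "cyclic r k W0 S0 v0" by auto
  obtain \<kappa> :: "'f poly \<Rightarrow> 'f alg_closure set" where \<kappa>: "finite (range \<kappa>)"
    "\<And>\<beta> \<beta>'. \<beta> \<in> P0 \<Longrightarrow> \<beta>' \<in> P0 \<Longrightarrow> \<not> r dvd \<beta> \<Longrightarrow> \<not> r dvd \<beta>' \<Longrightarrow> \<kappa> \<beta> = \<kappa> \<beta>' \<Longrightarrow>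
      \<exists>y\<in>P0. r dvd \<beta>' - y ^ 2 * \<beta>"
    using finite_square_classes[OF r] by blast
  have "\<forall>x\<in>?X. \<exists>p. cyclic r k (fst x) (snd x) (fst p) \<and> snd p \<in> P0 \<and> \<not> r dvd snd p \<and>
      (\<forall>f\<in>P0. B (pact (snd x) f (fst p)) (fst p) = B (pact S0 (snd p * f) v0) v0)"
  proof
    fix x assume "x \<in> ?X"
    then obtain v where v: "cyclic r k (fst x) (snd x) v" by auto
    obtain \<beta> where "\<beta> \<in> P0" "\<not> r dvd \<beta>"
      "\<forall>f\<in>P0. B (pact (snd x) f v) v = B (pact S0 (\<beta> * f) v0) v0"
      using cyclic_transfer[OF c0 v r] by blast
    then show "\<exists>p. cyclic r k (fst x) (snd x) (fst p) \<and> snd p \<in> P0 \<and> \<not> r dvd snd p \<and>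
      (\<forall>f\<in>P0. B (pact (snd x) f (fst p)) (fst p) = B (pact S0 (snd p * f) v0) v0)"
      using v by (intro exI[of _ "(v, \<beta>)"]) simp
  qed
  from bchoice[OF this] obtain p where p: "\<forall>x\<in>?X. cyclic r k (fst x) (snd x) (fst (p x)) \<and>
      snd (p x) \<in> P0 \<and> \<not> r dvd snd (p x) \<and>
      (\<forall>f\<in>P0. B (pact (snd x) f (fst (p x))) (fst (p x)) = B (pact S0 (snd (p x) * f) v0) v0)" ..
  define v \<beta> where "v x = fst (p x)" and "\<beta> x = snd (p x)" for x
  have v: "cyclic r k (fst x) (snd x) (v x)" if "x \<in> ?X" for x
    using bspec[OF p that] by (simp add: v_def)
  have \<beta>: "\<beta> x \<in> P0" "\<not> r dvd \<beta> x"
    "f \<in> P0 \<Longrightarrow> B (pact (snd x) f (v x)) (v x) = B (pact S0 (\<beta> x * f) v0) v0" if "x \<in> ?X" for x f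
    using bspec[OF p that] by (simp_all add: v_def \<beta>_def)
  show ?thesis
  proof (rule finite_classesI)
    show "finite ((\<lambda>x. \<kappa> (\<beta> x)) ` ?X)" by (rule finite_subset[OF _ \<kappa>(1)]) auto
    fix x x' assume x: "x \<in> ?X" "x' \<in> ?X" and eq: "\<kappa> (\<beta> x) = \<kappa> (\<beta> x')"
    obtain y where "y \<in> P0" "r dvd \<beta> x - y ^ 2 * \<beta> x'"
      using \<kappa>(2)[OF \<beta>(1)[OF x(2)] \<beta>(1)[OF x(1)] \<beta>(2)[OF x(2)] \<beta>(2)[OF x(1)] eq[symmetric]] by blast
    then obtain Y where Y: "Y \<in> P0" "r ^ Suc (k - 1) dvd \<beta> x - Y ^ 2 * \<beta> x'"
      using square_mod_power[OF r \<beta>(1)[OF x(2)] \<beta>(1)[OF x(1)] _ _ \<beta>(2)[OF x(1)]] by blast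
    \<comment> \<open>\<open>square_mod_power\<close> yields exponents of the form
      \<open>Suc\<close>, which reach \<open>k\<close> because \<open>k > 0\<close>.\<close>
    have k: "Suc (k - 1) = k" using cyclicD(4)[OF c0] by simp
    note S0 = cyclicD(7)[OF c0]
    have "congr (fst x, snd x) (fst x', snd x')"
    proof (rule cyclic_congr[OF v[OF x(2)] v[OF x(1)] r Y(1)])
      fix f assume f: "f \<in> P0"
      have "pact S0 ((\<beta> x - Y ^ 2 * \<beta> x') * f) v0 = 0"
        using Y(2)[unfolded k] cyclic_annihilator[OF c0 r] by simp
      then have "pact S0 (\<beta> x * f) v0 = pact S0 (\<beta> x' * (Y ^ 2 * f)) v0"
        by (simp add: left_diff_distrib pact_diff[OF S0] mult.left_commute mult.assoc)
      then show "B (pact (snd x) f (v x)) (v x) = B (pact (snd x') (Y ^ 2 * f) (v x')) (v x')"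
        using \<beta>(3)[OF x(1) f] \<beta>(3)[OF x(2), of "Y ^ 2 * f"] f Y(1) by simp
    qed
    then show "congr x x'" by simp
  qed
qed

text \<open>For \<open>f\<close> in \<open>P0\<close> the form \<open>B (pact S f u) v\<close> is
  hermitian on \<open>W\<close>, and by polarization a hermitian form that vanishes on the diagonal
  vanishes.\<close>

lemma ex_anisotropic:
  assumes W: "sa W S" and f: "f \<in> P0" and w: "w \<in> W" "pact S f w \<noteq> 0"
  shows "\<exists>v\<in>W. B (pact S f v) v \<noteq> 0"
proof (rule ccontr)
  assume "\<not> ?thesis"
  then have 0: "B (pact S f v) v = 0" if "v \<in> W" for v using that by blast
  note S = saD(1)[OF W]
  have "pact S f w \<in> W" using saD(7)[OF W w(1)] .
  then obtain u where u: "u \<in> W" "B (pact S f w) u \<noteq> 0"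
    using nondegD[OF saD(3)[OF W]] w(2) by blast
  define x where "x = B (pact S f w) u"
  \<comment> \<open>With this normalization both cross terms in the expansion at
    \<open>?w + u\<close> equal 1 and add up to 2.\<close>
  let ?w = "scale (1 / x) w"
  have w': "?w \<in> W" using w(1) saD(2)[OF W] by (rule subspace_scale[rotated])
  have wu: "B (pact S f ?w) u = 1"
    using u(2) by (simp add: endoD[OF endo_pact[OF S]] x_def)
  have "B (pact S f u) ?w = B u (pact S f ?w)"
    using saD(8)[OF W u(1) w', of f] f by (simp add: P0_iff)
  then have uw: "B (pact S f u) ?w = 1" using wu B_sym[of u] by simp
  have "B (pact S f (?w + u)) (?w + u) = 0"
    using w' u(1) saD(2)[OF W] by (intro 0 subspace_add)
  moreover have "B (pact S f (?w + u)) (?w + u)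
      = B (pact S f ?w) ?w + B (pact S f u) u + B (pact S f ?w) u + B (pact S f u) ?w"
    unfolding endoD(1)[OF endo_pact[OF S]] B_add_left B_add_right by simp
  ultimately have "(1 :: 'f) + 1 = 0" unfolding 0[OF w'] 0[OF u(1)] wu uw by simp
  then show False using two_neq_0 by simp
qed

text \<open>For the least exponent \<open>k\<close> killing \<open>W\<close>, the operator
  \<open>r^(k-1)(S)\<close> is nonzero and has an anisotropic vector \<open>v\<close>; what
  \<open>v\<close> generates is then nondegenerate and splits off.\<close>

lemma split_cyclic:
  assumes r: "irr r" and W: "sa W S" "W \<noteq> {0}" and nil: "\<And>w. w \<in> W \<Longrightarrow> pact S (r ^ m) w = 0"
  shows "\<exists>k W1 W2 v. cyclic r k W1 S v \<and> orth_sum W W1 W2 \<and> sa W2 S"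
proof -
  note S = saD(1)[OF W(1)]
  define k where "k = (LEAST k. \<forall>w\<in>W. pact S (r ^ k) w = 0)"
  have k: "pact S (r ^ k) w = 0" if "w \<in> W" for w
    using LeastI[of "\<lambda>k. \<forall>w\<in>W. pact S (r ^ k) w = 0" m] nil that unfolding k_def by blast
  have "k > 0"
  proof (rule ccontr)
    assume "\<not> k > 0"
    then have "w = 0" if "w \<in> W" for w using k[OF that] S by simp
    then show False using W subspace_0[OF saD(2)[OF W(1)]] by blast
  qed
  then have "\<not> (\<forall>w\<in>W. pact S (r ^ (k - 1)) w = 0)"
    unfolding k_def by (intro not_less_Least) simp
  then obtain v where v: "v \<in> W" "B (pact S (r ^ (k - 1)) v) v \<noteq> 0"
    using ex_anisotropic[OF W(1), of "r ^ (k - 1)"] irrD[OF r] by blast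
  define W1 where "W1 = range (\<lambda>f. pact S f v)"
  have sub: "subspace W1"
    unfolding subspace_def
  proof (intro conjI ballI allI)
    show "0 \<in> W1" unfolding W1_def by (rule range_eqI[of _ _ 0]) simp
  next
    fix x y assume "x \<in> W1" "y \<in> W1"
    then obtain f g where "x = pact S f v" "y = pact S g v" by (auto simp: W1_def)
    then have "x + y = pact S (f + g) v" by (simp add: pact_add[OF S])
    then show "x + y \<in> W1" by (simp add: W1_def)
  next
    fix c x assume "x \<in> W1"
    then obtain f where "x = pact S f v" by (auto simp: W1_def)
    then have "scale c x = pact S (smult c f) v" by (simp add: pact_smult[OF S])
    then show "scale c x \<in> W1" by (simp add: W1_def)
  qed
  have W1W: "W1 \<subseteq> W" using saD(7)[OF W(1) v(1)] by (auto simp: W1_def)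
  have inv: "S ` W1 \<subseteq> W1"
  proof
    fix x assume "x \<in> S ` W1"
    then obtain f where "x = pact S (pCons 0 f) v" by (auto simp: W1_def S)
    then show "x \<in> W1" by (simp add: W1_def)
  qed
  have nd: "nondeg W1"
    unfolding nondeg_def
  proof (intro ballI impI)
    fix u assume u: "u \<in> W1" "\<forall>w\<in>W1. B u w = 0"
    then obtain f where f: "u = pact S f v" by (auto simp: W1_def)
    have "B (pact S (f * g) v) v = 0" if g: "g \<in> P0" for g
    proof -
      have "B (pact S f v) (pact S g v) = 0" using u f by (auto simp: W1_def)
      then show ?thesis using g by (simp add: form_pact[OF W(1) v(1)] P0_iff mult.commute)
    qed
    then have "r ^ k dvd f" by (rule dvd_of_orthogonal[OF W(1) v(1) r k[OF v(1)] v(2)])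
    then show "u = 0" using pact_dvd[OF S _ k[OF v(1)]] f by blast
  qed
  define W2 where "W2 = {w \<in> W. \<forall>u\<in>W1. B w u = 0}"
  note oc = orth_complement[OF W(1) sub W1W nd inv, folded W2_def]
  note sa12 = orth_sum_sa[OF oc(1) W(1) inv oc(2)]
  have "v \<in> W1" unfolding W1_def by (rule range_eqI[of _ _ 1]) (simp add: S)
  then have "cyclic r k W1 S v"
    using sa12(1) \<open>k > 0\<close> k[OF v(1)] v(2) unfolding cyclic_def W1_def by blast
  then show ?thesis using oc(1) sa12(2) by blast
qed

text \<open>This leaves finitely many exponents to be coloured.\<close>

lemma cyclic_exponent_le:
  assumes c: "cyclic r k W S v" and r: "irr r"
  shows "k \<le> 2 * dimension"
proof -
  obtain f where f: "f \<noteq> 0" "Polynomial.degree f \<le> 2 * dimension" "pact S f v = 0"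
    using ex_annihilator[OF cyclicD(7)[OF c]] by blast
  then have "r ^ k dvd f" using cyclic_annihilator[OF c r] by blast
  then have "Polynomial.degree (r ^ k) \<le> 2 * dimension" using f(1,2) dvd_imp_degree_le order_trans by blast
  moreover have "Polynomial.degree (r ^ k) = k * Polynomial.degree r"
    using irrD(2)[OF r] by (simp add: degree_power_eq)
  moreover have "k * 1 \<le> k * Polynomial.degree r" using r by (intro mult_le_mono2) (simp add: irr_def)
  ultimately show ?thesis by linarith
qed

lemma orth_sum_dim_less:
  assumes "orth_sum W W1 W2" "nondeg W1" "subspace W" "W1 \<noteq> {0}"
  shows "dim W2 < dim W"
proof (rule ccontr)
  have sub: "subspace W1" "subspace W2" "W1 \<subseteq> W" "W2 \<subseteq> W" using assms(1) by (auto simp: orth_sum_def)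
  assume "\<not> ?thesis"
  then have "W2 = W" using sub assms(3) by (intro subspace_dim_equal) auto
  then have "B u v = 0" if "u \<in> W1" "v \<in> W1" for u v
    using assms(1) that by (auto simp: orth_sum_def)
  then have "u = 0" if "u \<in> W1" for u using nondegD[OF assms(2)] that by blast
  then show False using assms(4) subspace_0[OF sub(1)] by blast
qed

lemma orth_sum_commute: "orth_sum W W1 W2 \<Longrightarrow> orth_sum W W2 W1"
  unfolding orth_sum_def by (metis B_eq_0_sym add.commute)

lemma congr_glue:
  assumes sum: "orth_sum W W1 W2" "orth_sum W' W1' W2'"
    and sa: "sa W S" "sa W' S'" "sa W1 S" "sa W2 S" "sa W1' S'" "sa W2' S'"
    and c: "congr (W1, S) (W1', S')" "congr (W2, S) (W2', S')"
  shows "congr (W, S) (W', S')"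
proof -
  obtain g1 where g1: "isom W1 W1' g1" "\<And>w. w \<in> W1 \<Longrightarrow> g1 (S w) = S' (g1 w)"
    using c(1) by (auto simp: congr_def)
  obtain g2 where g2: "isom W2 W2' g2" "\<And>w. w \<in> W2 \<Longrightarrow> g2 (S w) = S' (g2 w)"
    using c(2) by (auto simp: congr_def)
  obtain g where g: "isom W W' g" "\<And>u v. u \<in> W1 \<Longrightarrow> v \<in> W2 \<Longrightarrow> g (u + v) = g1 u + g2 v"
    using isom_glue[OF sum saD(3)[OF sa(3)] saD(3)[OF sa(4)] saD(3)[OF sa(5)] saD(3)[OF sa(6)]
        saD(2)[OF sa(1)] saD(2)[OF sa(2)] g1(1) g2(1)] by blast
  have "g (S w) = S' (g w)" if "w \<in> W" for w
  proof -
    from that obtain u v where uv: "u \<in> W1" "v \<in> W2" "w = u + v" using sum(1) by (auto simp: orth_sum_def)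
    have "g (S w) = g1 (S u) + g2 (S v)"
      using uv saD(5)[OF sa(3)] saD(5)[OF sa(4)] by (simp add: endoD[OF saD(1)[OF sa(1)]] g)
    then show ?thesis using uv by (simp add: g g1 g2 endoD[OF saD(1)[OF sa(2)]])
  qed
  then show ?thesis using g(1) by (auto simp: congr_def)
qed

text \<open>Induction on the dimension, with one splitting chosen for each pair. Both pieces carry
  the same operator, so intertwining isometries of the pieces glue.\<close>

lemma finite_classes_primary:
  assumes r: "irr r"
  shows "finite_classes {(W, S). sa W S \<and> dim W \<le> n \<and> (\<exists>m. \<forall>w\<in>W. pact S (r ^ m) w = 0)} congr"
proof (induction n)
  case 0
  have "congr x y" if "sa (fst x) (snd x)" "dim (fst x) = 0" "sa (fst y) (snd y)" "dim (fst y) = 0" for x y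
  proof -
    have "fst x = {0}" "fst y = {0}" using that subspace_0[OF saD(2)] by (auto 4 3)
    then show ?thesis
      using that by (auto simp: congr_def isom_def endoD[OF saD(1)] intro!: exI[of _ "\<lambda>x. x"])
  qed
  then show ?case by (intro finite_classesI[of "\<lambda>_. ()"]) auto
next
  case (Suc n)
  let ?X = "\<lambda>n. {(W, S). sa W S \<and> dim W \<le> n \<and> (\<exists>m. \<forall>w\<in>W. pact S (r ^ m) w = 0)}"
  let ?C = "\<lambda>k. {(W, S). \<exists>v. cyclic r k W S v}"
  let ?Y = "{x \<in> ?X (Suc n). fst x \<noteq> {0}}"
  have C: "finite_classes (\<Union>k\<in>{..2 * dimension}. ?C k) congr"
    by (rule finite_classes_UN[where I = "{..2 * dimension}" and A = ?C]) (auto intro: finite_classes_cyclic[OF r])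
  have "\<forall>x\<in>?Y. \<exists>p. (fst p, snd x) \<in> (\<Union>k\<in>{..2 * dimension}. ?C k) \<and> (snd p, snd x) \<in> ?X n \<and>
      orth_sum (fst x) (fst p) (snd p)"
  proof
    fix x assume x: "x \<in> ?Y"
    obtain W S where xW: "x = (W, S)" by (cases x)
    obtain m where "\<forall>w\<in>W. pact S (r ^ m) w = 0" using x unfolding xW by auto
    then have W: "x = (W, S)" "sa W S" "W \<noteq> {0}" "dim W \<le> Suc n"
      "\<And>w. w \<in> W \<Longrightarrow> pact S (r ^ m) w = 0" using x unfolding xW by simp_all
    obtain k W1 W2 v where split: "cyclic r k W1 S v" "orth_sum W W1 W2" "sa W2 S"
      using split_cyclic[OF r W(2,3,5)] by blast
    have "W1 \<noteq> {0}" using cyclicD(2,6)[OF split(1)] endoD(3)[OF endo_pact[OF cyclicD(7)[OF split(1)]]] by auto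
    then have "dim W2 \<le> n"
      using orth_sum_dim_less[OF split(2) saD(3)[OF cyclicD(1)[OF split(1)]] saD(2)[OF W(2)]] W(4) by simp
    moreover have "\<forall>w\<in>W2. pact S (r ^ m) w = 0" using split(2) W(5) by (auto simp: orth_sum_def)
    ultimately have "(W2, snd x) \<in> ?X n" using split(3) W(1) by auto
    moreover have "(W1, snd x) \<in> (\<Union>k\<in>{..2 * dimension}. ?C k)"
      using split(1) cyclic_exponent_le[OF split(1) r] W(1) by auto
    ultimately show "\<exists>p. (fst p, snd x) \<in> (\<Union>k\<in>{..2 * dimension}. ?C k) \<and> (snd p, snd x) \<in> ?X n \<and>
      orth_sum (fst x) (fst p) (snd p)"
      using split(2) W(1) by (intro exI[of _ "(W1, W2)"]) simp
  qed
  from bchoice[OF this] obtain p where p: "\<forall>x\<in>?Y. (fst (p x), snd x) \<in> (\<Union>k\<in>{..2 * dimension}. ?C k) \<and>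
      (snd (p x), snd x) \<in> ?X n \<and> orth_sum (fst x) (fst (p x)) (snd (p x))" ..
  define f g where "f x = fst (p x)" and "g x = snd (p x)" for x
  have fg: "(f x, snd x) \<in> (\<Union>k\<in>{..2 * dimension}. ?C k)" "(g x, snd x) \<in> ?X n"
    "orth_sum (fst x) (f x) (g x)" if "x \<in> ?Y" for x
    using bspec[OF p that] unfolding f_def g_def by blast+
  have Y: "finite_classes ?Y congr"
  proof (rule finite_classes_pair[OF C Suc fg(1,2)])
    fix x y assume x: "x \<in> ?Y" and y: "y \<in> ?Y"
      and c: "congr (f x, snd x) (f y, snd y)" "congr (g x, snd x) (g y, snd y)"
    have "sa (f z) (snd z)" "sa (g z) (snd z)" "sa (fst z) (snd z)" if "z \<in> ?Y" for z
      using fg(1,2)[OF that] that by (auto dest: cyclicD(1))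
    then have "congr (fst x, snd x) (fst y, snd y)"
      by (intro congr_glue[OF fg(3)[OF x] fg(3)[OF y] _ _ _ _ _ _ c]) (use x y in blast)+
    then show "congr x y" by simp
  qed
  have "finite_classes (?X (Suc n)) congr"
  proof (rule finite_classes_UN[where I = "{True, False}" and A = "\<lambda>b. if b then ?Y else ?X n"])
    show "?X (Suc n) \<subseteq> (\<Union>b\<in>{True, False}. if b then ?Y else ?X n)" by auto
  qed (use Y Suc in auto)
  then show ?case .
qed

end

section \<open>Classes of centralizers\<close>

lemma pcompose_power: "pcompose (p ^ n) q = pcompose p q ^ n"
  by (induction n) (auto simp: pcompose_1 pcompose_mult)

lemma ex_power_decomposition:
  fixes p q :: "'a :: Fields.field poly"
  assumes "Polynomial.degree p > 0" "q \<noteq> 0"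
  shows "\<exists>m r. q = p ^ m * r \<and> \<not> p dvd r"
  using assms(2)
proof (induction "Polynomial.degree q" arbitrary: q rule: less_induct)
  case less
  show ?case
  proof (cases "p dvd q")
    case False
    then show ?thesis by (intro exI[of _ 0] exI[of _ q]) simp
  next
    case True
    then obtain r where r: "q = p * r" by blast
    then have "r \<noteq> 0" "Polynomial.degree r < Polynomial.degree q"
      using less.prems assms(1) by (auto simp: degree_mult_eq)
    then obtain m s where "r = p ^ m * s" "\<not> p dvd s" using less.hyps by blast
    then show ?thesis by (intro exI[of _ "Suc m"] exI[of _ s]) (simp add: r)
  qed
qed

context hermitian_space
begin

text \<open>
  An isometry \<open>g\<close> conjugates the isometries commuting with the first operator to those commuting with
  the second; \<open>c'\<close> stands for \<open>g c g\<^sup>-\<^sup>1\<close>.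
\<close>

definition zequiv :: "'v set \<times> ('v \<Rightarrow> 'v) \<Rightarrow> 'v set \<times> ('v \<Rightarrow> 'v) \<Rightarrow> bool" where
  "zequiv x y \<longleftrightarrow> (\<exists>g. isom (fst x) (fst y) g \<and>
     (\<forall>c c'. isom (fst x) (fst x) c \<longrightarrow> isom (fst y) (fst y) c' \<longrightarrow> (\<forall>w\<in>fst x. c' (g w) = g (c w)) \<longrightarrow>
        (\<forall>w\<in>fst x. c (snd x w) = snd x (c w)) = (\<forall>w\<in>fst y. c' (snd y w) = snd y (c' w))))"

lemma zequivI:
  assumes "isom W W' g"
    and "\<And>c c'. isom W W c \<Longrightarrow> isom W' W' c' \<Longrightarrow> \<forall>w\<in>W. c' (g w) = g (c w) \<Longrightarrow>
      (\<forall>w\<in>W. c (S w) = S (c w)) = (\<forall>w\<in>W'. c' (S' w) = S' (c' w))"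
  shows "zequiv (W, S) (W', S')"
  unfolding zequiv_def fst_conv snd_conv by (intro exI[of _ g] conjI allI impI assms)

lemma isom_pact_commute:
  assumes W: "subspace W" "nondeg W" "S ` W \<subseteq> W" "endo S" and c: "isom W W c"
    and comm: "\<And>w. w \<in> W \<Longrightarrow> c (S w) = S (c w)" and w: "w \<in> W"
  shows "c (pact S p w) = pact S p (c w)"
  by (rule pact_intertwine[OF W(4,1,3,4)]) (use isom_linear(1,2)[OF c W(1,2,1,2)] comm w in auto)

text \<open>On \<open>W\<close> the operators \<open>S\<close> and \<open>T\<close> are polynomials
  in each other.\<close>

lemma isom_commute_pact_iff:
  assumes sa: "sa W S" and T: "T = pact S s" and G: "\<And>w. w \<in> W \<Longrightarrow> S w = pact T G w" and c: "isom W W c"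
  shows "(\<forall>w\<in>W. c (S w) = S (c w)) \<longleftrightarrow> (\<forall>w\<in>W. c (T w) = T (c w))"
proof
  note W = saD[OF sa]
  assume "\<forall>w\<in>W. c (S w) = S (c w)"
  then show "\<forall>w\<in>W. c (T w) = T (c w)"
    unfolding T using isom_pact_commute[OF W(2,3,4,1) c] by blast
next
  note W = saD[OF sa]
  assume *: "\<forall>w\<in>W. c (T w) = T (c w)"
  show "\<forall>w\<in>W. c (S w) = S (c w)"
  proof
    fix w assume w: "w \<in> W"
    have "T ` W \<subseteq> W" unfolding T using W(7) by auto
    then have "c (pact T G w) = pact T G (c w)"
      using * w by (intro isom_pact_commute[OF W(2,3) _ _ c]) (auto simp: T endo_pact[OF W(1)])
    moreover have "c w \<in> W" using c w by (auto simp: isom_def)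
    ultimately show "c (S w) = S (c w)" using G w by simp
  qed
qed

text \<open>\<open>T\<close> and \<open>T'\<close> generate the same algebras as \<open>S\<close>
  and \<open>S'\<close>. An isometry intertwining \<open>T\<close> and \<open>T'\<close> therefore
  conjugates the centralizers, although it need not intertwine \<open>S\<close> and
  \<open>S'\<close>.\<close>

lemma zequiv_of_congr:
  assumes sa: "sa W S" "sa W' S'" and T: "T = pact S s" "T' = pact S' s'"
    and G: "\<And>w. w \<in> W \<Longrightarrow> S w = pact T G w" "\<And>w. w \<in> W' \<Longrightarrow> S' w = pact T' G' w"
    and cong: "congr (W, T) (W', T')"
  shows "zequiv (W, S) (W', S')"
proof -
  note W = saD[OF sa(1)] and W' = saD[OF sa(2)]
  obtain g where g: "isom W W' g" "\<And>w. w \<in> W \<Longrightarrow> g (T w) = T' (g w)"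
    using cong by (auto simp: congr_def)
  have gW: "g ` W = W'" using g(1) by (simp add: isom_def)
  have inj: "inj_on g W" by (rule isom_linear(3)[OF g(1) W(2,3) W'(2,3)])
  have TW: "T w \<in> W" if "w \<in> W" for w using W(7) that by (simp add: T)
  have "(\<forall>w\<in>W. c (S w) = S (c w)) = (\<forall>w\<in>W'. c' (S' w) = S' (c' w))"
    if c: "isom W W c" "isom W' W' c'" and cc: "\<forall>w\<in>W. c' (g w) = g (c w)" for c c'
  proof -
    have cW: "c w \<in> W" if "w \<in> W" for w using c(1) that by (auto simp: isom_def)
    have "(\<forall>w\<in>W. c (T w) = T (c w)) = (\<forall>w\<in>W. g (c (T w)) = g (T (c w)))"
      using cW TW by (intro ball_cong refl inj_on_eq_iff[OF inj, symmetric]) auto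
    also have "\<dots> = (\<forall>w\<in>W. c' (T' (g w)) = T' (c' (g w)))"
      using cc g(2) cW TW by (metis (no_types, lifting))
    also have "\<dots> = (\<forall>w\<in>W'. c' (T' w) = T' (c' w))"
      unfolding gW[symmetric] by simp
    finally show ?thesis
      using isom_commute_pact_iff[OF sa(1) T(1) G(1) c(1)] isom_commute_pact_iff[OF sa(2) T(2) G(2) c(2)]
      by blast
  qed
  then show ?thesis by (rule zequivI[OF g(1)])
qed

lemma zequiv_trivial:
  assumes "W = {0}" "W' = {0}" "endo S" "endo S'"
  shows "zequiv (W, S) (W', S')"
  using assms unfolding zequiv_def by (intro exI[of _ "\<lambda>x. x"]) (auto simp: isom_def endoD)

lemma sa_pact:
  assumes sa: "sa W S" and s: "s \<in> P0" shows "sa W (pact S s)"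
  using saD[OF sa] s unfolding sa_def by (auto simp: P0_iff endo_pact)

text \<open>The new generator \<open>s(S)\<close> is primary for one of the finitely many
  \<open>r\<close>, and \<open>G\<close> recovers \<open>S\<close> from it.\<close>

lemma ex_primary_replacement:
  assumes sa: "sa W S" "W \<noteq> {0}" and p: "irr p" and nil: "\<And>w. w \<in> W \<Longrightarrow> pact S (p ^ m) w = 0"
    and R: "\<And>p. irr p \<Longrightarrow> Polynomial.degree p \<le> 2 * dimension \<Longrightarrow>
        \<exists>r\<in>R. irr r \<and> (\<exists>f\<in>P0. \<exists>h\<in>P0. p dvd pcompose r f \<and> p dvd pcompose h f - [:0, 1:])"
  shows "\<exists>r\<in>R. \<exists>s\<in>P0. \<exists>G. (\<forall>w\<in>W. S w = pact (pact S s) G w) \<and>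
      (\<forall>w\<in>W. pact (pact S s) (r ^ m) w = 0)"
proof -
  note S = saD(1)[OF sa(1)]
  \<comment> \<open>\<open>R\<close> covers degrees up to \<open>2 * dimension\<close>;
    \<open>p\<close> obeys this bound because it divides an annihilator of a nonzero vector.\<close>
  obtain w where w: "w \<in> W" "w \<noteq> 0" using sa(2) subspace_0[OF saD(2)[OF sa(1)]] by blast
  obtain f where f: "f \<in> P0" "f \<noteq> 0" "Polynomial.degree f \<le> 2 * dimension" "pact S f w = 0"
    using ex_annihilator[OF S] by blast
  have "p dvd f"
  proof (rule ccontr)
    assume "\<not> p dvd f"
    then obtain u v where uv: "u * f + v * p ^ m = 1" using irr_coprime_power[OF p f(1)] by blast
    have "pact S (u * f + v * p ^ m) w = 0"
      using pact_dvd[OF S dvd_triv_right f(4)] pact_dvd[OF S dvd_triv_right nil[OF w(1)]]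
      by (simp add: pact_add[OF S])
    then show False using w(2) by (simp add: uv S)
  qed
  then have "Polynomial.degree p \<le> 2 * dimension" using f(2,3) dvd_imp_degree_le order_trans by blast
  then obtain r f h where r: "r \<in> R" "irr r" "f \<in> P0" "h \<in> P0"
    "p dvd pcompose r f" "p dvd pcompose h f - [:0, 1:]" using R[OF p] by blast
  obtain s where s: "s \<in> P0" "p dvd pcompose h s - [:0, 1:]" "p dvd pcompose r s" "\<not> p ^ 2 dvd pcompose r s"
    using ex_uniformizing_root[OF p r(2-6)] by blast
  have "[:0, 1:] \<in> P0" by simp
  then obtain G where G: "p ^ m dvd [:0, 1:] - pcompose G s"
    using P0_mod_power_generated[OF p irrD(1)[OF r(2)] r(4) s(1-4)] by blast
  have "S w = pact (pact S s) G w" if "w \<in> W" for w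
    using pact_dvd[OF S G nil[OF that]] by (simp add: pact_diff[OF S] pact_X[OF S] pact_pcompose[OF S] S endoD[OF S])
  moreover have d: "p ^ m dvd pcompose (r ^ m) s"
    using dvd_power_same[OF s(3)] by (simp add: pcompose_power)
  have "pact (pact S s) (r ^ m) w = 0" if "w \<in> W" for w
    using pact_dvd[OF S d nil[OF that]] by (simp add: pact_pcompose[OF S])
  ultimately show ?thesis using r(1) s(1) by blast
qed

lemma finite_classes_zequiv_primary:
  "finite_classes {(W, S). sa W S \<and> (\<exists>p m. irr p \<and> (\<forall>w\<in>W. pact S (p ^ m) w = 0))} zequiv"
    (is "finite_classes ?A _")
proof -
  from finite_irr_representatives[of "2 * dimension"]
  obtain R where R0: "finite R \<and> (\<forall>r\<in>R. irr r) \<and>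
     (\<forall>p. irr p \<and> Polynomial.degree p \<le> 2 * dimension \<longrightarrow>
        (\<exists>r\<in>R. \<exists>f\<in>P0. \<exists>h\<in>P0. p dvd pcompose r f \<and> p dvd pcompose h f - [:0, 1:]))" ..
  have R: "finite R" "\<And>r. r \<in> R \<Longrightarrow> irr r" using R0 by simp_all
  have R': "\<exists>r\<in>R. irr r \<and> (\<exists>f\<in>P0. \<exists>h\<in>P0. p dvd pcompose r f \<and> p dvd pcompose h f - [:0, 1:])"
    if "irr p" "Polynomial.degree p \<le> 2 * dimension" for p
    using R0 that by meson
  let ?P = "\<lambda>r. {(W, S). sa W S \<and> dim W \<le> dimension \<and> (\<exists>m. \<forall>w\<in>W. pact S (r ^ m) w = 0)}"
  have P: "finite_classes (\<Union>r\<in>R. ?P r) congr"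
    by (rule finite_classes_UN[OF R(1), where A = ?P]) (auto intro: finite_classes_primary R(2))
  let ?N = "{x \<in> ?A. fst x \<noteq> {0}}"
  have "\<forall>x\<in>?N. \<exists>s. s \<in> P0 \<and> (\<exists>G. \<forall>w\<in>fst x. snd x w = pact (pact (snd x) s) G w) \<and>
      (fst x, pact (snd x) s) \<in> (\<Union>r\<in>R. ?P r)"
  proof
    fix x assume x: "x \<in> ?N"
    obtain W S where xW: "x = (W, S)" by (cases x)
    obtain p m where pm: "irr p" "\<And>w. w \<in> W \<Longrightarrow> pact S (p ^ m) w = 0" using x unfolding xW by auto
    have W: "sa W S" "W \<noteq> {0}" using x unfolding xW by auto
    obtain r s G where "r \<in> R" "s \<in> P0" "\<forall>w\<in>W. S w = pact (pact S s) G w"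
      "\<forall>w\<in>W. pact (pact S s) (r ^ m) w = 0"
      using ex_primary_replacement[OF W pm R'] by blast
    moreover have "dim W \<le> dimension" by (rule dim_subset_UNIV)
    ultimately show "\<exists>s. s \<in> P0 \<and> (\<exists>G. \<forall>w\<in>fst x. snd x w = pact (pact (snd x) s) G w) \<and>
      (fst x, pact (snd x) s) \<in> (\<Union>r\<in>R. ?P r)"
      using sa_pact[OF W(1)] unfolding xW by (intro exI[of _ s]) auto
  qed
  from bchoice[OF this] obtain s where s: "\<forall>x\<in>?N. s x \<in> P0 \<and>
      (\<exists>G. \<forall>w\<in>fst x. snd x w = pact (pact (snd x) (s x)) G w) \<and>
      (fst x, pact (snd x) (s x)) \<in> (\<Union>r\<in>R. ?P r)" ..
  have N: "finite_classes ?N zequiv"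
  proof (rule finite_classes_map[OF P, where f = "\<lambda>x. (fst x, pact (snd x) (s x))"])
    show "(fst x, pact (snd x) (s x)) \<in> (\<Union>r\<in>R. ?P r)" if "x \<in> ?N" for x
      using bspec[OF s that] by blast
    fix x y assume x: "x \<in> ?N" and y: "y \<in> ?N"
      and c: "congr (fst x, pact (snd x) (s x)) (fst y, pact (snd y) (s y))"
    obtain G where G: "\<forall>w\<in>fst x. snd x w = pact (pact (snd x) (s x)) G w" using bspec[OF s x] by blast
    obtain G' where G': "\<forall>w\<in>fst y. snd y w = pact (pact (snd y) (s y)) G' w" using bspec[OF s y] by blast
    have "sa (fst x) (snd x)" "sa (fst y) (snd y)" using x y by auto
    from zequiv_of_congr[OF this refl refl bspec[OF G] bspec[OF G'] c]
    show "zequiv x y" by simp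
  qed
  \<comment> \<open>The zero space has no nonzero vector that could bound the degree of
    \<open>p\<close>; it forms a class of its own.\<close>
  have Z: "finite_classes {x \<in> ?A. fst x = {0}} zequiv"
  proof (rule finite_classesI[of "\<lambda>_. ()"])
    fix x y assume "x \<in> {x \<in> ?A. fst x = {0}}" "y \<in> {x \<in> ?A. fst x = {0}}"
    then have "fst x = {0}" "fst y = {0}" "endo (snd x)" "endo (snd y)" by (auto dest: saD(1))
    from zequiv_trivial[OF this] show "zequiv x y" by simp
  qed simp
  show ?thesis
    by (rule finite_classes_UN[where I = "{True, False}" and
          A = "\<lambda>b. if b then ?N else {x \<in> ?A. fst x = {0}}"]) (use N Z in auto)
qed

section \<open>Gluing along primary components\<close>

lemma isom_restrict:
  assumes sum: "orth_sum W W1 W2" and W: "subspace W" "nondeg W" "nondeg W1" and c: "isom W W c"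
    and inv: "\<And>w. w \<in> W1 \<Longrightarrow> c w \<in> W1" "\<And>w. w \<in> W2 \<Longrightarrow> c w \<in> W2"
  shows "isom W1 W1 c"
proof -
  have sub: "subspace W1" "subspace W2" "W1 \<subseteq> W" "W2 \<subseteq> W" using sum by (auto simp: orth_sum_def)
  have "w \<in> c ` W1" if w: "w \<in> W1" for w
  proof -
    have "w \<in> c ` W" using c w sub(3) by (auto simp: isom_def)
    then obtain x where x: "x \<in> W" "w = c x" by blast
    obtain u v where uv: "u \<in> W1" "v \<in> W2" "x = u + v" using sum x(1) by (auto simp: orth_sum_def)
    have "c x = c u + c v"
      using uv sub isom_linear(1)[OF c W(1,2,1,2)] by auto
    then have "c v = w - c u" using x by simp
    then have "c v \<in> W1" using inv(1)[OF uv(1)] w sub(1) by (auto intro: subspace_diff)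
    moreover have "B u (c v) = 0" if "u \<in> W1" for u
      using sum inv(2)[OF uv(2)] that by (auto simp: orth_sum_def)
    \<comment> \<open>\<open>c v\<close> lies in \<open>W1\<close> and is orthogonal to it, so
      \<open>w\<close> is already the image of \<open>u\<close>.\<close>
    ultimately have "c v = 0" using nondegD[OF W(3)] B_eq_0_sym by metis
    then show ?thesis using \<open>c v = w - c u\<close> uv(1) by auto
  qed
  then show ?thesis using c inv sub unfolding isom_def by blast
qed

text \<open>The summands are kernels of polynomials in the operators, so an isometry commuting with
  the operator preserves them, and commutation can be tested on each summand.\<close>

lemma zequiv_glue:
  assumes sum: "orth_sum W W1 W2" "orth_sum W' W1' W2'"
    and sa: "sa W S" "sa W' S'" "sa W1 S" "sa W2 S" "sa W1' S'" "sa W2' S'"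
    and K: "W1 = {w \<in> W. pact S p w = 0}" "W2 = {w \<in> W. pact S q w = 0}"
      "W1' = {w \<in> W'. pact S' p' w = 0}" "W2' = {w \<in> W'. pact S' q' w = 0}"
    and z: "zequiv (W1, S) (W1', S')" "zequiv (W2, S) (W2', S')"
  shows "zequiv (W, S) (W', S')"
proof -
  obtain g1 where g1: "isom W1 W1' g1" and z1: "\<And>c c'. isom W1 W1 c \<Longrightarrow> isom W1' W1' c' \<Longrightarrow>
      (\<forall>w\<in>W1. c' (g1 w) = g1 (c w)) \<Longrightarrow>
      (\<forall>w\<in>W1. c (S w) = S (c w)) = (\<forall>w\<in>W1'. c' (S' w) = S' (c' w))"
    using z(1) unfolding zequiv_def by auto
  obtain g2 where g2: "isom W2 W2' g2" and z2: "\<And>c c'. isom W2 W2 c \<Longrightarrow> isom W2' W2' c' \<Longrightarrow>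
      (\<forall>w\<in>W2. c' (g2 w) = g2 (c w)) \<Longrightarrow>
      (\<forall>w\<in>W2. c (S w) = S (c w)) = (\<forall>w\<in>W2'. c' (S' w) = S' (c' w))"
    using z(2) unfolding zequiv_def by auto
  note W = saD[OF sa(1)] and W' = saD[OF sa(2)] and W1 = saD[OF sa(3)] and W2 = saD[OF sa(4)]
    and W1' = saD[OF sa(5)] and W2' = saD[OF sa(6)]
  obtain g where g: "isom W W' g" "\<And>u v. u \<in> W1 \<Longrightarrow> v \<in> W2 \<Longrightarrow> g (u + v) = g1 u + g2 v"
    using isom_glue[OF sum W1(3) W2(3) W1'(3) W2'(3) W(2) W'(2) g1 g2] by blast
  have sub: "W1 \<subseteq> W" "W2 \<subseteq> W" "W1' \<subseteq> W'" "W2' \<subseteq> W'" using sum by (auto simp: orth_sum_def)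
  have gg1: "g u = g1 u" if "u \<in> W1" for u
    using g(2)[OF that subspace_0[OF W2(2)]] isom_linear(4)[OF g2 W2(2,3) W2'(2,3)] by simp
  have gg2: "g v = g2 v" if "v \<in> W2" for v
    using g(2)[OF subspace_0[OF W1(2)] that] isom_linear(4)[OF g1 W1(2,3) W1'(2,3)] by simp
  have gW1: "g ` W1 = W1'" using g1 gg1 by (simp add: isom_def)
  have gW2: "g ` W2 = W2'" using g2 gg2 by (simp add: isom_def)
  have inj: "inj_on g W" by (rule isom_linear(3)[OF g(1) W(2,3) W'(2,3)])
  have "(\<forall>w\<in>W. c (S w) = S (c w)) = (\<forall>w\<in>W'. c' (S' w) = S' (c' w))"
    if c: "isom W W c" "isom W' W' c'" and cc: "\<forall>w\<in>W. c' (g w) = g (c w)" for c c'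
  proof -
    have cW: "c w \<in> W" if "w \<in> W" for w using c(1) that by (auto simp: isom_def)
    have c'W: "c' w \<in> W'" if "w \<in> W'" for w using c(2) that by (auto simp: isom_def)
    have restrict: "(\<forall>w\<in>W. c (S w) = S (c w)) = (\<forall>w\<in>W'. c' (S' w) = S' (c' w))"
      if i: "isom W1 W1 c" "isom W2 W2 c" "isom W1' W1' c'" "isom W2' W2' c'"
    proof -
      have 1: "(\<forall>w\<in>W1. c (S w) = S (c w)) = (\<forall>w\<in>W1'. c' (S' w) = S' (c' w))"
      proof (rule z1[OF i(1,3)], rule ballI)
        fix w assume w: "w \<in> W1"
        then have "c w \<in> W1" using i(1) by (auto simp: isom_def)
        then show "c' (g1 w) = g1 (c w)" using cc gg1 w sub(1) by (metis subsetD)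
      qed
      have 2: "(\<forall>w\<in>W2. c (S w) = S (c w)) = (\<forall>w\<in>W2'. c' (S' w) = S' (c' w))"
      proof (rule z2[OF i(2,4)], rule ballI)
        fix w assume w: "w \<in> W2"
        then have "c w \<in> W2" using i(2) by (auto simp: isom_def)
        then show "c' (g2 w) = g2 (c w)" using cc gg2 w sub(2) by (metis subsetD)
      qed
      have split: "(\<forall>w\<in>U. d (Q w) = Q (d w)) \<longleftrightarrow> (\<forall>w\<in>U1. d (Q w) = Q (d w)) \<and> (\<forall>w\<in>U2. d (Q w) = Q (d w))"
        if os: "orth_sum U U1 U2" and U: "sa U Q" and d: "isom U U d" for U U1 U2 Q d
      proof (intro iffI conjI ballI)
        note lin = isom_linear(1)[OF d saD(2,3)[OF U] saD(2,3)[OF U]]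
        fix w assume *: "(\<forall>w\<in>U1. d (Q w) = Q (d w)) \<and> (\<forall>w\<in>U2. d (Q w) = Q (d w))" and "w \<in> U"
        then obtain u v where uv: "u \<in> U1" "v \<in> U2" "w = u + v" using os unfolding orth_sum_def by blast
        then have "u \<in> U" "v \<in> U" using os by (auto simp: orth_sum_def)
        then show "d (Q w) = Q (d w)"
          using * uv saD(5)[OF U] by (simp add: endoD(1)[OF saD(1)[OF U]] lin)
      qed (use os in \<open>auto simp: orth_sum_def\<close>)
      show ?thesis
        unfolding split[OF sum(1) sa(1) c(1)] split[OF sum(2) sa(2) c(2)] 1 2 ..
    qed
    show ?thesis
    \<comment> \<open>If \<open>c\<close> commutes, it preserves the summands, and its conjugate
      \<open>c'\<close> preserves theirs. The symmetric case starts from \<open>c'\<close>; if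
      neither commutes, both sides are false.\<close>
    proof (cases "\<forall>w\<in>W. c (S w) = S (c w)")
      case True
      have ker: "c w \<in> W \<and> pact S f (c w) = 0" if "w \<in> W" "pact S f w = 0" for f w
        using isom_pact_commute[OF W(2,3,4,1) c(1) _ that(1), of f] True cW[OF that(1)] that(2)
          isom_linear(4)[OF c(1) W(2,3,2,3)] by auto
      have inv: "c w \<in> W1" if "w \<in> W1" for w using ker that by (auto simp: K)
      have inv2: "c w \<in> W2" if "w \<in> W2" for w using ker that by (auto simp: K)
      have i1: "isom W1 W1 c" by (rule isom_restrict[OF sum(1) W(2,3) W1(3) c(1) inv inv2])
      have i2: "isom W2 W2 c" by (rule isom_restrict[OF orth_sum_commute[OF sum(1)] W(2,3) W2(3) c(1) inv2 inv])
      have im: "isom U' U' c'" if U: "isom U U c" "g ` U = U'" "U \<subseteq> W" for U U'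
      proof -
        have "c' ` U' = g ` c ` U" using cc U by (force simp: image_iff)
        then have "c' ` U' = U'" using U by (simp add: isom_def)
        moreover have "U' \<subseteq> W'" using U g(1) by (auto simp: isom_def)
        ultimately show ?thesis using c(2) unfolding isom_def by blast
      qed
      show ?thesis by (rule restrict[OF i1 i2 im[OF i1 gW1 sub(1)] im[OF i2 gW2 sub(2)]])
    next
      case False
      show ?thesis
      proof (cases "\<forall>w\<in>W'. c' (S' w) = S' (c' w)")
        case True
        have ker: "c' w \<in> W' \<and> pact S' f (c' w) = 0" if "w \<in> W'" "pact S' f w = 0" for f w
          using isom_pact_commute[OF W'(2,3,4,1) c(2) _ that(1), of f] True c'W[OF that(1)] that(2)
            isom_linear(4)[OF c(2) W'(2,3,2,3)] by auto
        have inv: "c' w \<in> W1'" if "w \<in> W1'" for w using ker that by (auto simp: K)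
        have inv2: "c' w \<in> W2'" if "w \<in> W2'" for w using ker that by (auto simp: K)
        have i1: "isom W1' W1' c'" by (rule isom_restrict[OF sum(2) W'(2,3) W1'(3) c(2) inv inv2])
        have i2: "isom W2' W2' c'" by (rule isom_restrict[OF orth_sum_commute[OF sum(2)] W'(2,3) W2'(3) c(2) inv2 inv])
        have im: "isom U U c" if U: "isom U' U' c'" "g ` U = U'" "U \<subseteq> W" for U U'
        proof -
          have "g ` c ` U = c' ` U'" using cc U by (force simp: image_iff)
          then have "g ` c ` U = g ` U" using U by (simp add: isom_def)
          moreover have "c ` U \<subseteq> W" using cW U(3) by blast
          ultimately have "c ` U = U" using inj_on_image_eq_iff[OF inj _ U(3)] by blast
          then show ?thesis using c(1) U(3) unfolding isom_def by blast
        qed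
        show ?thesis by (rule restrict[OF im[OF i1 gW1 sub(1)] im[OF i2 gW2 sub(2)] i1 i2])
      qed (use False in blast)
    qed
  qed
  then show ?thesis by (rule zequivI[OF g(1)])
qed

text \<open>An annihilating polynomial of least degree factors into coprime \<open>p^m\<close> and
  \<open>r\<close>. Least degree makes the kernel of \<open>p^m\<close> nonzero, and the assumption
  that \<open>W\<close> is not primary does so for \<open>r\<close>.\<close>

lemma split_coprime:
  assumes sa: "sa W S" and n0: "W \<noteq> {0}"
    and np: "\<nexists>p m. irr p \<and> (\<forall>w\<in>W. pact S (p ^ m) w = 0)"
  shows "\<exists>p q. let W1 = {w \<in> W. pact S p w = 0}; W2 = {w \<in> W. pact S q w = 0} in
    orth_sum W W1 W2 \<and> sa W1 S \<and> sa W2 S \<and> W1 \<noteq> {0} \<and> W2 \<noteq> {0}"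
proof -
  note W = saD[OF sa]
  let ?A = "\<lambda>q. q \<in> P0 \<and> q \<noteq> 0 \<and> (\<forall>w\<in>W. pact S q w = 0)"
  obtain q where q: "?A q" and min: "\<And>y. ?A y \<Longrightarrow> Polynomial.degree q \<le> Polynomial.degree y"
  proof -
    obtain q0 where "?A q0" using ex_global_annihilator[OF W(1)] by blast
    from ex_has_least_nat[of ?A, OF this, of Polynomial.degree] show ?thesis using that by blast
  qed
  have "Polynomial.degree q > 0"
  proof (rule ccontr)
    assume "\<not> Polynomial.degree q > 0"
    then obtain a where a: "q = [:a:]" using degree_eq_zeroE by blast
    then have "scale a w = 0" if "w \<in> W" for w using q that by (auto simp: W(1) endoD[OF W(1)])
    moreover have "a \<noteq> 0" using q a by auto
    ultimately have "w = 0" if "w \<in> W" for w using that by auto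
    then show False using n0 subspace_0[OF W(2)] by blast
  qed
  from ex_irr_dvd[OF conjunct1[OF q] this] obtain p where p: "irr p" "p dvd q" by blast
  note pP = irrD[OF p(1)]
  obtain m r where m: "q = p ^ m * r" "\<not> p dvd r"
  proof -
    have "Polynomial.degree p > 0" using p(1) by (simp add: irr_def)
    from ex_power_decomposition[OF this conjunct1[OF conjunct2[OF q]]] show ?thesis using that by blast
  qed
  have "m > 0" using m p(2) by (cases m) auto
  have "p ^ m * r div p ^ m = r" using pP by simp
  then have rP: "r \<in> P0" using P0_div[OF conjunct1[OF q] P0_power[OF pP(1)], of m] m(1) by simp
  have r0: "r \<noteq> 0" using m q by auto
  obtain u v where uv: "u \<in> P0" "v \<in> P0" "u * r + v * p ^ m = 1"
    using irr_coprime_power[OF p(1) rP m(2)] by blast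
  define W1 where "W1 = {w \<in> W. pact S (p ^ m) w = 0}"
  define W2 where "W2 = {w \<in> W. pact S r w = 0}"
  have one: "w = pact S (u * r) w + pact S (v * p ^ m) w" for w
    using pact_add[OF W(1), of "u * r" "v * p ^ m" w] by (simp add: uv W(1))
  have sub: "subspace {w \<in> W. pact S f w = 0}" and inv: "S ` {w \<in> W. pact S f w = 0} \<subseteq> {w \<in> W. pact S f w = 0}" for f
    using W(2,5) by (auto simp: subspace_def endoD[OF endo_pact[OF W(1)]] pact_S[OF W(1)] endoD[OF W(1)])
  have os: "orth_sum W W1 W2"
    unfolding orth_sum_def
  proof (intro conjI ballI)
    show "subspace W1" "subspace W2" "W1 \<subseteq> W" "W2 \<subseteq> W" using sub by (auto simp: W1_def W2_def)
  next
    fix w assume w: "w \<in> W"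
    have q0: "pact S q w = 0" using q w by blast
    have "p ^ m * (u * r) = q * u" "r * (v * p ^ m) = q * v" by (simp_all add: m(1) mult_ac)
    then have "pact S (p ^ m * (u * r)) w = 0" "pact S (r * (v * p ^ m)) w = 0"
      using pact_dvd[OF W(1) dvd_triv_left q0] by (simp_all only:)
    then have "pact S (p ^ m) (pact S (u * r) w) = 0" "pact S r (pact S (v * p ^ m) w) = 0"
      unfolding pact_mult[OF W(1), of "p ^ m"] pact_mult[OF W(1), of r "v * p ^ m"] by simp_all
    then have "pact S (u * r) w \<in> W1" "pact S (v * p ^ m) w \<in> W2"
      using W(7)[OF w] by (auto simp: W1_def W2_def)
    then show "\<exists>u\<in>W1. \<exists>v\<in>W2. w = u + v" using one by blast
  next
    \<comment> \<open>\<open>(v * p^m)(S)\<close> is self-adjoint, the identity on \<open>W2\<close>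
      and zero on \<open>W1\<close>.\<close>
    fix x y assume x: "x \<in> W1" and y: "y \<in> W2"
    have "pact S (u * r) y = 0"
      by (rule pact_dvd[OF W(1) dvd_triv_right]) (use y in \<open>simp add: W2_def\<close>)
    then have "B x y = B x (pact S (v * p ^ m) y)" using one[of y] by simp
    also have "\<dots> = B (pact S (v * p ^ m) x) y"
      using W(8)[of x y "v * p ^ m"] x y P0_mult[OF uv(2) P0_power[OF pP(1), of m]]
      unfolding P0_iff by (simp add: W1_def W2_def)
    also have "pact S (v * p ^ m) x = 0"
      by (rule pact_dvd[OF W(1) dvd_triv_right]) (use x in \<open>simp add: W1_def\<close>)
    finally show "B x y = 0" by simp
  qed
  have sas: "sa W1 S" "sa W2 S"
    by (rule orth_sum_sa[OF os sa]; simp only: W1_def W2_def inv)+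
  have "W2 \<noteq> {0}"
  proof
    assume W2: "W2 = {0}"
    have "pact S (p ^ m) w = 0" if "w \<in> W" for w
    proof -
      obtain a b where "a \<in> W1" "b \<in> W2" "w = a + b" using os \<open>w \<in> W\<close> unfolding orth_sum_def by blast
      then show ?thesis using W2 by (simp add: W1_def)
    qed
    then show False using np p(1) by blast
  qed
  moreover have "W1 \<noteq> {0}"
  proof
    assume W1: "W1 = {0}"
    have "pact S r w = 0" if "w \<in> W" for w
    proof -
      obtain a b where "a \<in> W1" "b \<in> W2" "w = a + b" using os \<open>w \<in> W\<close> unfolding orth_sum_def by blast
      then show ?thesis using W1 by (simp add: W2_def)
    qed
    then have "Polynomial.degree q \<le> Polynomial.degree r" using min rP r0 by blast
    moreover have "Polynomial.degree q = m * Polynomial.degree p + Polynomial.degree r"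
      using r0 pP by (simp add: m(1) degree_mult_eq degree_power_eq)
    moreover have "m * Polynomial.degree p > 0" using \<open>m > 0\<close> p(1) by (simp add: irr_def)
    ultimately show False by linarith
  qed
  ultimately show ?thesis
    using os sas by (intro exI[of _ "p ^ m"] exI[of _ r]) (simp add: W1_def W2_def Let_def)
qed

lemma finite_classes_zequiv: "finite_classes {(W, S). sa W S \<and> dim W \<le> n} zequiv"
proof (induction n)
  case 0
  show ?case
  proof (rule finite_classesI[of "\<lambda>_. ()"])
    fix x y assume "x \<in> {(W, S). sa W S \<and> dim W \<le> 0}" "y \<in> {(W, S). sa W S \<and> dim W \<le> 0}"
    then have "endo (snd x)" "endo (snd y)" "fst x \<subseteq> {0}" "fst y \<subseteq> {0}" "0 \<in> fst x" "0 \<in> fst y"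
      using subspace_0[OF saD(2)] by (auto dest: saD(1))
    then have "zequiv (fst x, snd x) (fst y, snd y)" by (intro zequiv_trivial) auto
    then show "zequiv x y" by simp
  qed simp
next
  case (Suc n)
  let ?A = "\<lambda>n. {(W, S). sa W S \<and> dim W \<le> n}"
  let ?P = "{(W, S). sa W S \<and> (\<exists>p m. irr p \<and> (\<forall>w\<in>W. pact S (p ^ m) w = 0))}"
  let ?K = "\<lambda>x p. {w \<in> fst x. pact (snd x) p w = 0}"
  let ?N = "{x \<in> ?A (Suc n). fst x \<noteq> {0} \<and> x \<notin> ?P}"
  have "\<forall>x\<in>?N. \<exists>p. orth_sum (fst x) (?K x (fst p)) (?K x (snd p)) \<and>
      (?K x (fst p), snd x) \<in> ?A n \<and> (?K x (snd p), snd x) \<in> ?A n"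
  proof
    fix x assume x: "x \<in> ?N"
    obtain W S where xW: "x = (W, S)" by (cases x)
    have W: "sa W S" "dim W \<le> Suc n" "W \<noteq> {0}" "\<nexists>p m. irr p \<and> (\<forall>w\<in>W. pact S (p ^ m) w = 0)"
      using x unfolding xW by auto
    obtain p q where pq: "orth_sum W (?K x p) (?K x q)" "sa (?K x p) S" "sa (?K x q) S"
      "?K x p \<noteq> {0}" "?K x q \<noteq> {0}"
      using split_coprime[OF W(1,3,4)] unfolding xW Let_def fst_conv snd_conv by blast
    have "dim (?K x q) < dim W" "dim (?K x p) < dim W"
      using orth_sum_dim_less[OF pq(1) saD(3)[OF pq(2)] saD(2)[OF W(1)] pq(4)]
        orth_sum_dim_less[OF orth_sum_commute[OF pq(1)] saD(3)[OF pq(3)] saD(2)[OF W(1)] pq(5)] by auto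
    then have "dim (?K x q) \<le> n" "dim (?K x p) \<le> n" using W(2) by linarith+
    then show "\<exists>p. orth_sum (fst x) (?K x (fst p)) (?K x (snd p)) \<and>
      (?K x (fst p), snd x) \<in> ?A n \<and> (?K x (snd p), snd x) \<in> ?A n"
      using pq(1-3) by (intro exI[of _ "(p, q)"]) (simp add: xW)
  qed
  from bchoice[OF this] obtain p where p: "\<forall>x\<in>?N. orth_sum (fst x) (?K x (fst (p x))) (?K x (snd (p x))) \<and>
      (?K x (fst (p x)), snd x) \<in> ?A n \<and> (?K x (snd (p x)), snd x) \<in> ?A n" ..
  have N: "finite_classes ?N zequiv"
  proof (rule finite_classes_pair[OF Suc Suc,
        where f = "\<lambda>x. (?K x (fst (p x)), snd x)" and g = "\<lambda>x. (?K x (snd (p x)), snd x)"])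
    fix x y assume x: "x \<in> ?N" and y: "y \<in> ?N"
      and z: "zequiv (?K x (fst (p x)), snd x) (?K y (fst (p y)), snd y)"
        "zequiv (?K x (snd (p x)), snd x) (?K y (snd (p y)), snd y)"
    have "sa (fst x) (snd x)" "sa (fst y) (snd y)" using x y by auto
    moreover have "sa (?K x (fst (p x))) (snd x)" "sa (?K x (snd (p x))) (snd x)"
      "sa (?K y (fst (p y))) (snd y)" "sa (?K y (snd (p y))) (snd y)"
      using bspec[OF p x] bspec[OF p y] by simp_all
    moreover have "orth_sum (fst x) (?K x (fst (p x))) (?K x (snd (p x)))"
      "orth_sum (fst y) (?K y (fst (p y))) (?K y (snd (p y)))"
      using bspec[OF p x] bspec[OF p y] by blast+
    ultimately have "zequiv (fst x, snd x) (fst y, snd y)"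
      by (intro zequiv_glue[OF _ _ _ _ _ _ _ _ refl refl refl refl z])
    then show "zequiv x y" by simp
  qed (use p in blast)+
  show ?case
  \<comment> \<open>Every pair is splittable, primary or of dimension at most \<open>n\<close>; the
    zero space falls under the last.\<close>
  proof (rule finite_classes_UN[where I = "{0, 1, 2 :: nat}" and
        A = "\<lambda>i. if i = 0 then ?N else if i = 1 then ?P else ?A n"])
    have "dim W \<le> n" if "W = {0}" for W using that by simp
    then show "?A (Suc n) \<subseteq> (\<Union>i\<in>{0, 1, 2 :: nat}. if i = 0 then ?N else if i = 1 then ?P else ?A n)"
      by auto
  qed (use N Suc finite_classes_zequiv_primary in auto)
qed

end

section \<open>Cayley transform and finiteness\<close>

lemma finite_quotient_of_classes:
  assumes "equiv A r" "finite_classes A (\<lambda>x y. (x, y) \<in> r)"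
  shows "finite (A // r)"
proof -
  obtain \<kappa> :: "'a \<Rightarrow> nat" where \<kappa>: "finite (\<kappa> ` A)"
    "\<And>x y. x \<in> A \<Longrightarrow> y \<in> A \<Longrightarrow> \<kappa> x = \<kappa> y \<Longrightarrow> (x, y) \<in> r"
    using assms(2) unfolding finite_classes_def by blast
  have "A // r \<subseteq> (\<lambda>n. r `` {inv_into A \<kappa> n}) ` \<kappa> ` A"
  proof
    fix C assume "C \<in> A // r"
    then obtain x where x: "x \<in> A" "C = r `` {x}" by (auto elim: quotientE)
    have "inv_into A \<kappa> (\<kappa> x) \<in> A" "\<kappa> (inv_into A \<kappa> (\<kappa> x)) = \<kappa> x"
      using x(1) by (auto intro: inv_into_into f_inv_into_f)
    then have "(x, inv_into A \<kappa> (\<kappa> x)) \<in> r" using \<kappa>(2) x(1) by simp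
    then have "C = r `` {inv_into A \<kappa> (\<kappa> x)}" using equiv_class_eq[OF assms(1)] x(2) by blast
    then show "C \<in> (\<lambda>n. r `` {inv_into A \<kappa> n}) ` \<kappa> ` A" using x(1) by blast
  qed
  then show ?thesis using \<kappa>(1) finite_surj by blast
qed

context hermitian_space
begin

abbreviation U where "U \<equiv> unitary_group scale B"

lemma U_simps: "f \<otimes>\<^bsub>U\<^esub> g = f \<circ> g" "\<one>\<^bsub>U\<^esub> = id"
  by (simp_all add: unitary_group_def general_linear_group_def)

lemma U_iff: "g \<in> carrier U \<longleftrightarrow> endo g \<and> bij g \<and> (\<forall>u v. B (g u) (g v) = B u v)"
  by (simp add: unitary_group_def general_linear_group_def)

sublocale U: group U
  by (rule group_unitary_group) unfold_locales

lemma nondeg_UNIV: "nondeg UNIV"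
  using nondegenerate_B unfolding nondeg_def nondegenerate_def by blast

lemma U_iff_isom: "g \<in> carrier U \<longleftrightarrow> isom UNIV UNIV g"
proof
  assume "isom UNIV UNIV g"
  moreover from isom_linear[OF this subspace_UNIV nondeg_UNIV subspace_UNIV nondeg_UNIV]
  have "endo g" "inj g" by (auto intro: endoI)
  ultimately show "g \<in> carrier U" by (auto simp: U_iff isom_def bij_def)
qed (auto simp: U_iff isom_def bij_def)

lemma centralizer_iff: "c \<in> centralizer U T \<longleftrightarrow> c \<in> carrier U \<and> (\<forall>v. c (T v) = T (c v))"
  by (auto simp: centralizer_def U_simps fun_eq_iff)

text \<open>The elements \<open>(a + \<delta>) / (a - \<delta>)\<close> with \<open>a\<close> fixed
  have norm 1 and are pairwise distinct, hence infinite in number, while all eigenvalues of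
  \<open>T\<close> are roots of one nonzero polynomial.\<close>

lemma ex_nonresonant:
  assumes inf: "infinite {a. \<sigma> a = a}" and T: "endo T"
  shows "\<exists>\<zeta>. \<zeta> * \<sigma> \<zeta> = 1 \<and> (\<forall>v. T v = scale \<zeta> v \<longrightarrow> v = 0)"
proof -
  obtain \<delta> where \<delta>: "\<delta> \<noteq> 0" "\<sigma> \<delta> = - \<delta>" using ex_skew by blast
  have d0: "a - \<delta> \<noteq> 0" "a + \<delta> \<noteq> 0" if "\<sigma> a = a" for a
  proof -
    have "\<delta> \<noteq> - \<delta>" using \<delta>(1) two_neq_0 by (metis add_eq_0_iff mult_2 mult_eq_0_iff)
    then show "a - \<delta> \<noteq> 0" "a + \<delta> \<noteq> 0" using that \<delta>
      by (metis eq_iff_diff_eq_0, metis add_eq_0_iff conj_minus minus_minus)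
  qed
  let ?f = "\<lambda>a. (a + \<delta>) / (a - \<delta>)"
  have "inj_on ?f {a. \<sigma> a = a}"
  proof (rule inj_onI)
    fix a b assume "a \<in> {a. \<sigma> a = a}" "b \<in> {a. \<sigma> a = a}" and eq: "?f a = ?f b"
    then have "(a + \<delta>) * (b - \<delta>) = (b + \<delta>) * (a - \<delta>)" using d0 by (simp add: frac_eq_eq)
    then have "2 * \<delta> * (b - a) = 0" by (simp add: algebra_simps)
    then show "a = b" using \<delta> two_neq_0 by simp
  qed
  then have inf': "infinite (?f ` {a. \<sigma> a = a})" using inf by (simp add: finite_image_iff)
  obtain q where q: "q \<noteq> 0" "\<And>w. pact T q w = 0" using ex_global_annihilator[OF T] by blast
  have "finite {x. poly q x = 0}" using q(1) by (rule poly_roots_finite)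
  then obtain \<zeta> where \<zeta>: "\<zeta> \<in> ?f ` {a. \<sigma> a = a}" "poly q \<zeta> \<noteq> 0"
    using inf' by (metis (mono_tags, lifting) finite_subset mem_Collect_eq subsetI)
  obtain a where a: "\<sigma> a = a" "\<zeta> = (a + \<delta>) / (a - \<delta>)" using \<zeta>(1) by blast
  have "\<zeta> * \<sigma> \<zeta> = 1" 
  proof -
    have "\<sigma> \<zeta> = (a - \<delta>) / (a + \<delta>)" using a \<delta>(2) by simp
    then show ?thesis using d0[OF a(1)] a(2) by simp
  qed
  moreover have "v = 0" if v: "T v = scale \<zeta> v" for v
  proof -
    have "pact T p v = scale (poly p \<zeta>) v" for p
      by (induction p) (auto simp: T v endoD[OF T] scale_left_distrib mult.commute)
    then have "scale (poly q \<zeta>) v = 0" using q(2) by metis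
    then show ?thesis using \<zeta>(2) by simp
  qed
  ultimately show ?thesis by blast
qed

text \<open>
  The Cayley transform \<open>\<delta>(T + \<zeta>)(T - \<zeta>)\<^sup>-\<^sup>1\<close>, self-adjoint since \<open>\<zeta>\<close> has norm \<open>1\<close> and \<open>\<delta>\<close> is skew.
\<close>

lemma ex_cayley:
  assumes inf: "infinite {a. \<sigma> a = a}" and T: "T \<in> carrier U"
  shows "\<exists>S. sa UNIV S \<and> (\<forall>c. endo c \<longrightarrow> (\<forall>v. c (T v) = T (c v)) = (\<forall>v. c (S v) = S (c v)))"
proof -
  have Te: "endo T" and TB: "\<And>u v. B (T u) (T v) = B u v" using T by (auto simp: U_iff)
  note Tl = endoD[OF Te]
  obtain \<zeta> where \<zeta>: "\<zeta> * \<sigma> \<zeta> = 1" "\<And>v. T v = scale \<zeta> v \<Longrightarrow> v = 0"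
    using ex_nonresonant[OF inf Te] by blast
  obtain \<delta> where \<delta>: "\<delta> \<noteq> 0" "\<sigma> \<delta> = - \<delta>" using ex_skew by blast
  have \<zeta>0: "\<zeta> \<noteq> 0" using \<zeta>(1) by auto
  define M where "M v = T v - scale \<zeta> v" for v
  have Me: "endo M" by (rule endoI) (auto simp: M_def Tl scale_right_distrib scale_right_diff_distrib scale_left_commute)
  note Ml = endoD[OF Me]
  have "inj M"
  proof (rule injI)
    fix x y assume "M x = M y"
    then have "M (x - y) = 0" by (simp add: Ml)
    then have "x - y = 0" by (intro \<zeta>(2)) (simp add: M_def)
    then show "x = y" by simp
  qed
  then have "surj M" using linear_inj_imp_surj[OF Me] by blast
  define N where "N = inv_into UNIV M"
  have MN: "M (N v) = v" for v using \<open>surj M\<close> by (simp add: N_def surj_f_inv_f)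
  have NM: "N (M v) = v" for v using \<open>inj M\<close> by (simp add: N_def)
  have Ne: "endo N"
  proof (rule endoI)
    show "N (u + v) = N u + N v" for u v by (metis MN NM Ml(1))
    show "N (scale a u) = scale a (N u)" for a u by (metis MN NM Ml(2))
  qed
  note Nl = endoD[OF Ne]
  \<comment> \<open>Since \<open>T + \<zeta> = M + 2 \<zeta>\<close>, this is
    \<open>\<delta> (T + \<zeta>)\<close> composed with the inverse \<open>N\<close> of
    \<open>M\<close>.\<close>
  define S where "S v = scale \<delta> (v + scale (2 * \<zeta>) (N v))" for v
  have Se: "endo S"
    by (rule endoI) (auto simp: S_def Nl scale_right_distrib scale_left_commute mult_ac)
  have SM: "S (M v) = scale \<delta> (T v + scale \<zeta> v)" for v
  proof -
    have "scale (2 * \<zeta>) v = scale \<zeta> v + scale \<zeta> v" by (metis mult_2 scale_left_distrib)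
    then show ?thesis unfolding S_def NM by (simp add: M_def)
  qed
  have "B (S u) v = B u (S v)" for u v
  proof -
    \<comment> \<open>The vectors \<open>M x\<close> fill the space, and on them \<open>N\<close>
      disappears. Unitarity and norm 1 cancel two terms and leave a skew identity, whose sign the
      skew \<open>\<delta>\<close> corrects.\<close>
    have "B (S (M x)) (M y) = B (M x) (S (M y))" for x y
    proof -
      have "B (T x + scale \<zeta> x) (M y) = B (T x) (T y) - \<sigma> \<zeta> * B (T x) y + \<zeta> * B x (T y) - (\<zeta> * \<sigma> \<zeta>) * B x y"
        "B (M x) (T y + scale \<zeta> y) = B (T x) (T y) + \<sigma> \<zeta> * B (T x) y - \<zeta> * B x (T y) - (\<zeta> * \<sigma> \<zeta>) * B x y"
        by (simp_all add: M_def algebra_simps)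
      then have "B (T x + scale \<zeta> x) (M y) = - B (M x) (T y + scale \<zeta> y)"
        unfolding TB \<zeta>(1) by simp
      then show ?thesis unfolding SM B_scale_left B_scale_right \<delta>(2)
        by (simp only: mult_minus_left mult_minus_right)
    qed
    then show ?thesis using MN by metis
  qed
  then have "sa UNIV S" using Se nondeg_UNIV by (simp add: sa_def)
  moreover have "(\<forall>v. c (T v) = T (c v)) = (\<forall>v. c (S v) = S (c v))" if c: "endo c" for c
  proof -
    note cl = endoD[OF c]
    \<comment> \<open>From \<open>T\<close> to \<open>M\<close> to \<open>N\<close> to
      \<open>S\<close>, each operator is the inverse or an invertible affine function of the
      previous one, so all commute with the same maps.\<close>
    have "(\<forall>v. c (T v) = T (c v)) = (\<forall>v. c (M v) = M (c v))" by (simp add: M_def cl)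
    also have "\<dots> = (\<forall>v. c (N v) = N (c v))" by (metis MN NM)
    also have "\<dots> = (\<forall>v. c (S v) = S (c v))"
      using \<delta>(1) \<zeta>0 two_neq_0 by (simp add: S_def cl)
    finally show ?thesis .
  qed
  ultimately show ?thesis by blast
qed

text \<open>With \<open>c' = g c g^-1\<close>, the condition in \<open>zequiv\<close> says that
  conjugation by \<open>g\<close> carries one centralizer onto the other.\<close>

lemma z_rel_of_zequiv:
  assumes T: "T \<in> carrier U" "T' \<in> carrier U"
    and S: "\<And>c. endo c \<Longrightarrow> (\<forall>v. c (T v) = T (c v)) = (\<forall>v. c (S v) = S (c v))"
    and S': "\<And>c. endo c \<Longrightarrow> (\<forall>v. c (T' v) = T' (c v)) = (\<forall>v. c (S' v) = S' (c v))"
    and z: "zequiv (UNIV, S) (UNIV, S')"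
  shows "(T, T') \<in> z_rel U"
proof -
  obtain g where g: "isom UNIV UNIV g" and gz: "\<And>c c'. isom UNIV UNIV c \<Longrightarrow> isom UNIV UNIV c' \<Longrightarrow>
      (\<forall>w. c' (g w) = g (c w)) \<Longrightarrow> (\<forall>w. c (S w) = S (c w)) = (\<forall>w. c' (S' w) = S' (c' w))"
    using z unfolding zequiv_def by auto
  have gU: "g \<in> carrier U" using g U_iff_isom by blast
  have *: "c \<in> centralizer U T \<longleftrightarrow> c' \<in> centralizer U T'"
    if c: "c \<in> carrier U" "c' \<in> carrier U" and e: "c' \<circ> g = g \<circ> c" for c c'
  proof -
    have "endo c" "endo c'" using c by (auto simp: U_iff)
    moreover have "\<forall>w. c' (g w) = g (c w)" using e by (auto simp: fun_eq_iff)
    ultimately show ?thesis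
      using gz[of c c'] c S S' unfolding centralizer_iff U_iff_isom by simp
  qed
  have conj: "(g <#\<^bsub>U\<^esub> H) #>\<^bsub>U\<^esub> (inv\<^bsub>U\<^esub> g) = (\<lambda>s. g \<otimes>\<^bsub>U\<^esub> s \<otimes>\<^bsub>U\<^esub> inv\<^bsub>U\<^esub> g) ` H" for H
    by (auto simp: l_coset_def r_coset_def)
  have "centralizer U T' = (\<lambda>s. g \<otimes>\<^bsub>U\<^esub> s \<otimes>\<^bsub>U\<^esub> inv\<^bsub>U\<^esub> g) ` centralizer U T"
  proof (intro subset_antisym subsetI)
    fix c' assume c': "c' \<in> centralizer U T'"
    then have c'U: "c' \<in> carrier U" by (simp add: centralizer_iff)
    define c where "c = inv\<^bsub>U\<^esub> g \<otimes>\<^bsub>U\<^esub> c' \<otimes>\<^bsub>U\<^esub> g"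
    have cU: "c \<in> carrier U" using gU c'U by (simp add: c_def)
    have gc: "g \<otimes>\<^bsub>U\<^esub> c = c' \<otimes>\<^bsub>U\<^esub> g" using gU c'U by (simp add: c_def U.m_assoc[symmetric])
    then have "c \<in> centralizer U T" using *[OF cU c'U] c' by (simp add: U_simps)
    moreover have "c' = g \<otimes>\<^bsub>U\<^esub> c \<otimes>\<^bsub>U\<^esub> inv\<^bsub>U\<^esub> g" unfolding gc using gU c'U by (simp add: U.m_assoc)
    ultimately show "c' \<in> (\<lambda>s. g \<otimes>\<^bsub>U\<^esub> s \<otimes>\<^bsub>U\<^esub> inv\<^bsub>U\<^esub> g) ` centralizer U T" by blast
  next
    fix c' assume "c' \<in> (\<lambda>s. g \<otimes>\<^bsub>U\<^esub> s \<otimes>\<^bsub>U\<^esub> inv\<^bsub>U\<^esub> g) ` centralizer U T"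
    then obtain c where c: "c \<in> centralizer U T" "c' = g \<otimes>\<^bsub>U\<^esub> c \<otimes>\<^bsub>U\<^esub> inv\<^bsub>U\<^esub> g" by blast
    have cU: "c \<in> carrier U" using c by (simp add: centralizer_iff)
    have c'U: "c' \<in> carrier U" using gU cU c(2) by simp
    have "c' \<otimes>\<^bsub>U\<^esub> g = g \<otimes>\<^bsub>U\<^esub> c" using gU cU by (simp add: c(2) U.m_assoc)
    then show "c' \<in> centralizer U T'" using *[OF cU c'U] c(1) by (simp add: U_simps)
  qed
  then have "centralizer U T' = (g <#\<^bsub>U\<^esub> centralizer U T) #>\<^bsub>U\<^esub> (inv\<^bsub>U\<^esub> g)" by (simp only: conj)
  then show ?thesis using T gU unfolding z_rel_def by blast
qed

lemma finite_z_classes_infinite: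
  assumes inf: "infinite {a. \<sigma> a = a}"
  shows "finite (z_classes U)"
proof -
  have "\<forall>T\<in>carrier U. \<exists>S. sa UNIV S \<and>
      (\<forall>c. endo c \<longrightarrow> (\<forall>v. c (T v) = T (c v)) = (\<forall>v. c (S v) = S (c v)))"
    using ex_cayley[OF inf] by blast
  from bchoice[OF this] obtain S where S: "\<forall>T\<in>carrier U. sa UNIV (S T) \<and>
      (\<forall>c. endo c \<longrightarrow> (\<forall>v. c (T v) = T (c v)) = (\<forall>v. c (S T v) = S T (c v)))" ..
  have "finite_classes (carrier U) (\<lambda>x y. (x, y) \<in> z_rel U)"
  proof (rule finite_classes_map[OF finite_classes_zequiv[of dimension], where f = "\<lambda>T. (UNIV, S T)"])
    show "(UNIV, S T) \<in> {(W, S). sa W S \<and> dim W \<le> dimension}" if "T \<in> carrier U" for T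
      using bspec[OF S that] dim_subset_UNIV by simp
    show "(T, T') \<in> z_rel U" if "T \<in> carrier U" "T' \<in> carrier U" "zequiv (UNIV, S T) (UNIV, S T')" for T T'
      using bspec[OF S that(1)] bspec[OF S that(2)] by (intro z_rel_of_zequiv[OF that(1,2) _ _ that(3)]) blast+
  qed
  then show ?thesis
    unfolding z_classes_def by (rule finite_quotient_of_classes[OF U.equiv_z_rel])
qed

lemma finite_z_classes_finite:
  assumes fin: "finite {a. \<sigma> a = a}"
  shows "finite (z_classes U)"
proof -
  obtain \<delta> where \<delta>: "\<delta> \<noteq> 0" "\<sigma> \<delta> = - \<delta>" using ex_skew by blast
  have "(4 :: 'f) = 2 * 2" by simp
  then have four: "(4 :: 'f) \<noteq> 0" using two_neq_0 by (metis mult_eq_0_iff)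
  \<comment> \<open>The large field is spanned by 1 and \<open>\<delta>\<close> over the fixed
    field, hence finite; so are \<open>V\<close> and the set of its self-maps.\<close>
  have "(UNIV :: 'f set) \<subseteq> (\<lambda>(a, b). a + \<delta> * b) ` ({a. \<sigma> a = a} \<times> {a. \<sigma> a = a})"
  proof
    fix x :: 'f
    have "x = (x + \<sigma> x) / 2 + \<delta> * ((x - \<sigma> x) / (2 * \<delta>))"
      using \<delta>(1) two_neq_0 four by (simp add: field_simps)
    moreover have "\<sigma> ((x + \<sigma> x) / 2) = (x + \<sigma> x) / 2" "\<sigma> ((x - \<sigma> x) / (2 * \<delta>)) = (x - \<sigma> x) / (2 * \<delta>)"
      using \<delta> two_neq_0 by (simp_all add: field_simps)
    ultimately show "x \<in> (\<lambda>(a, b). a + \<delta> * b) ` ({a. \<sigma> a = a} \<times> {a. \<sigma> a = a})"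
      by (intro image_eqI[of _ _ "((x + \<sigma> x) / 2, (x - \<sigma> x) / (2 * \<delta>))"]) auto
  qed
  then have F: "finite (UNIV :: 'f set)"
    by (rule finite_subset) (intro finite_imageI finite_cartesian_product fin)
  have "(UNIV :: 'v set) \<subseteq> (\<lambda>u. \<Sum>b\<in>Bs. scale (u b) b) ` (PiE Bs (\<lambda>_. UNIV :: 'f set))"
  proof
    fix v :: 'v
    have "v \<in> span Bs" by (simp add: span_Basis)
    then obtain u where u: "v = (\<Sum>b\<in>Bs. scale (u b) b)" unfolding span_finite[OF finite_Basis] by blast
    then have "v = (\<Sum>b\<in>Bs. scale (restrict u Bs b) b)" by simp
    then show "v \<in> (\<lambda>u. \<Sum>b\<in>Bs. scale (u b) b) ` (PiE Bs (\<lambda>_. UNIV :: 'f set))"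
      by (intro image_eqI[of _ _ "restrict u Bs"]) auto
  qed
  moreover have "finite (PiE Bs (\<lambda>_. UNIV :: 'f set))" using F finite_Basis by (intro finite_PiE) auto
  ultimately have "finite (UNIV :: 'v set)" by (meson finite_surj)
  then have "finite (PiE (UNIV :: 'v set) (\<lambda>_. UNIV :: 'v set))" by (intro finite_PiE) auto
  then have "finite (carrier U)" by (rule finite_subset[rotated]) auto
  then show ?thesis unfolding z_classes_def quotient_def by simp
qed

end

theorem theorem1p2:
  fixes \<sigma> :: "'f :: Fields.field \<Rightarrow> 'f"
    and scale :: "'f \<Rightarrow> 'v :: ab_group_add \<Rightarrow> 'v"
    and Bs :: "'v set"
    and B :: "'v \<Rightarrow> 'v \<Rightarrow> 'f"
  assumes "order_two_automorphism \<sigma>"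
    and "finite_dimensional_vector_space scale Bs"
    and "hermitian_form \<sigma> scale B"
    and "nondegenerate B"
    and "property_FE (fixed_field \<sigma>)"
  shows "finite (z_classes (unitary_group scale B))"
proof -
  interpret finite_dimensional_vector_space scale Bs by (fact assms(2))
  interpret hermitian_space \<sigma> scale Bs B
    by unfold_locales (use assms in auto)
  show ?thesis
    using finite_z_classes_infinite finite_z_classes_finite by blast
qed

end
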